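(* Let $M$ be a finite $\mathcal J$-above $Y$-semigroup and let $\delta=2+2\sup\{h_{\mathcal J}(m):m\in M\}\in\overline{\mathbb N}$. Then there exist nonempty sets $X_i$ and an embedding (injective monoid homomorphism) $\varphi:\sigma\mapsto\varphi_\sigma$ of $\mathrm{Rh}_Y(M^I)$ into an iterated wreath product of partial transformation monoids $\prod_{i=1}^{\delta}(X_i,M_i)=\cdots\circ(X_2,M_2)\circ(X_1,M_1)$ such that: (i) $M_{2k+1}$ is a submonoid of $\{\mathrm{Id}_{X_{2k+1}}\}\cup K(X_{2k+1})$ for $2k+1\le\delta$; (ii) $M_{2k+2}$ is a submonoid of $S(X_{2k+2})\cup K(X_{2k+2})$ for $2k+2\le\delta$, and if $\{R_\lambda:\lambda\in\Lambda\}$ is the set of all $\mathcal R$-classes of $M^I$ contained in $U_2(k)\cup U_3(k)\cup U_4(k)$, then $M_{2k+2}\cap S(X_{2k+2})\cong\bigoplus_{\lambda\in\Lambda}G'_\lambda$ with each $G'_\lambda$ a subgroup of $G_\lambda$; (iii) $\varphi$ has the Zeiger property. Moreover, if $Y$ is finite, then all $X_i$ (hence all $M_i$) are finite.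
   Context: $M^I$: $M$ with a new identity $I$. Finite $\mathcal J$-above: $\{y:y\ge_{\mathcal J}x\}$ finite for all $x$. $h_{\mathcal J}(m)$: largest $k$ with a chain $m=m_0<_{\mathcal J}\cdots<_{\mathcal J}m_k$ in $M^I$. $Y$-semigroup: $M$ with a surjective morphism $Y^+\to M$. $\mathrm{Rh}(M^I)$: Rhodes expansion, chains $(m_k<_{\mathcal L}\cdots<_{\mathcal L}m_0=I)$ with product $\sigma\tau=\mathrm{lm}(m_kn\le_{\mathcal L}\cdots\le_{\mathcal L}m_1n\le_{\mathcal L}\tau)$, $n$ the leftmost term of $\tau$, $\mathrm{lm}$ keeping leftmost terms of $\mathcal L$-blocks; $\mathrm{Rh}_Y(M^I)$: submonoid generated by $(y<_{\mathcal L}I)$, $y\in Y$. For a set $X$: $P(X)$ partial self-maps, $S(X)$ permutations, $K(X)=\{\varphi\in P(X):|X\varphi|\le1\}$. Wreath product $\cdots\circ(X_2,M_2)\circ(X_1,M_1)$ ($M_i\le P(X_i)$): on $\mathcal X=\bigcup_{i\le\delta}X_i\times\cdots\times X_1$, the monoid of sequential partial maps ((SQ1) $(x_i,\dots,x_1)\in\mathrm{dom}\Rightarrow(x_{i-1},\dots,x_1)\in\mathrm{dom}$; (SQ2) preserves each $X_i\times\cdots\times X_1$; (SQ3) preserves equality of last $i$ components) whose local maps lie in the $M_i$; the local map $(\cdot,x_{i-1},\dots,x_1)\varphi\pi_i\in P(X_i)$ sends $x$ to the first component of $(x,x_{i-1},\dots,x_1)\varphi$ when defined. Zeiger property: for all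 $\sigma$, $k$ and $(x_{2k+1},\dots,x_1)$, if $(\cdot,x_{2k+1},\dots,x_1)\varphi_\sigma\pi_{2k+2}\in S(X_{2k+2})\setminus K(X_{2k+2})$, then for every $q$ with $2k+2\le q-1<\delta$ and every extension $(x_{q-1},\dots,x_{2k+2},x_{2k+1},\dots,x_1)$, the local map $(\cdot,x_{q-1},\dots,x_1)\varphi_\sigma\pi_q$ is a restriction of the identity of $X_q$. Further notation: $W(M^I)=\{m:\mathcal L_m=\mathcal H_m\}$; $G_m$ is the Schützenberger group of the $\mathcal H$-class of $m$ (same for all $m$ in an $\mathcal R$-class; $G_\lambda$ denotes it for $R_\lambda$); $q_m$ is the number of distinct $\mathcal L$-classes of elements $ym$ with $y\in Y$ and $ym<_{\mathcal L}m$. $U_2(k)=\{m\in W(M^I):h_{\mathcal J}(m)=k,\ |G_m|(1+q_m)>1\}$, $U_3(k)=\{m\notin W(M^I):h_{\mathcal J}(m)=k,\ |G_m|>1\}$, $U_4(k)=\{m\notin W(M^I):h_{\mathcal J}(m)=k,\ |G_m|\cdot q_m>1\}$. *)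

theory Defs
  imports Main "HOL-Library.Extended_Nat" "HOL-Library.FuncSet" "HOL-Algebra.Product_Groups"
begin

fun om :: "'m::semigroup_mult option \<Rightarrow> 'm option \<Rightarrow> 'm option" where
  "om None b = b"
| "om (Some a) None = Some a"
| "om (Some a) (Some b) = Some (a * b)"

definition L_le :: "'m::semigroup_mult option \<Rightarrow> 'm option \<Rightarrow> bool" where
  "L_le x y \<longleftrightarrow> (\<exists>u. x = om u y)"
definition R_le :: "'m::semigroup_mult option \<Rightarrow> 'm option \<Rightarrow> bool" where
  "R_le x y \<longleftrightarrow> (\<exists>u. x = om y u)"
definition J_le :: "'m::semigroup_mult option \<Rightarrow> 'm option \<Rightarrow> bool" where
  "J_le x y \<longleftrightarrow> (\<exists>u v. x = om (om u y) v)"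
definition L_eq :: "'m::semigroup_mult option \<Rightarrow> 'm option \<Rightarrow> bool" where
  "L_eq x y \<longleftrightarrow> L_le x y \<and> L_le y x"
definition R_eq :: "'m::semigroup_mult option \<Rightarrow> 'm option \<Rightarrow> bool" where
  "R_eq x y \<longleftrightarrow> R_le x y \<and> R_le y x"
definition H_eq :: "'m::semigroup_mult option \<Rightarrow> 'm option \<Rightarrow> bool" where
  "H_eq x y \<longleftrightarrow> L_eq x y \<and> R_eq x y"
definition L_less :: "'m::semigroup_mult option \<Rightarrow> 'm option \<Rightarrow> bool" where
  "L_less x y \<longleftrightarrow> L_le x y \<and> \<not> L_le y x"
definition J_less :: "'m::semigroup_mult option \<Rightarrow> 'm option \<Rightarrow> bool" where
  "J_less x y \<longleftrightarrow> J_le x y \<and> \<not> J_le y x"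

definition Lcls :: "'m::semigroup_mult option \<Rightarrow> 'm option set" where
  "Lcls m = {x. L_eq x m}"
definition Rcls :: "'m::semigroup_mult option \<Rightarrow> 'm option set" where
  "Rcls m = {x. R_eq x m}"
definition Hcls :: "'m::semigroup_mult option \<Rightarrow> 'm option set" where
  "Hcls m = {x. H_eq x m}"

definition finite_J_above :: "'m::semigroup_mult itself \<Rightarrow> bool" where
  "finite_J_above _ \<longleftrightarrow> (\<forall>x::'m. finite {y::'m. J_le (Some x) (Some y)})"

definition hJ :: "'m::semigroup_mult option \<Rightarrow> enat" where
  "hJ m = Sup {enat k | k. \<exists>c. c 0 = m \<and> (\<forall>i<k. J_less (c i) (c (Suc i)))}"

definition ecard :: "'a set \<Rightarrow> enat" where
  "ecard A = (if finite A then enat (card A) else \<infinity>)"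

text \<open>A chain (m_k <_L ... <_L m_0 = I) is the list [m_k, ..., m_1, m_0].\<close>
definition rh_chain :: "'m::semigroup_mult option list \<Rightarrow> bool" where
  "rh_chain xs \<longleftrightarrow> xs \<noteq> [] \<and> last xs = None \<and>
     (\<forall>j. Suc j < length xs \<longrightarrow> L_less (xs ! j) (xs ! Suc j))"

fun lm :: "'m::semigroup_mult option list \<Rightarrow> 'm option list" where
  "lm [] = []"
| "lm [a] = [a]"
| "lm (a # b # r) = (if L_eq a b then lm (a # r) else a # lm (b # r))"

definition rh_mult :: "'m::semigroup_mult option list \<Rightarrow> 'm option list \<Rightarrow> 'm option list" where
  "rh_mult \<sigma> \<tau> = lm (map (\<lambda>m. om m (hd \<tau>)) (butlast \<sigma>) @ \<tau>)"

inductive_set RhY :: "('y \<Rightarrow> 'm::semigroup_mult) \<Rightarrow> 'm option list set" for gen where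
  one: "[None] \<in> RhY gen"
| gen: "[Some (gen y), None] \<in> RhY gen"
| mult: "\<sigma> \<in> RhY gen \<Longrightarrow> \<tau> \<in> RhY gen \<Longrightarrow> rh_mult \<sigma> \<tau> \<in> RhY gen"

text \<open>Partial maps act on the right; pcomp f g = first f, then g.\<close>
definition pcomp :: "('a \<Rightarrow> 'b option) \<Rightarrow> ('b \<Rightarrow> 'c option) \<Rightarrow> 'a \<Rightarrow> 'c option" where
  "pcomp f g = (\<lambda>x. Option.bind (f x) g)"

definition pmaps :: "'x set \<Rightarrow> ('x \<Rightarrow> 'x option) set" where
  "pmaps X = {f. \<forall>x y. f x = Some y \<longrightarrow> x \<in> X \<and> y \<in> X}"

definition idX :: "'x set \<Rightarrow> 'x \<Rightarrow> 'x option" where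
  "idX X = (\<lambda>x. if x \<in> X then Some x else None)"

definition perms :: "'x set \<Rightarrow> ('x \<Rightarrow> 'x option) set" where
  "perms X = {f \<in> pmaps X. (\<forall>x\<in>X. f x \<noteq> None) \<and> bij_betw (\<lambda>x. the (f x)) X X}"

definition constmaps :: "'x set \<Rightarrow> ('x \<Rightarrow> 'x option) set" where
  "constmaps X = {f \<in> pmaps X. \<exists>c. \<forall>x y. f x = Some y \<longrightarrow> y = c}"

definition pmonoid :: "'x set \<Rightarrow> ('x \<Rightarrow> 'x option) set \<Rightarrow> bool" where
  "pmonoid X Mo \<longleftrightarrow> Mo \<subseteq> pmaps X \<and> idX X \<in> Mo \<and> (\<forall>f\<in>Mo. \<forall>g\<in>Mo. pcomp f g \<in> Mo)"

definition pgroup :: "'x set \<Rightarrow> ('x \<Rightarrow> 'x option) set \<Rightarrow> ('x \<Rightarrow> 'x option) monoid" where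
  "pgroup X Mo = \<lparr>carrier = Mo \<inter> perms X, mult = pcomp, one = idX X\<rparr>"

text \<open>A tuple (x_n, ..., x_1) \<in> X_n \<times> ... \<times> X_1 is the list [x_n, ..., x_1].\<close>
definition tuples :: "(nat \<Rightarrow> 'x set) \<Rightarrow> nat \<Rightarrow> 'x list \<Rightarrow> bool" where
  "tuples X n xs \<longleftrightarrow> length xs = n \<and> (\<forall>j<n. xs ! j \<in> X (n - j))"

definition wspace :: "(nat \<Rightarrow> 'x set) \<Rightarrow> enat \<Rightarrow> 'x list set" where
  "wspace X \<delta> = {xs. 1 \<le> length xs \<and> enat (length xs) \<le> \<delta> \<and> tuples X (length xs) xs}"

definition sequential :: "(nat \<Rightarrow> 'x set) \<Rightarrow> enat \<Rightarrow> ('x list \<Rightarrow> 'x list option) \<Rightarrow> bool" where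
  "sequential X \<delta> \<phi> \<longleftrightarrow>
     (\<forall>xs ys. \<phi> xs = Some ys \<longrightarrow> xs \<in> wspace X \<delta> \<and> ys \<in> wspace X \<delta>) \<and>
     (\<forall>xs. \<phi> xs \<noteq> None \<and> 2 \<le> length xs \<longrightarrow> \<phi> (tl xs) \<noteq> None) \<and>
     (\<forall>xs ys. \<phi> xs = Some ys \<longrightarrow> length ys = length xs) \<and>
     (\<forall>xs ys xs' ys' i. \<phi> xs = Some xs' \<and> \<phi> ys = Some ys' \<and> i \<le> length xs \<and> i \<le> length ys \<and>
        drop (length xs - i) xs = drop (length ys - i) ys \<longrightarrow>
        drop (length xs' - i) xs' = drop (length ys' - i) ys')"

text \<open>Local map (., x_{i-1}, ..., x_1) \<phi> \<pi>_i, with ctx = [x_{i-1}, ..., x_1].\<close>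
definition localmap :: "('x list \<Rightarrow> 'x list option) \<Rightarrow> 'x list \<Rightarrow> 'x \<Rightarrow> 'x option" where
  "localmap \<phi> ctx = (\<lambda>x. map_option hd (\<phi> (x # ctx)))"

definition wreath :: "(nat \<Rightarrow> 'x set) \<Rightarrow> (nat \<Rightarrow> ('x \<Rightarrow> 'x option) set) \<Rightarrow> enat
     \<Rightarrow> ('x list \<Rightarrow> 'x list option) set" where
  "wreath X Mi \<delta> = {\<phi>. sequential X \<delta> \<phi> \<and>
     (\<forall>i ctx. 1 \<le> i \<and> enat i \<le> \<delta> \<and> tuples X (i - 1) ctx \<longrightarrow> localmap \<phi> ctx \<in> Mi i)}"

definition wid :: "(nat \<Rightarrow> 'x set) \<Rightarrow> enat \<Rightarrow> 'x list \<Rightarrow> 'x list option" where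
  "wid X \<delta> = (\<lambda>xs. if xs \<in> wspace X \<delta> then Some xs else None)"

definition zeiger :: "(nat \<Rightarrow> 'x set) \<Rightarrow> enat \<Rightarrow> 's set \<Rightarrow> ('s \<Rightarrow> 'x list \<Rightarrow> 'x list option) \<Rightarrow> bool" where
  "zeiger X \<delta> S \<phi> \<longleftrightarrow>
    (\<forall>\<sigma>\<in>S. \<forall>k ctx. tuples X (2*k+1) ctx \<and>
        localmap (\<phi> \<sigma>) ctx \<in> perms (X (2*k+2)) - constmaps (X (2*k+2)) \<longrightarrow>
       (\<forall>q ext. 2*k+2 \<le> q - 1 \<and> enat (q - 1) < \<delta> \<and> tuples X (q - 1) ext \<and>
           drop (q - 1 - (2*k+1)) ext = ctx \<longrightarrow>
          (\<forall>x y. localmap (\<phi> \<sigma>) ext x = Some y \<longrightarrow> x \<in> X q \<and> y = x)))"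

definition schutz :: "'m::semigroup_mult option \<Rightarrow> ('m option \<Rightarrow> 'm option) monoid" where
  "schutz m = \<lparr>carrier = {restrict (\<lambda>h. om h s) (Hcls m) | s. \<forall>h\<in>Hcls m. om h s \<in> Hcls m},
               mult = (\<lambda>f g. restrict (g \<circ> f) (Hcls m)),
               one = restrict id (Hcls m)\<rparr>"

text \<open>G_lambda for an R-class R_lambda (independent of the representative up to isomorphism).\<close>
definition schutzR :: "'m::semigroup_mult option set \<Rightarrow> ('m option \<Rightarrow> 'm option) monoid" where
  "schutzR R = schutz (SOME m. m \<in> R)"

definition inW :: "'m::semigroup_mult option \<Rightarrow> bool" where
  "inW m \<longleftrightarrow> Lcls m = Hcls m"

definition qm :: "('y \<Rightarrow> 'm::semigroup_mult) \<Rightarrow> 'm option \<Rightarrow> enat" where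
  "qm gen m = ecard {Lcls (om (Some (gen y)) m) | y. L_less (om (Some (gen y)) m) m}"

definition U2 :: "('y \<Rightarrow> 'm::semigroup_mult) \<Rightarrow> nat \<Rightarrow> 'm option set" where
  "U2 gen k = {m. inW m \<and> hJ m = enat k \<and> ecard (carrier (schutz m)) * (1 + qm gen m) > 1}"
definition U3 :: "('y \<Rightarrow> 'm::semigroup_mult) \<Rightarrow> nat \<Rightarrow> 'm option set" where
  "U3 gen k = {m. \<not> inW m \<and> hJ m = enat k \<and> ecard (carrier (schutz m)) > 1}"
definition U4 :: "('y \<Rightarrow> 'm::semigroup_mult) \<Rightarrow> nat \<Rightarrow> 'm option set" where
  "U4 gen k = {m. \<not> inW m \<and> hJ m = enat k \<and> ecard (carrier (schutz m)) * qm gen m > 1}"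

definition Lambda :: "('y \<Rightarrow> 'm::semigroup_mult) \<Rightarrow> nat \<Rightarrow> 'm option set set" where
  "Lambda gen k = {R. \<exists>m. R = Rcls m \<and> R \<subseteq> U2 gen k \<union> U3 gen k \<union> U4 gen k}"

text \<open>Ambient type for the level sets X_i (large enough to hold any construction).\<close>
type_synonym ('m, 'y) xelem = "(('m option + 'y) \<times> nat) set"

end

(*
  Right multiplication by a chain t with leftmost term n sends the elements m of a chain s to m n.
  By stability, m n either stays in the R-class of m, and then so do all elements of s below m, or
  its height grows. Hence the part of s of height at most k, together with the L-class of the
  element following it, transforms autonomously. It is coded, height by height, by the R-class of
  the element x of height k inside an L-class that is already known (odd coordinates), and by the
  position of x in its H-class plus the choice of the L-class below x (even coordinates). If x n is
  still R-equivalent to x, the odd coordinate and the choice are fixed and the position is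
  translated by an element of the Schuetzenberger group; positions are measured relative to the
  predecessor of x in s, so that everything below x is then fixed, which is the Zeiger property.
  If x n drops, nothing at height k depends on x any more and the local maps are constant.
*)

theory Submission
  imports Defs
begin

section \<open>Green relations and height\<close>

text \<open>The work is done on \<open>chains\<close>, where each proper term is L-equivalent to a
  generator times its predecessor. They contain \<open>RhY gen\<close> and are closed under
  \<open>rh_mult\<close>; because the condition is local, the coordinates that can follow a given
  prefix can be described exactly. This matters since local maps have to be constant or permutations
  of a whole level set: coordinates that no chain realizes must be fixed without losing
  multiplicativity, and this works because the set of realized coordinates does not change while the
  element of that height is not dropped. The identity chain acts as the identity on all tuples,
  every other chain is undefined where the tail codes nothing; this is consistent since a product of
  chains is \<open>[None]\<close> only trivially. Each height from 0 to the supremum gets two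
  coordinates, hence \<delta> = 2 + 2 sup. Height 0 belongs to the identity alone, whose second
  coordinate records the first L-class below it. A single local map moves coordinates of one R-class
  only, so a direct sum suffices, and every G'_\<lambda> is the whole Schuetzenberger group.\<close>

notation om (infixl "\<bullet>" 70)

lemma om_None [simp]: "x \<bullet> None = x"
  by (cases x) auto

lemma om_assoc: "(x \<bullet> y) \<bullet> z = x \<bullet> (y \<bullet> z)"
  by (cases x; cases y; cases z) (auto simp: mult.assoc)

lemma om_eq_None [simp]: "x \<bullet> y = None \<longleftrightarrow> x = None \<and> y = None"
  by (cases x; cases y) auto

lemma L_le_refl [simp]: "L_le x x"
  unfolding L_le_def by (rule exI[of _ None]) simp

lemma R_le_refl [simp]: "R_le x x"
  unfolding R_le_def by (rule exI[of _ None]) simp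

lemma L_le_trans: "L_le x y \<Longrightarrow> L_le y z \<Longrightarrow> L_le x z"
  unfolding L_le_def by (metis om_assoc)

lemma R_le_trans: "R_le x y \<Longrightarrow> R_le y z \<Longrightarrow> R_le x z"
  unfolding R_le_def by (metis om_assoc)

lemma J_le_trans: "J_le x y \<Longrightarrow> J_le y z \<Longrightarrow> J_le x z"
  unfolding J_le_def by (metis om_assoc)

lemma L_le_imp_J_le: "L_le x y \<Longrightarrow> J_le x y"
  unfolding L_le_def J_le_def by (metis om_None)

lemma R_le_imp_J_le: "R_le x y \<Longrightarrow> J_le x y"
  unfolding R_le_def J_le_def by (metis om.simps(1))

lemma J_le_refl [simp]: "J_le x x"
  by (simp add: L_le_imp_J_le)

lemma L_le_om [simp]: "L_le (u \<bullet> x) x"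
  unfolding L_le_def by auto

lemma R_le_om [simp]: "R_le (x \<bullet> u) x"
  unfolding R_le_def by auto

lemma L_le_cong: "L_le x y \<Longrightarrow> L_le (x \<bullet> n) (y \<bullet> n)"
  unfolding L_le_def by (metis om_assoc)

lemma L_eq_refl [simp]: "L_eq x x" and R_eq_refl [simp]: "R_eq x x"
  by (auto simp: L_eq_def R_eq_def)

lemma L_eq_sym: "L_eq x y \<Longrightarrow> L_eq y x" and R_eq_sym: "R_eq x y \<Longrightarrow> R_eq y x"
  by (auto simp: L_eq_def R_eq_def)

lemma L_eq_trans: "L_eq x y \<Longrightarrow> L_eq y z \<Longrightarrow> L_eq x z"
  and R_eq_trans: "R_eq x y \<Longrightarrow> R_eq y z \<Longrightarrow> R_eq x z"
  unfolding L_eq_def R_eq_def by (blast intro: L_le_trans R_le_trans)+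

lemma L_eq_cong: "L_eq x y \<Longrightarrow> L_eq (x \<bullet> n) (y \<bullet> n)"
  by (auto simp: L_eq_def L_le_cong)

lemma L_le_None [simp]: "L_le x None"
  unfolding L_le_def by auto

lemma J_le_None [simp]: "J_le x None"
  by (simp add: L_le_imp_J_le)

lemma J_le_None_iff [simp]: "J_le None y \<longleftrightarrow> y = None"
  by (auto simp: J_le_def dest: sym) (metis om_None)

lemma L_eq_None [simp]: "L_eq None y \<longleftrightarrow> y = None" "L_eq y None \<longleftrightarrow> y = None"
  by (metis J_le_None_iff L_eq_def L_eq_refl L_le_imp_J_le)+

lemma R_eq_None [simp]: "R_eq None y \<longleftrightarrow> y = None" "R_eq y None \<longleftrightarrow> y = None"
  by (metis J_le_None_iff R_eq_def R_eq_refl R_le_imp_J_le)+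

lemma Lcls_iff [simp]: "x \<in> Lcls m \<longleftrightarrow> L_eq x m"
  and Rcls_iff [simp]: "x \<in> Rcls m \<longleftrightarrow> R_eq x m"
  and Hcls_iff [simp]: "x \<in> Hcls m \<longleftrightarrow> L_eq x m \<and> R_eq x m"
  by (auto simp: Lcls_def Rcls_def Hcls_def H_eq_def)

lemma Lcls_eq_iff: "Lcls x = Lcls y \<longleftrightarrow> L_eq x y"
  by (metis Lcls_iff L_eq_refl L_eq_sym L_eq_trans subsetI subset_antisym)

lemma Rcls_eq_iff: "Rcls x = Rcls y \<longleftrightarrow> R_eq x y"
  by (metis Rcls_iff R_eq_refl R_eq_sym R_eq_trans subsetI subset_antisym)

lemma Hcls_eq: "L_eq x y \<Longrightarrow> R_eq x y \<Longrightarrow> Hcls x = Hcls y"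
  unfolding set_eq_iff Hcls_iff by (metis L_eq_trans R_eq_trans L_eq_sym R_eq_sym)

text \<open>Half of Green's lemma, in a form that covers everything L-below z: write a = u z and
  multiply z s v = z by u on the left.\<close>

lemma right_inverse:
  assumes "R_eq (z \<bullet> s) z"
  obtains v where "\<And>a. L_le a z \<Longrightarrow> (a \<bullet> s) \<bullet> v = a"
proof -
  from assms obtain v where v: "z = (z \<bullet> s) \<bullet> v"
    unfolding R_eq_def R_le_def by auto
  have "(a \<bullet> s) \<bullet> v = a" if "L_le a z" for a
    using that v unfolding L_le_def by (metis om_assoc)
  then show ?thesis by (rule that)
qed

lemma R_eq_below: "R_eq (z \<bullet> s) z \<Longrightarrow> L_le x z \<Longrightarrow> R_eq (x \<bullet> s) x"
  by (elim right_inverse) (metis R_eq_def R_le_om)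

lemma R_eq_om_cong:
  assumes "L_eq x x'"
  shows "R_eq (x \<bullet> n) x \<longleftrightarrow> R_eq (x' \<bullet> n) x'"
  using assms R_eq_below unfolding L_eq_def by blast

text \<open>The common right inverse from \<open>right_inverse\<close> undoes the translation by s
  on both elements at once.\<close>

lemma L_eq_cancel_below:
  assumes "R_eq (z \<bullet> s) z" "L_le x z" "L_le x' z"
  shows "L_eq (x \<bullet> s) (x' \<bullet> s) \<longleftrightarrow> L_eq x x'"
  using assms by (elim right_inverse) (metis L_eq_cong)

section \<open>Powers and stability\<close>

primrec opow :: "'m::semigroup_mult option \<Rightarrow> nat \<Rightarrow> 'm option" where
  "opow x 0 = None"
| "opow x (Suc n) = x \<bullet> opow x n"

lemma opow_add: "opow x (i + j) = opow x i \<bullet> opow x j"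
  by (induction i) (auto simp: om_assoc)

lemma opow_commute: "x \<bullet> opow x n = opow x n \<bullet> x"
  by (induction n) (simp, metis om_assoc opow.simps(2))

text \<open>Iterating the factorization keeps every \<open>opow u n \<bullet> y\<close> J-above y; a
  finite J-above set then forces a repetition.\<close>

lemma opow_fix: "y = (u \<bullet> y) \<bullet> t \<Longrightarrow> y = (opow u n \<bullet> y) \<bullet> opow t n"
proof (induction n)
  case (Suc n)
  have "(opow u (Suc n) \<bullet> y) \<bullet> opow t (Suc n)
    = opow u n \<bullet> ((u \<bullet> y) \<bullet> t) \<bullet> opow t n"
    by (simp add: opow_commute om_assoc) 
  then show ?case using Suc by simp
qed simp

lemma finite_range_repeat:
  fixes f :: "nat \<Rightarrow> 'a"
  assumes "finite (range f)"
  shows "\<exists>i j. i < j \<and> f i = f j"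
proof -
  have "\<not> inj f" using assms finite_imageD infinite_UNIV_nat by blast
  then obtain i j where "f i = f j" "i \<noteq> j" unfolding inj_def by blast
  then show ?thesis by (metis linorder_neqE_nat)
qed

text \<open>A natural-number version of \<open>hJ\<close>; \<open>hJ_ht\<close> shows that nothing
  is lost for finite J-above semigroups.\<close>

definition ht :: "'m::semigroup_mult option \<Rightarrow> nat" where
  "ht m = the_enat (hJ m)"

locale finite_above =
  fixes gen :: "'y \<Rightarrow> 'm::semigroup_mult"
  assumes fJ: "finite_J_above TYPE('m)"
begin

lemma finite_above: "finite {y::'m option. J_le x y}"
proof (cases x)
  case None
  then show ?thesis by simp
next
  case (Some a)
  have "{y::'m option. J_le x y} \<subseteq> insert None (Some ` {y. J_le (Some a) (Some y)})"
    using Some by (auto simp: image_iff) (metis option.exhaust)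
  then show ?thesis
    using fJ unfolding finite_J_above_def by (meson finite.simps finite_imageI finite_subset)
qed

text \<open>All elements \<open>opow (s \<bullet> u) n \<bullet> y\<close> lie J-above y, so two of
  them coincide. Absorbing the common power leaves y as a left multiple of itself by a positive
  power of s u, hence of x = u y.\<close>

lemma stable_L:
  fixes x y :: "'m option"
  assumes "L_le x y" "J_le y x"
  shows "L_eq x y"
proof -
  from assms(1) obtain u where u: "x = u \<bullet> y" unfolding L_le_def by auto
  from assms(2) obtain s t where st: "y = (s \<bullet> x) \<bullet> t" unfolding J_le_def by auto
  have fix1: "y = (opow (s \<bullet> u) n \<bullet> y) \<bullet> opow t n" for n
    by (rule opow_fix) (use st u in \<open>simp add: om_assoc\<close>)
  have "range (\<lambda>n. opow (s \<bullet> u) n \<bullet> y) \<subseteq> {z. J_le y z}"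
    using fix1 by (auto simp: J_le_def) (metis om.simps(1))
  then have "finite (range (\<lambda>n. opow (s \<bullet> u) n \<bullet> y))"
    using finite_above finite_subset by blast
  then obtain i j where ij: "i < j" "opow (s \<bullet> u) i \<bullet> y = opow (s \<bullet> u) j \<bullet> y"
    using finite_range_repeat by blast
  define d where "d = j - i - 1"
  have j: "j = Suc d + i" using ij(1) by (simp add: d_def)
  have "y = (opow (s \<bullet> u) j \<bullet> y) \<bullet> opow t i" using fix1[of i] ij(2) by simp
  also have "\<dots> = opow (s \<bullet> u) (Suc d) \<bullet> ((opow (s \<bullet> u) i \<bullet> y) \<bullet> opow t i)"
    by (simp only: j opow_add om_assoc)
  also have "\<dots> = opow (s \<bullet> u) (Suc d) \<bullet> y" using fix1[of i] by simp
  also have "\<dots> = (opow (s \<bullet> u) d \<bullet> s) \<bullet> x" by (simp add: opow_commute u om_assoc)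
  finally have "L_le y x" unfolding L_le_def by blast
  then show ?thesis using assms(1) by (simp add: L_eq_def)
qed

lemma stable_R:
  fixes x y :: "'m option"
  assumes "R_le x y" "J_le y x"
  shows "R_eq x y"
proof -
  from assms(1) obtain u where u: "x = y \<bullet> u" unfolding R_le_def by auto
  from assms(2) obtain s t where st: "y = (s \<bullet> x) \<bullet> t" unfolding J_le_def by auto
  have fix1: "y = (opow s n \<bullet> y) \<bullet> opow (u \<bullet> t) n" for n
    by (rule opow_fix) (use st u in \<open>simp add: om_assoc\<close>)
  have "range (\<lambda>n. y \<bullet> opow (u \<bullet> t) n) \<subseteq> {z. J_le y z}"
    using fix1 by (auto simp: J_le_def) (metis om.simps(1) om_assoc om_None)
  then have "finite (range (\<lambda>n. y \<bullet> opow (u \<bullet> t) n))"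
    using finite_above finite_subset by blast
  then obtain i j where ij: "i < j" "y \<bullet> opow (u \<bullet> t) i = y \<bullet> opow (u \<bullet> t) j"
    using finite_range_repeat by blast
  define d where "d = j - i - 1"
  have j: "j = i + Suc d" using ij(1) by (simp add: d_def)
  have "y = opow s i \<bullet> (y \<bullet> opow (u \<bullet> t) j)" using fix1[of i] ij(2) by (simp add: om_assoc)
  also have "\<dots> = ((opow s i \<bullet> y) \<bullet> opow (u \<bullet> t) i) \<bullet> opow (u \<bullet> t) (Suc d)"
    by (simp only: j opow_add om_assoc)
  also have "\<dots> = y \<bullet> opow (u \<bullet> t) (Suc d)" using fix1[of i] by simp
  also have "\<dots> = x \<bullet> (t \<bullet> opow (u \<bullet> t) d)" by (simp add: u om_assoc)
  finally have "R_le y x" unfolding R_le_def by blast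
  then show ?thesis using assms(1) by (simp add: R_eq_def)
qed

section \<open>Height as a natural number\<close>

abbreviation J_chain :: "'m option \<Rightarrow> nat \<Rightarrow> (nat \<Rightarrow> 'm option) \<Rightarrow> bool" where
  "J_chain m k c \<equiv> c 0 = m \<and> (\<forall>i<k. J_less (c i) (c (Suc i)))"

lemma J_chain_less: "J_chain m k c \<Longrightarrow> i < j \<Longrightarrow> j \<le> k \<Longrightarrow> J_less (c i) (c j)"
proof (induction j)
  case (Suc j)
  show ?case
  proof (cases "i = j")
    case False
    then have "J_less (c i) (c j)" "J_less (c j) (c (Suc j))" using Suc by auto
    then show ?thesis unfolding J_less_def by (meson J_le_trans)
  qed (use Suc in auto)
qed simp

lemma J_chain_bound:
  assumes "J_chain m k c"
  shows "k \<le> card {y. J_le m y}"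
proof -
  have "inj_on c {..k}"
    by (rule linorder_inj_onI') (use J_chain_less[OF assms] in \<open>force simp: J_less_def\<close>)
  moreover have "c ` {..k} \<subseteq> {y. J_le m y}"
    using J_chain_less[OF assms, of 0] assms
    by (auto simp: J_less_def) (metis J_le_refl neq0_conv)
  ultimately have "card {..k} \<le> card {y. J_le m y}"
    using finite_above card_inj_on_le by blast
  then show ?thesis by simp
qed

lemma hJ_ht: "hJ (m::'m option) = enat (ht m)"
proof -
  have "hJ m \<le> enat (card {y. J_le m y})"
    unfolding hJ_def by (rule Sup_least) (use J_chain_bound in force)
  then show ?thesis unfolding ht_def by (cases "hJ m") auto
qed

lemma J_chain_le_ht: "J_chain m k c \<Longrightarrow> k \<le> ht m"
proof -
  assume "J_chain m k c"
  then have "enat k \<le> hJ m" unfolding hJ_def by (intro Sup_upper) auto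
  then show ?thesis by (simp add: hJ_ht)
qed

text \<open>A finite nonempty set of extended naturals contains its supremum; the chain of length 0
  makes it nonempty and \<open>J_chain_bound\<close> makes it finite.\<close>

lemma ht_attained: "\<exists>c. J_chain m (ht m) c"
proof -
  let ?S = "{enat k | k. \<exists>c. J_chain m k c}"
  have "enat 0 \<in> ?S" by force
  moreover have "?S \<subseteq> enat ` {..card {y. J_le m y}}" using J_chain_bound by force
  then have "finite ?S" using finite_subset by blast
  ultimately have "finite ?S" "?S \<noteq> {}" by auto
  then have "Max ?S \<in> ?S" "Sup ?S = Max ?S"
    by (rule Max_in) (simp only: Sup_enat_def \<open>finite ?S\<close> \<open>?S \<noteq> {}\<close> if_True if_False)
  moreover have "Sup ?S = enat (ht m)" using hJ_ht[of m] unfolding hJ_def .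
  ultimately have "enat (ht m) \<in> ?S" by simp
  then show ?thesis by auto
qed

lemma ht_J_less:
  assumes "J_less x (y::'m option)"
  shows "ht y < ht x"
proof -
  obtain c where c: "J_chain y (ht y) c" using ht_attained by blast
  have "J_chain x (Suc (ht y)) (case_nat x c)"
    using c assms by (auto split: nat.split)
  from J_chain_le_ht[OF this] show ?thesis by simp
qed

lemma ht_J_le:
  assumes "J_le x (y::'m option)"
  shows "ht y \<le> ht x"
proof -
  obtain c where c: "J_chain y (ht y) c" using ht_attained by blast
  \<comment> \<open>Only the starting point is exchanged; the first step stays strict because x lies
    below y.\<close>
  have "J_chain x (ht y) (\<lambda>i. if i = 0 then x else c i)"
    using c assms by (auto simp: J_less_def) (metis J_le_trans)+
  from J_chain_le_ht[OF this] show ?thesis .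
qed

lemma ht_L_eq: "L_eq x y \<Longrightarrow> ht x = ht (y::'m option)"
  and ht_R_eq: "R_eq x y \<Longrightarrow> ht x = ht (y::'m option)"
  unfolding L_eq_def R_eq_def
  by (simp_all add: L_le_imp_J_le R_le_imp_J_le eq_iff ht_J_le)

lemma ht_om: "ht (x::'m option) \<le> ht (x \<bullet> n)"
  by (simp add: R_le_imp_J_le ht_J_le)

text \<open>Turns the dichotomy of the construction into a numerical one: by
  \<open>stable_R\<close>, a right multiple that leaves the R-class falls strictly in the J-order,
  and this raises the height.\<close>

lemma R_eq_iff_ht: "R_eq ((x::'m option) \<bullet> n) x \<longleftrightarrow> ht (x \<bullet> n) = ht x"
  by (metis J_less_def R_le_om R_le_imp_J_le ht_J_less ht_R_eq nat_neq_iff stable_R)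

lemma L_less_ht: "L_less x (y::'m option) \<Longrightarrow> ht y < ht x"
  by (metis J_less_def L_eq_def L_le_imp_J_le L_less_def ht_J_less stable_L)

lemma ht_None [simp]: "ht (None::'m option) = 0"
proof -
  obtain c where "J_chain (None::'m option) (ht (None::'m option)) c" using ht_attained by blast
  then show ?thesis unfolding J_less_def by (metis J_le_None gr0I)
qed

lemma ht_eq_0 [simp]: "ht (x::'m option) = 0 \<longleftrightarrow> x = None"
  by (metis J_le_None J_le_None_iff J_less_def gr_implies_not0 ht_J_less ht_None)

end

section \<open>Chains and their multiplication\<close>

lemma lm_eq_Nil [simp]: "lm w = [] \<longleftrightarrow> w = []"
  by (induction w rule: lm.induct) auto

lemma hd_lm [simp]: "hd (lm w) = hd w"
  by (induction w rule: lm.induct) auto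

lemma set_lm: "set (lm w) \<subseteq> set w"
  by (induction w rule: lm.induct) auto

lemma lm_Cons_lm: "lm (a # lm w) = lm (a # w)"
proof (induction w arbitrary: a rule: lm.induct)
  case (3 b c r)
  show ?case
  proof (cases "L_eq b c")
    case True
    then have "L_eq a b \<Longrightarrow> L_eq a c" by (blast intro: L_eq_trans)
    then show ?thesis using 3(1)[OF True, of a] True by (simp del: lm.simps(2))
  next
    case False
    then show ?thesis using 3(2)[OF False, of a] 3(2)[OF False, of b] by (simp del: lm.simps(2))
  qed
qed auto

lemma lm_lm [simp]: "lm (lm w) = lm w"
proof (induction w rule: lm.induct)
  case (3 b c r)
  then show ?case using lm_Cons_lm[of b "c # r"] by auto
qed auto

lemma lm_append_lm: "lm (u @ lm w) = lm (u @ w)"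
proof (induction u)
  case (Cons a u)
  then show ?case using lm_Cons_lm[of a "u @ lm w"] lm_Cons_lm[of a "u @ w"] by simp
qed simp

lemma lm_split:
  assumes "u \<noteq> [] \<Longrightarrow> v \<noteq> [] \<Longrightarrow> \<not> L_eq (last u) (hd v)"
  shows "lm (u @ v) = lm u @ lm v"
  using assms
proof (induction u rule: lm.induct)
  case (2 a)
  then show ?case by (cases v) auto
next
  case (3 a b r)
  show ?case
  proof (cases "L_eq a b")
    case True
    have "v \<noteq> [] \<Longrightarrow> \<not> L_eq (last (a # r)) (hd v)"
      using 3(3) True by (cases r) (auto dest: L_eq_sym L_eq_trans)
    then show ?thesis using 3(1)[OF True] True by auto
  next
    case False
    then show ?thesis using 3(2)[OF False] 3(3) by auto
  qed
qed auto

text \<open>\<open>lm\<close> keeps the leftmost term of a block, so the last term may change, but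
  only inside its L-class.\<close>

lemma L_eq_last_lm: "u \<noteq> [] \<Longrightarrow> L_eq (last (lm u)) (last u)"
proof (induction u rule: lm.induct)
  case (3 a b r)
  then show ?case by (cases "L_eq a b"; cases r) (auto split: if_splits)
qed auto

text \<open>A map such as right multiplication may merge neighbouring L-blocks but never splits one,
  so reducing earlier makes no difference.\<close>

lemma lm_map_lm:
  assumes "\<And>a b. L_eq a b \<Longrightarrow> L_eq (f a) (f b)"
  shows "lm (map f (lm u) @ w) = lm (map f u @ w)"
proof (induction u rule: lm.induct)
  case (3 a b r)
  show ?case
  proof (cases "L_eq a b")
    case True
    then show ?thesis using 3(1)[OF True] assms[of a b] by simp
  next
    case False
    have "lm (map f (lm (a # b # r)) @ w) = lm (f a # lm (map f (lm (b # r)) @ w))"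
      using False by (simp add: lm_Cons_lm)
    also have "\<dots> = lm (f a # lm (map f (b # r) @ w))"
      using 3(2)[OF False] by simp
    also have "\<dots> = lm (map f (a # b # r) @ w)"
      by (simp only: lm_Cons_lm list.map append_Cons)
    finally show ?thesis .
  qed
qed auto

text \<open>A cut by an L-invariant predicate never runs through an L-block. It is applied with
  bounds on the height.\<close>

lemma lm_takeWhile_dropWhile:
  assumes inv: "\<And>x y. L_eq x y \<Longrightarrow> P x = P y"
  shows "takeWhile P (lm w) = lm (takeWhile P w)" and "dropWhile P (lm w) = lm (dropWhile P w)"
proof -
  let ?u = "takeWhile P w" and ?v = "dropWhile P w"
  have "lm (?u @ ?v) = lm ?u @ lm ?v"
  proof (rule lm_split)
    assume "?u \<noteq> []" "?v \<noteq> []"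
    then have "P (last ?u)" "\<not> P (hd ?v)"
      by (metis last_in_set set_takeWhileD) (use \<open>?v \<noteq> []\<close> hd_dropWhile in blast)
    then show "\<not> L_eq (last ?u) (hd ?v)" using inv by blast
  qed
  then have eq: "lm w = lm ?u @ lm ?v" by simp
  have 1: "\<forall>x\<in>set (lm ?u). P x" using set_lm set_takeWhileD by fast
  have 2: "lm ?v = [] \<or> \<not> P (hd (lm ?v))" by (metis hd_dropWhile hd_lm lm_eq_Nil)
  have "l = [] \<or> \<not> P (hd l) \<Longrightarrow> takeWhile P l = [] \<and> dropWhile P l = l" for l
    by (cases l) auto
  then have 3: "takeWhile P (lm ?v) = [] \<and> dropWhile P (lm ?v) = lm ?v"
    using 2 by blast
  show "takeWhile P (lm w) = lm ?u" "dropWhile P (lm w) = lm ?v"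
    unfolding eq by (metis 1 3 takeWhile_append2 append_Nil2) (metis 1 3 dropWhile_append2)
qed

section \<open>Chains with generator steps\<close>

context finite_above
begin

text \<open>Strict steps are not preserved by right multiplication, weak ones are; \<open>lm\<close>
  turns weak steps back into strict ones.\<close>

definition wstep :: "'m option \<Rightarrow> 'm option \<Rightarrow> bool" where
  "wstep a b \<longleftrightarrow> L_eq a b \<or> (\<exists>y. L_eq a (Some (gen y) \<bullet> b))"

definition gstep :: "'m option \<Rightarrow> 'm option \<Rightarrow> bool" where
  "gstep a b \<longleftrightarrow> \<not> L_eq a b \<and> (\<exists>y. L_eq a (Some (gen y) \<bullet> b))"

text \<open>A superset of \<open>RhY gen\<close> defined by a condition on neighbours, so that
  single terms can be exchanged and chains prolonged, as the realization of prescribed coordinates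
  requires.\<close>

definition chains :: "'m option list set" where
  "chains = {s. s \<noteq> [] \<and> last s = None \<and> successively gstep s}"

lemma gstep_imp_wstep: "gstep a b \<Longrightarrow> wstep a b"
  by (auto simp: gstep_def wstep_def)

lemma successively_wstep: "successively gstep s \<Longrightarrow> successively wstep s"
  by (erule successively_mono) (erule gstep_imp_wstep)

lemma wstep_cong: "wstep a b \<Longrightarrow> wstep (a \<bullet> n) (b \<bullet> n)"
  unfolding wstep_def by (metis L_eq_cong om_assoc)

lemma gstep_imp_L_le: "gstep a b \<Longrightarrow> L_le a b"
  unfolding gstep_def L_eq_def by (blast intro: L_le_trans L_le_om)

lemma gstep_ht: "gstep a b \<Longrightarrow> ht b < ht a"
  by (metis L_eq_def L_less_def L_less_ht gstep_def gstep_imp_L_le)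

lemma successively_lm:
  "successively wstep w \<Longrightarrow> successively gstep (lm w)"
proof (induction w rule: lm.induct)
  case (3 a b r)
  show ?case
  proof (cases "L_eq a b")
    case True
    have "successively wstep (a # r)"
      using 3(3) True by (cases r) (auto simp: wstep_def intro: L_eq_trans)
    then show ?thesis using 3(1) True by simp
  next
    case False
    then have "successively gstep (lm (b # r))" using 3(2,3) by simp
    moreover have "gstep a (hd (lm (b # r)))"
      using False 3(3) by (auto simp: gstep_def wstep_def)
    ultimately show ?thesis using False by (auto simp: successively_Cons)
  qed
qed auto

lemma lm_chains:
  "w \<noteq> [] \<Longrightarrow> last w = None \<Longrightarrow> successively wstep w \<Longrightarrow> lm w \<in> chains"
  using L_eq_last_lm[of w] by (auto simp: chains_def successively_lm)

lemma chains_sorted: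
  assumes "s \<in> chains"
  shows "sorted_wrt (\<lambda>a b. L_le a b) s" "sorted_wrt (\<lambda>a b. ht b < ht a) s"
proof -
  have s: "successively gstep s" using assms by (simp add: chains_def)
  have "successively L_le s" "successively (\<lambda>a b. ht b < ht a) s"
    by (rule successively_mono[OF s], erule gstep_imp_L_le)
      (rule successively_mono[OF s], erule gstep_ht)
  moreover have "transp (L_le :: 'm option \<Rightarrow> _)" "transp (\<lambda>a b :: 'm option. ht b < ht a)"
    unfolding transp_def by (blast intro: L_le_trans, simp)
  ultimately show "sorted_wrt (\<lambda>a b. L_le a b) s" "sorted_wrt (\<lambda>a b. ht b < ht a) s"
    by (simp_all add: successively_conv_sorted_wrt)
qed

lemma chains_butlast: "s \<in> chains \<Longrightarrow> s = butlast s @ [None]"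
  by (metis (mono_tags, lifting) append_butlast_last_id chains_def mem_Collect_eq)

lemma chains_proper:
  assumes "s \<in> chains" "x \<in> set (butlast s)"
  shows "x \<noteq> None"
proof -
  have "sorted_wrt (\<lambda>a b. ht b < ht a) (butlast s @ [None])"
    using chains_sorted(2)[OF assms(1)] chains_butlast[OF assms(1)] by simp
  then have "ht (None::'m option) < ht x" using assms(2) by (simp only: sorted_wrt_append) simp
  then show ?thesis by (metis less_irrefl)
qed

lemma hd_chain_None:
  assumes "s \<in> chains"
  shows "hd s = None \<longleftrightarrow> s = [None]"
proof (cases "butlast s")
  case Nil
  then show ?thesis using chains_butlast[OF assms] by simp
next
  case (Cons a b)
  then have "s = a # b @ [None]" "a \<noteq> None"
    using chains_butlast[OF assms] chains_proper[OF assms] by auto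
  then show ?thesis by simp
qed

lemma one_chain [simp]: "[None] \<in> chains"
  by (simp add: chains_def)

lemma lm_chain: "s \<in> chains \<Longrightarrow> lm s = s"
proof -
  have "successively gstep s \<Longrightarrow> lm s = s" for s
    by (induction s rule: lm.induct) (auto simp: gstep_def)
  then show "s \<in> chains \<Longrightarrow> lm s = s" by (simp add: chains_def)
qed

lemma rh_mult_chains:
  assumes "s \<in> chains" "t \<in> chains"
  shows "rh_mult s t \<in> chains"
  unfolding rh_mult_def
proof (rule lm_chains)
  let ?b = "butlast s" and ?f = "\<lambda>m. m \<bullet> hd t"
  have t: "t \<noteq> []" "last t = None" "successively wstep t"
    using assms(2) successively_wstep by (auto simp: chains_def)
  then show "map ?f ?b @ t \<noteq> []" "last (map ?f ?b @ t) = None" by simp_all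
  have "successively gstep s" using assms(1) by (simp add: chains_def)
  then have b: "successively gstep ?b" "?b \<noteq> [] \<longrightarrow> gstep (last ?b) None"
    using successively_append_iff[of gstep ?b "[None]"] chains_butlast[OF assms(1)] by auto
  have "successively wstep (map ?f ?b)"
    unfolding successively_map using b(1)
    by (rule successively_mono) (intro wstep_cong gstep_imp_wstep)
  \<comment> \<open>The step of s down from the identity becomes the step at the junction, since the
    identity is multiplied to \<open>hd t\<close>.\<close>
  moreover have "?b \<noteq> [] \<Longrightarrow> wstep (last (map ?f ?b)) (hd t)"
    using b(2) wstep_cong[of "last ?b" None "hd t"] by (auto simp: last_map gstep_imp_wstep)
  ultimately show "successively wstep (map ?f ?b @ t)"
    using t by (auto simp: successively_append_iff)
qed

lemma RhY_subset_chains: "s \<in> RhY gen \<Longrightarrow> s \<in> chains"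
proof (induction rule: RhY.induct)
  case (gen y)
  show ?case
    by (auto simp: chains_def gstep_def intro: exI[of _ y])
qed (auto intro: rh_mult_chains)

lemma hd_rh_mult:
  assumes "s \<in> chains" "t \<in> chains"
  shows "hd (rh_mult s t) = hd s \<bullet> hd t"
proof (cases "butlast s")
  case Nil
  then show ?thesis using chains_butlast[OF assms(1)] by (simp add: rh_mult_def)
next
  case (Cons a b)
  then have "hd s = a" by (metis assms(1) chains_butlast append_Cons list.sel(1))
  then show ?thesis using Cons by (simp add: rh_mult_def)
qed

lemma rh_mult_one_left: "t \<in> chains \<Longrightarrow> rh_mult [None] t = t"
  by (simp add: rh_mult_def lm_chain)

lemma rh_mult_one_right: "s \<in> chains \<Longrightarrow> rh_mult s [None] = s"
  by (simp add: rh_mult_def lm_chain flip: chains_butlast)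

text \<open>Leftmost terms multiply, and the adjoined identity has no proper factors. This keeps the
  special action of the identity chain compatible with products.\<close>

lemma rh_mult_eq_one:
  assumes "s \<in> chains" "t \<in> chains" "rh_mult s t = [None]"
  shows "s = [None]" "t = [None]"
  using hd_rh_mult[OF assms(1,2)] assms hd_chain_None om_eq_None by (metis list.sel(1))+

lemma lm_snoc_None:
  assumes "\<forall>x\<in>set u. x \<noteq> None"
  shows "lm (u @ [None]) = lm u @ [None]"
  using assms last_in_set[of u] by (subst lm_split) auto

lemma rh_mult_assoc:
  assumes "s \<in> chains" "t \<in> chains" "r \<in> chains"
  shows "rh_mult (rh_mult s t) r = rh_mult s (rh_mult t r)"
proof -
  let ?n = "hd t" and ?p = "hd r"
  let ?u = "map (\<lambda>m. m \<bullet> ?n) (butlast s) @ butlast t"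
  \<comment> \<open>The outer product strips the final identity of \<open>rh_mult s t\<close>; this
    commutes with \<open>lm\<close> only because no other term is the identity.\<close>
  have "\<forall>x\<in>set ?u. x \<noteq> None"
  proof
    fix x assume "x \<in> set ?u"
    then consider m where "m \<in> set (butlast s)" "x = m \<bullet> ?n" | "x \<in> set (butlast t)" by auto
    then show "x \<noteq> None" by cases (metis assms chains_proper om_eq_None)+
  qed
  then have "lm (?u @ [None]) = lm ?u @ [None]" by (rule lm_snoc_None)
  then have st: "rh_mult s t = lm ?u @ [None]"
    using chains_butlast[OF assms(2)] by (simp add: rh_mult_def)
  have "rh_mult (rh_mult s t) r = lm (map (\<lambda>m. m \<bullet> ?p) ?u @ r)"
    unfolding st by (simp add: rh_mult_def lm_map_lm L_eq_cong del: map_append)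
  also have "\<dots> = lm (map (\<lambda>m. m \<bullet> (?n \<bullet> ?p)) (butlast s) @ (map (\<lambda>m. m \<bullet> ?p) (butlast t) @ r))"
    by (simp add: om_assoc comp_def)
  also have "\<dots> = lm (map (\<lambda>m. m \<bullet> (?n \<bullet> ?p)) (butlast s) @ rh_mult t r)"
    by (simp only: rh_mult_def lm_append_lm)
  also have "\<dots> = rh_mult s (rh_mult t r)"
    using hd_rh_mult[OF assms(2,3)] by (simp add: rh_mult_def)
  finally show ?thesis .
qed

section \<open>Levels of a chain and their behaviour under multiplication\<close>

text \<open>The chain is read level by level: \<open>up k s\<close> is its part of height below \<open>k\<close>,
  \<open>nx k s\<close> the L-class of the next element down (empty if there is none), \<open>elt k s\<close> the lowest
  element of height at most \<open>k\<close>, and \<open>par k s\<close> the lowest one of height below \<open>k\<close>. The pair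
  \<open>(up k s, nx k s)\<close> is exactly the information carried by the first \<open>2 * k\<close> coordinates.\<close>

definition up :: "nat \<Rightarrow> 'm option list \<Rightarrow> 'm option list" where
  "up k s = dropWhile (\<lambda>x. k \<le> ht x) s"

definition nx :: "nat \<Rightarrow> 'm option list \<Rightarrow> 'm option set" where
  "nx k s = (if takeWhile (\<lambda>x. k \<le> ht x) s = [] then {} else Lcls (last (takeWhile (\<lambda>x. k \<le> ht x) s)))"

definition elt :: "nat \<Rightarrow> 'm option list \<Rightarrow> 'm option" where
  "elt k s = hd (up (Suc k) s)"

definition par :: "nat \<Rightarrow> 'm option list \<Rightarrow> 'm option" where
  "par k s = (if up k s = [] then None else hd (up k s))"

text \<open>Decides whether t acts at level k by a permutation or by a constant map. Only
  \<open>hd t\<close> enters, since this is the factor by which all proper terms of s are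
  multiplied.\<close>

definition idt :: "nat \<Rightarrow> 'm option list \<Rightarrow> 'm option list \<Rightarrow> bool" where
  "idt k s t \<longleftrightarrow> R_eq (elt k s \<bullet> hd t) (elt k s)"

definition mulc :: "'m option set \<Rightarrow> 'm option \<Rightarrow> 'm option set" where
  "mulc N n = {x. \<exists>z\<in>N. L_eq x (z \<bullet> n)}"

lemma mulc_empty [simp]: "mulc {} n = {}"
  by (simp add: mulc_def)

lemma mulc_Lcls [simp]: "mulc (Lcls z) n = Lcls (z \<bullet> n)"
  unfolding mulc_def Lcls_def by (auto intro: L_eq_trans L_eq_cong L_eq_refl)

lemma chain_not_Nil: "s \<in> chains \<Longrightarrow> s \<noteq> []"
  and last_chain: "s \<in> chains \<Longrightarrow> last s = None"
  by (simp_all add: chains_def)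

lemma up_Suc_not_Nil:
  assumes "s \<in> chains"
  shows "up (Suc k) s \<noteq> []"
  using last_in_set[OF chain_not_Nil[OF assms]] last_chain[OF assms]
  by (auto simp: up_def dropWhile_eq_Nil_conv intro!: bexI[of _ None])

lemma last_up: "up k s \<noteq> [] \<Longrightarrow> s \<in> chains \<Longrightarrow> last (up k s) = None"
  unfolding up_def by (metis last_appendR last_chain takeWhile_dropWhile_id)

lemma up_0 [simp]: "up 0 s = []"
  by (simp add: up_def)

lemma nx_0 [simp]: "s \<in> chains \<Longrightarrow> nx 0 s = Lcls None"
  by (simp add: nx_def chain_not_Nil last_chain takeWhile_eq_all_conv[THEN iffD2])

lemma up_sorted:
  assumes "s \<in> chains"
  shows "sorted_wrt L_le (up k s)" "sorted_wrt (\<lambda>a b. ht b < ht a) (up k s)"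
  using chains_sorted[OF assms] unfolding up_def
  by (metis sorted_wrt_append takeWhile_dropWhile_id)+

lemma ht_elt: "s \<in> chains \<Longrightarrow> ht (elt k s) \<le> k"
  using hd_dropWhile[of "\<lambda>x. Suc k \<le> ht x" s] up_Suc_not_Nil[of s k]
  by (auto simp: elt_def up_def)

lemma nx_ht: "z \<in> nx k s \<Longrightarrow> k \<le> ht z"
proof -
  assume z: "z \<in> nx k s"
  let ?t = "takeWhile (\<lambda>x. k \<le> ht x) s"
  have "?t \<noteq> []" "L_eq z (last ?t)" using z by (auto simp: nx_def split: if_splits)
  moreover then have "k \<le> ht (last ?t)" by (metis last_in_set set_takeWhileD)
  ultimately show ?thesis using ht_L_eq by metis
qed

text \<open>Heights decrease strictly along the list, so at most one term has height exactly k: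
  either it is \<open>elt k s\<close>, or level k is skipped.\<close>

lemma up_Suc:
  assumes "s \<in> chains"
  shows "ht (elt k s) = k \<Longrightarrow> up (Suc k) s = elt k s # up k s \<and> nx k s = Lcls (elt k s)"
    and "ht (elt k s) \<noteq> k \<Longrightarrow> up (Suc k) s = up k s \<and> nx (Suc k) s = nx k s"
proof -
  let ?A = "takeWhile (\<lambda>x. Suc k \<le> ht x) s" and ?e = "elt k s"
  obtain B where B: "up (Suc k) s = ?e # B"
    using up_Suc_not_Nil[OF assms] by (metis elt_def list.exhaust_sel)
  have s: "s = ?A @ ?e # B" using B unfolding up_def by (metis takeWhile_dropWhile_id)
  have A: "\<forall>x\<in>set ?A. k \<le> ht x" by (auto dest!: set_takeWhileD)
  have Bht: "\<forall>x\<in>set B. ht x < ht ?e" using up_sorted(2)[OF assms, of "Suc k"] B by simp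
  have td: "takeWhile (\<lambda>x. k \<le> ht x) (?A @ C) = ?A @ takeWhile (\<lambda>x. k \<le> ht x) C"
    "dropWhile (\<lambda>x. k \<le> ht x) (?A @ C) = dropWhile (\<lambda>x. k \<le> ht x) C" for C
    using A by (auto intro: takeWhile_append2 dropWhile_append2)
  {
    assume h: "ht ?e = k"
    then have "takeWhile (\<lambda>x. k \<le> ht x) B = []" "dropWhile (\<lambda>x. k \<le> ht x) B = B"
      using Bht by (cases B; simp)+
    then have "takeWhile (\<lambda>x. k \<le> ht x) s = ?A @ [?e]" "dropWhile (\<lambda>x. k \<le> ht x) s = B"
      using td[of "?e # B"] s h by simp_all
    then show "up (Suc k) s = elt k s # up k s \<and> nx k s = Lcls (elt k s)"
      using B by (simp add: nx_def) (simp add: up_def)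
  next
    assume "ht ?e \<noteq> k"
    then have h: "ht ?e < k" using ht_elt[OF assms, of k] by simp
    then have "takeWhile (\<lambda>x. k \<le> ht x) s = ?A" "dropWhile (\<lambda>x. k \<le> ht x) s = ?e # B"
      using td[of "?e # B"] s by simp_all
    then show "up (Suc k) s = up k s \<and> nx (Suc k) s = nx k s"
      using B by (simp add: nx_def) (simp add: up_def)
  }
qed

text \<open>Whether the chain skips height k is thus known before any coordinate of that level is
  read.\<close>

lemma ht_elt_iff: "s \<in> chains \<Longrightarrow> ht (elt k s) = k \<longleftrightarrow> (\<exists>z\<in>nx k s. ht z = k)"
  using up_Suc[of s k] nx_ht[of _ "Suc k" s]
  by (metis L_eq_refl Lcls_iff Suc_n_not_le_n)

lemma up_lm: "up k (lm w) = lm (up k w)"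
  unfolding up_def by (rule lm_takeWhile_dropWhile) (simp add: ht_L_eq)

lemma nx_lm: "nx k (lm w) = nx k w"
proof -
  have "takeWhile (\<lambda>x. k \<le> ht x) (lm w) = lm (takeWhile (\<lambda>x. k \<le> ht x) w)"
    by (rule lm_takeWhile_dropWhile) (simp add: ht_L_eq)
  then show ?thesis
    by (auto simp: nx_def Lcls_eq_iff[THEN iffD2, OF L_eq_last_lm])
qed

text \<open>Terms of height at least k keep such a height, so they split off from the raw product.
  All that remains visible of them is the L-class of the last one, and only if no term of W of
  height at least k comes after it.\<close>

lemma up_nx_rh_mult:
  fixes s t :: "'m option list"
  assumes "s \<in> chains" "up k s \<noteq> []"
  defines "W \<equiv> map (\<lambda>m. m \<bullet> hd t) (butlast (up k s)) @ t"
  shows "up k (rh_mult s t) = lm (up k W)"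
    and "nx k (rh_mult s t) = (if takeWhile (\<lambda>x. k \<le> ht x) W = [] then mulc (nx k s) (hd t) else nx k W)"
proof -
  let ?P = "\<lambda>x. k \<le> ht x" and ?f = "\<lambda>m. m \<bullet> hd t"
  let ?A = "takeWhile ?P s"
  have "butlast s = ?A @ butlast (up k s)"
    using assms(2) by (metis butlast_append takeWhile_dropWhile_id up_def)
  then have raw: "rh_mult s t = lm (map ?f ?A @ W)"
    by (simp add: rh_mult_def W_def)
  have A: "\<forall>x\<in>set (map ?f ?A). ?P x"
    using ht_om by (auto dest!: set_takeWhileD intro: order_trans)
  then have td: "takeWhile ?P (map ?f ?A @ W) = map ?f ?A @ takeWhile ?P W"
    "dropWhile ?P (map ?f ?A @ W) = dropWhile ?P W"
    by (blast intro: takeWhile_append2 dropWhile_append2)+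
  then show "up k (rh_mult s t) = lm (up k W)"
    unfolding raw up_lm by (simp add: up_def)
  show "nx k (rh_mult s t) = (if takeWhile ?P W = [] then mulc (nx k s) (hd t) else nx k W)"
    unfolding raw nx_lm unfolding nx_def td by (auto simp: last_map)
qed

text \<open>The formulas of \<open>up_nx_rh_mult\<close> involve s only through
  \<open>up k s\<close> and \<open>nx k s\<close>. They do not apply at k = 0, but there the data
  agree for all chains.\<close>

lemma st_cong:
  assumes "s \<in> chains" "s' \<in> chains" "t \<in> chains" "up k s = up k s'" "nx k s = nx k s'"
  shows "up k (rh_mult s t) = up k (rh_mult s' t) \<and> nx k (rh_mult s t) = nx k (rh_mult s' t)"
proof (cases "k = 0")
  case True
  then show ?thesis using assms by (simp add: rh_mult_chains)
next
  case False
  then have "up k s \<noteq> []" using up_Suc_not_Nil[OF assms(1), of "k - 1"] by simp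
  then show ?thesis using up_nx_rh_mult[of s k t] up_nx_rh_mult[of s' k t] assms by simp
qed

text \<open>At an occupied level \<open>nx k s\<close> is the L-class of \<open>elt k s\<close>; at
  a skipped one \<open>elt k s\<close> is the head of the known part \<open>up k s\<close>.\<close>

lemma elt_cong:
  assumes "s \<in> chains" "s' \<in> chains" "up k s = up k s'" "nx k s = nx k s'"
  shows "L_eq (elt k s) (elt k s')" "ht (elt k s) = k \<longleftrightarrow> ht (elt k s') = k"
    "ht (elt k s) \<noteq> k \<Longrightarrow> elt k s = elt k s'"
proof -
  show 1: "ht (elt k s) = k \<longleftrightarrow> ht (elt k s') = k"
    using assms ht_elt_iff[of s k] ht_elt_iff[of s' k] by simp
  show "elt k s = elt k s'" if "ht (elt k s) \<noteq> k"
    using that 1 up_Suc(2)[OF assms(1), of k] up_Suc(2)[OF assms(2), of k] assms(3)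
    unfolding elt_def by metis
  then show "L_eq (elt k s) (elt k s')"
    using 1 up_Suc(1)[OF assms(1), of k] up_Suc(1)[OF assms(2), of k] assms(4)
    by (metis L_eq_refl Lcls_eq_iff)
qed

lemma idt_cong:
  assumes "s \<in> chains" "s' \<in> chains" "up k s = up k s'" "nx k s = nx k s'"
  shows "idt k s t \<longleftrightarrow> idt k s' t"
  unfolding idt_def using R_eq_om_cong[OF elt_cong(1)[OF assms]] .

lemma elt_Cons:
  assumes "s \<in> chains" "elt k s \<noteq> None"
  obtains B where "up (Suc k) s = elt k s # B" "B \<noteq> []"
proof -
  have "up (Suc k) s \<noteq> []" "last (up (Suc k) s) = None"
    using up_Suc_not_Nil[OF assms(1)] last_up[OF _ assms(1)] by auto
  then show thesis using that assms(2) unfolding elt_def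
    by (metis last.simps list.exhaust_sel)
qed

lemma idt_rh_mult:
  assumes "s \<in> chains" "t \<in> chains" "t \<noteq> [None]" "idt k s t"
  shows "elt k (rh_mult s t) = elt k s \<bullet> hd t"
    and "nx (Suc k) (rh_mult s t) = mulc (nx (Suc k) s) (hd t)"
    and "R_eq (elt k (rh_mult s t)) (elt k s)"
proof -
  have n: "hd t \<noteq> None" using hd_chain_None assms(2,3) by blast
  have R: "R_eq (elt k s \<bullet> hd t) (elt k s)" using assms(4) by (simp add: idt_def)
  \<comment> \<open>The identity is alone in its R-class, so a nontrivial t always drops it. Hence
    \<open>elt k s\<close> is among the terms that really get multiplied.\<close>
  then have "elt k s \<noteq> None" using n by (metis R_eq_None(2) om.simps(1))
  then obtain B where B: "up (Suc k) s = elt k s # B" "B \<noteq> []" using elt_Cons assms(1) by blast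
  have h: "ht (elt k s \<bullet> hd t) < Suc k"
    using ht_R_eq[OF R] ht_elt[OF assms(1), of k] by simp
  let ?W = "map (\<lambda>m. m \<bullet> hd t) (butlast (up (Suc k) s)) @ t"
  have W: "?W = (elt k s \<bullet> hd t) # map (\<lambda>m. m \<bullet> hd t) (butlast B) @ t"
    using B by simp
  have "takeWhile (\<lambda>x. Suc k \<le> ht x) ?W = []" "up (Suc k) ?W = ?W"
    using h unfolding W by (simp_all add: up_def)
  then show 1: "elt k (rh_mult s t) = elt k s \<bullet> hd t"
    and "nx (Suc k) (rh_mult s t) = mulc (nx (Suc k) s) (hd t)"
    using up_nx_rh_mult[OF assms(1) up_Suc_not_Nil[OF assms(1)], of k t] W
    by (simp_all add: elt_def)
  show "R_eq (elt k (rh_mult s t)) (elt k s)" using 1 R by simp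
qed

text \<open>If the element at height \<open>k\<close> drops, nothing is left of it but the L-class it drops to,
  and that is already determined by the chain above height \<open>k\<close>.\<close>

lemma not_idt_cong:
  assumes "s \<in> chains" "s' \<in> chains" "t \<in> chains" "t \<noteq> [None]"
    and st: "up k s = up k s'" "nx k s = nx k s'" and nid: "\<not> idt k s t"
  shows "up (Suc k) (rh_mult s t) = up (Suc k) (rh_mult s' t)"
    and "nx (Suc k) (rh_mult s t) = nx (Suc k) (rh_mult s' t)"
proof -
  let ?P = "\<lambda>x. Suc k \<le> ht x" and ?f = "\<lambda>m. m \<bullet> hd t"
  note m = up_nx_rh_mult[OF assms(1) up_Suc_not_Nil[OF assms(1)], of k t]
    and m' = up_nx_rh_mult[OF assms(2) up_Suc_not_Nil[OF assms(2)], of k t]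
  have "up (Suc k) (rh_mult s t) = up (Suc k) (rh_mult s' t)
      \<and> nx (Suc k) (rh_mult s t) = nx (Suc k) (rh_mult s' t)"
  proof (cases "ht (elt k s) = k")
    \<comment> \<open>Level k is skipped, so the data for k and \<open>Suc k\<close> agree.\<close>
    case False
    then show ?thesis
      using elt_cong(2)[OF assms(1,2) st] up_Suc(2) assms(1,2,3) st by (intro st_cong) simp_all
  next
    case True
    then have True': "ht (elt k s') = k" using elt_cong(2)[OF assms(1,2) st] by simp
    note u = up_Suc(1)[OF assms(1) True] up_Suc(1)[OF assms(2) True']
    show ?thesis
    proof (cases "up k s = []")
      \<comment> \<open>Here \<open>elt k s\<close> is the identity and k = 0. The first term of t
        has positive height, so the data of the product come from t alone.\<close>
      case empty: True
      have "hd t \<noteq> None" using hd_chain_None assms(3,4) by blast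
      moreover have "elt k s = None" "elt k s' = None"
        using last_up[OF up_Suc_not_Nil assms(1)] last_up[OF up_Suc_not_Nil assms(2)]
          u empty st assms(1,2) by (metis last.simps)+
      moreover obtain n r where "t = n # r" using chain_not_Nil[OF assms(3)] by (cases t) auto
      ultimately have "takeWhile ?P t \<noteq> []" 
        using True ht_eq_0[of n] by (auto simp del: ht_eq_0)
      then show ?thesis using m m' u empty st by simp
    next
      case False
      let ?r = "map ?f (butlast (up k s)) @ t"
      have q: "L_eq (elt k s) (elt k s')" using u st Lcls_eq_iff by metis
      have nid': "\<not> idt k s' t" using nid idt_cong[OF assms(1,2) st] by simp
      have h: "?P (elt k s \<bullet> hd t)" "?P (elt k s' \<bullet> hd t)"
        using nid nid' True True' ht_om[of "elt k s" "hd t"] ht_om[of "elt k s'" "hd t"]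
        unfolding idt_def R_eq_iff_ht by auto
      have W: "map ?f (butlast (up (Suc k) s)) @ t = (elt k s \<bullet> hd t) # ?r"
        "map ?f (butlast (up (Suc k) s')) @ t = (elt k s' \<bullet> hd t) # ?r"
        using u False st by simp_all
      have "up (Suc k) ((elt k s \<bullet> hd t) # ?r) = up (Suc k) ((elt k s' \<bullet> hd t) # ?r)"
        unfolding up_def using h by simp
      moreover have "nx (Suc k) ((elt k s \<bullet> hd t) # ?r) = nx (Suc k) ((elt k s' \<bullet> hd t) # ?r)"
        unfolding nx_def using h L_eq_cong[OF q] by (simp add: Lcls_eq_iff)
      moreover have "takeWhile ?P ((elt k s \<bullet> hd t) # ?r) \<noteq> []"
        "takeWhile ?P ((elt k s' \<bullet> hd t) # ?r) \<noteq> []" using h by simp_all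
      ultimately show ?thesis using m m' unfolding W by simp
    qed
  qed
  then show "up (Suc k) (rh_mult s t) = up (Suc k) (rh_mult s' t)"
    "nx (Suc k) (rh_mult s t) = nx (Suc k) (rh_mult s' t)" by blast+
qed

lemma elt_antimono:
  assumes "s \<in> chains" "k \<le> k'"
  shows "L_le (elt k' s) (elt k s)"
proof -
  have "L_le (elt (Suc k) s) (elt k s)" for k
  proof (cases "ht (elt (Suc k) s) = Suc k")
    case True
    then have "sorted_wrt L_le (elt (Suc k) s # up (Suc k) s)"
      using up_Suc(1)[OF assms(1)] up_sorted(1)[OF assms(1), of "Suc (Suc k)"] by metis
    then show ?thesis using up_Suc_not_Nil[OF assms(1), of k] by (simp add: elt_def[of k])
  next
    case False
    then show ?thesis using up_Suc(2)[OF assms(1), of "Suc k"] by (simp add: elt_def)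
  qed
  with assms(2) show ?thesis by (induction rule: dec_induct) (simp, blast intro: L_le_trans)
qed

end

section \<open>Sequential actions from coordinates\<close>

primrec codes :: "(nat \<Rightarrow> 's \<Rightarrow> 'x) \<Rightarrow> nat \<Rightarrow> 's \<Rightarrow> 'x list" where
  "codes c 0 s = []"
| "codes c (Suc i) s = c (Suc i) s # codes c i s"

lemma length_codes [simp]: "length (codes c i s) = i"
  by (induction i) auto

lemma drop_codes: "j \<le> i \<Longrightarrow> drop (i - j) (codes c i s) = codes c j s"
proof (induction i)
  case (Suc i)
  then show ?case by (cases "j = Suc i") (auto simp: Suc_diff_le)
qed simp

lemma codes_eq_mono: "codes c i s = codes c i s' \<Longrightarrow> j \<le> i \<Longrightarrow> codes c j s = codes c j s'"
  by (metis drop_codes)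

lemma tuples_Cons: "tuples X (Suc n) (x # xs) \<longleftrightarrow> x \<in> X (Suc n) \<and> tuples X n xs"
  unfolding tuples_def by (auto simp: less_Suc_eq_0_disj nth_Cons')

lemma tuples_0 [simp]: "tuples X 0 xs \<longleftrightarrow> xs = []"
  by (auto simp: tuples_def)

lemma tuples_length: "tuples X n xs \<Longrightarrow> length xs = n"
  by (simp add: tuples_def)

lemma wspace_Cons:
  "x # xs \<in> wspace X \<delta> \<longleftrightarrow>
     enat (Suc (length xs)) \<le> \<delta> \<and> x \<in> X (Suc (length xs)) \<and> tuples X (length xs) xs"
  by (auto simp: wspace_def tuples_Cons)

lemma wspace_tl:
  assumes "xs \<in> wspace X \<delta>" "2 \<le> length xs"
  shows "tl xs \<in> wspace X \<delta>"
  using assms by (cases xs) (auto simp: wspace_def tuples_Cons elim: order_trans[rotated])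

lemma localmap_wid:
  assumes "tuples X i ctx" "enat (Suc i) \<le> \<delta>"
  shows "localmap (wid X \<delta>) ctx = idX (X (Suc i))"
  using assms tuples_length[OF assms(1)]
  by (auto simp: localmap_def wid_def idX_def wspace_Cons fun_eq_iff)

text \<open>Isolates the passage from coordinates to a wreath product. Each coordinate prefix is a
  right congruence; \<open>valid i s\<close> collects the next coordinates realized after the first
  i coordinates of s; \<open>idt i s t\<close> says that the local map of t at this prefix is to be
  total.\<close>

locale wreath_coding =
  fixes S :: "'s set" and mul :: "'s \<Rightarrow> 's \<Rightarrow> 's" and e :: 's
    and code :: "nat \<Rightarrow> 's \<Rightarrow> 'x" and X :: "nat \<Rightarrow> 'x set" and \<delta> :: enat
    and idt :: "nat \<Rightarrow> 's \<Rightarrow> 's \<Rightarrow> bool"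
    and valid :: "nat \<Rightarrow> 's \<Rightarrow> 'x set"
  defines "valid \<equiv> \<lambda>i s. {code (Suc i) s' | s'. s' \<in> S \<and> codes code i s' = codes code i s}"
  assumes e_in: "e \<in> S"
    and mul_in: "s \<in> S \<Longrightarrow> t \<in> S \<Longrightarrow> mul s t \<in> S"
    and assoc: "s \<in> S \<Longrightarrow> t \<in> S \<Longrightarrow> r \<in> S \<Longrightarrow> mul (mul s t) r = mul s (mul t r)"
    and e_mul: "s \<in> S \<Longrightarrow> mul e s = s" and mul_e: "s \<in> S \<Longrightarrow> mul s e = s"
    and mul_eq_e: "s \<in> S \<Longrightarrow> t \<in> S \<Longrightarrow> mul s t = e \<Longrightarrow> s = e"
    and code_in: "s \<in> S \<Longrightarrow> code (Suc i) s \<in> X (Suc i)"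
    and congr: "\<lbrakk>s \<in> S; s' \<in> S; t \<in> S; codes code i s = codes code i s'\<rbrakk>
      \<Longrightarrow> codes code i (mul s t) = codes code i (mul s' t)"
    and idt_congr: "\<lbrakk>s \<in> S; s' \<in> S; codes code i s = codes code i s'\<rbrakk> \<Longrightarrow> idt i s t = idt i s' t"
    and idt_mul: "\<lbrakk>s \<in> S; t \<in> S; r \<in> S; t \<noteq> e; r \<noteq> e\<rbrakk>
      \<Longrightarrow> idt i s (mul t r) \<longleftrightarrow> idt i s t \<and> idt i (mul s t) r"
    and valid_idt: "\<lbrakk>s \<in> S; t \<in> S; t \<noteq> e; idt i s t\<rbrakk> \<Longrightarrow> valid i (mul s t) = valid i s"
    and not_idt: "\<lbrakk>s \<in> S; s' \<in> S; t \<in> S; t \<noteq> e; \<not> idt i s t; codes code i s = codes code i s'\<rbrakk>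
      \<Longrightarrow> code (Suc i) (mul s t) = code (Suc i) (mul s' t)"
begin

text \<open>On tuples that code no element of \<open>S\<close> but whose tail does, the action fixes the first
  component where the local map has to be total; these tuples are never mapped to codes, because
  the set of valid components does not change there.\<close>

definition \<phi> :: "'s \<Rightarrow> 'x list \<Rightarrow> 'x list option" where
  "\<phi> t xs = (if t = e then wid X \<delta> xs
     else if xs \<notin> wspace X \<delta> then None
     else if \<exists>s\<in>S. xs = codes code (length xs) s
       then Some (codes code (length xs) (mul (SOME s. s \<in> S \<and> xs = codes code (length xs) s) t))
     else if \<exists>s\<in>S. tl xs = codes code (length (tl xs)) s \<and> idt (length (tl xs)) s t
       then Some (hd xs # codes code (length (tl xs))
         (mul (SOME s. s \<in> S \<and> tl xs = codes code (length (tl xs)) s) t))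
     else None)"

lemma tuples_codes: "s \<in> S \<Longrightarrow> tuples X i (codes code i s)"
  by (induction i) (auto simp: tuples_Cons code_in)

lemma wspace_codes: "s \<in> S \<Longrightarrow> 1 \<le> i \<Longrightarrow> enat i \<le> \<delta> \<Longrightarrow> codes code i s \<in> wspace X \<delta>"
  using tuples_codes[of s i] by (simp add: wspace_def)

lemma mul_some:
  assumes "s \<in> S" "t \<in> S" "xs = codes code i s"
  shows "codes code i (mul (SOME s. s \<in> S \<and> xs = codes code i s) t) = codes code i (mul s t)"
proof -
  let ?s = "SOME s. s \<in> S \<and> xs = codes code i s"
  have "\<exists>s. s \<in> S \<and> xs = codes code i s" using assms by blast
  then have "?s \<in> S \<and> xs = codes code i ?s" by (rule someI_ex)
  then show ?thesis using assms congr[of ?s s t i] by simp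
qed

lemma phi_codes:
  assumes "s \<in> S" "t \<in> S" "1 \<le> i" "enat i \<le> \<delta>"
  shows "\<phi> t (codes code i s) = Some (codes code i (mul s t))"
proof (cases "t = e")
  case True
  then show ?thesis using assms wspace_codes by (simp add: \<phi>_def wid_def mul_e)
next
  case False
  then show ?thesis
    using assms(1) wspace_codes[OF assms(1,3,4)] mul_some[OF assms(1,2) refl, of i]
    by (auto simp: \<phi>_def)
qed

lemma codes_Suc_iff:
  assumes "s \<in> S"
  shows "(\<exists>s'\<in>S. x # codes code i s = codes code (Suc i) s') \<longleftrightarrow> x \<in> valid i s"
  unfolding valid_def by auto

lemma phi_invalid:
  assumes "s \<in> S" "t \<in> S" "t \<noteq> e" "x \<in> X (Suc i)" "enat (Suc i) \<le> \<delta>" "x \<notin> valid i s"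
  shows "\<phi> t (x # codes code i s) = (if idt i s t then Some (x # codes code i (mul s t)) else None)"
proof -
  have "x # codes code i s \<in> wspace X \<delta>"
    using assms tuples_codes by (simp add: wspace_Cons)
  moreover have "\<not> (\<exists>s'\<in>S. x # codes code i s = codes code (length (x # codes code i s)) s')"
    using codes_Suc_iff[OF assms(1), of x i] assms(6) by simp
  moreover have "(\<exists>s'\<in>S. codes code i s = codes code i s' \<and> idt i s' t) \<longleftrightarrow> idt i s t"
    using assms(1) idt_congr by blast
  ultimately show ?thesis
    using assms(3) mul_some[OF assms(1,2) refl, of i] unfolding \<phi>_def by auto
qed

lemma phi_no_code:
  assumes "t \<noteq> e" "\<not> (\<exists>s\<in>S. ctx = codes code (length ctx) s)"
  shows "\<phi> t (x # ctx) = None"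
  using assms unfolding \<phi>_def by auto

lemma phi_wspace: "\<phi> t xs = Some ys \<Longrightarrow> xs \<in> wspace X \<delta>"
  by (auto simp: \<phi>_def wid_def split: if_splits)

lemma phi_cases:
  assumes "\<phi> t xs = Some ys" "t \<in> S"
  obtains (one) "t = e" "ys = xs"
  | (code) i s where "t \<noteq> e" "s \<in> S" "xs = codes code (Suc i) s" "ys = codes code (Suc i) (mul s t)"
      "enat (Suc i) \<le> \<delta>"
  | (invalid) x i s where "t \<noteq> e" "s \<in> S" "xs = x # codes code i s" "ys = x # codes code i (mul s t)"
      "idt i s t" "x \<notin> valid i s" "x \<in> X (Suc i)" "enat (Suc i) \<le> \<delta>"
proof (cases "t = e")
  case True
  then show ?thesis using one assms by (auto simp: \<phi>_def wid_def split: if_splits)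
next
  case False
  have w: "xs \<in> wspace X \<delta>" using phi_wspace assms by blast
  then obtain x ctx where xs: "xs = x # ctx" by (cases xs) (auto simp: wspace_def)
  let ?i = "length ctx"
  have x: "x \<in> X (Suc ?i)" "enat (Suc ?i) \<le> \<delta>" using w xs by (simp_all add: wspace_Cons)
  from phi_no_code[OF False, of ctx x] assms(1) xs obtain s where s: "s \<in> S" "ctx = codes code ?i s"
    by auto
  show ?thesis
  proof (cases "x \<in> valid ?i s")
    case True
    then obtain s' where s': "s' \<in> S" "xs = codes code (Suc ?i) s'"
      using s xs by (auto simp: valid_def)
    show ?thesis
      by (rule code[OF False s'(1,2) _ x(2)]) (use phi_codes[OF s'(1) assms(2) _ x(2)] s' assms in simp)
  next
    case inv: False
    from phi_invalid[OF s(1) assms(2) False x inv] assms(1) xs s(2)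
    have "idt ?i s t" "ys = x # codes code ?i (mul s t)" by (auto split: if_splits)
    then show ?thesis using invalid[OF False s(1)] xs s(2) inv x by metis
  qed
qed

lemma phi_range:
  assumes "\<phi> t xs = Some ys" "t \<in> S"
  shows "ys \<in> wspace X \<delta> \<and> length ys = length xs"
  using assms
proof (cases rule: phi_cases)
  case one
  then show ?thesis using assms phi_wspace by simp
next
  case (code i s)
  then show ?thesis using wspace_codes[OF mul_in[OF code(2) assms(2)], of "Suc i"] by simp
next
  case (invalid x i s)
  then show ?thesis using tuples_codes[OF mul_in[OF invalid(2) assms(2)], of i] by (simp add: wspace_Cons)
qed

lemma phi_tl:
  assumes "\<phi> t xs = Some ys" "t \<in> S" "2 \<le> length xs"
  shows "\<phi> t (tl xs) = Some (tl ys)"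
proof -
  have d: "enat i \<le> \<delta>" if "enat (Suc i) \<le> \<delta>" for i
    using that by (rule order_trans[rotated]) simp
  show ?thesis using assms(1,2)
  proof (cases rule: phi_cases)
    case one
    then show ?thesis
      using wspace_tl[OF phi_wspace[OF assms(1)] assms(3)] by (simp add: \<phi>_def wid_def)
  next
    case (code i s)
    then show ?thesis using phi_codes[OF code(2) assms(2), of i] assms(3) d by simp
  next
    case (invalid x i s)
    then show ?thesis using phi_codes[OF invalid(2) assms(2), of i] assms(3) d by simp
  qed
qed

lemma phi_drop:
  assumes "\<phi> t xs = Some ys" "t \<in> S" "j < length xs"
  shows "\<phi> t (drop j xs) = Some (drop j ys)"
  using assms(3)
proof (induction j)
  case (Suc j)
  then show ?case using phi_tl[of t "drop j xs" "drop j ys"] assms by (simp add: drop_Suc tl_drop)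
qed (use assms in simp)

lemma phi_sequential:
  assumes "t \<in> S"
  shows "sequential X \<delta> (\<phi> t)"
  unfolding sequential_def
proof (intro conjI allI impI)
  fix xs ys assume "\<phi> t xs = Some ys"
  then show "xs \<in> wspace X \<delta>" "ys \<in> wspace X \<delta>" "length ys = length xs"
    using phi_wspace phi_range assms by auto
next
  fix xs assume "\<phi> t xs \<noteq> None \<and> 2 \<le> length xs"
  then show "\<phi> t (tl xs) \<noteq> None" using phi_tl assms by fastforce
next
  fix xs ys xs' ys' i
  assume h: "\<phi> t xs = Some xs' \<and> \<phi> t ys = Some ys' \<and> i \<le> length xs \<and> i \<le> length ys \<and>
        drop (length xs - i) xs = drop (length ys - i) ys"
  show "drop (length xs' - i) xs' = drop (length ys' - i) ys'"
  proof (cases "i = 0")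
    case False
    then have "length xs - i < length xs" "length ys - i < length ys" using h by auto
    then have "\<phi> t (drop (length xs - i) xs) = Some (drop (length xs - i) xs')"
      "\<phi> t (drop (length ys - i) ys) = Some (drop (length ys - i) ys')"
      using h phi_drop assms by blast+
    moreover have "length xs' = length xs" "length ys' = length ys" using h phi_range assms by blast+
    ultimately show ?thesis using h by simp
  qed simp
qed

lemma phi_one: "\<phi> e = wid X \<delta>"
  by (simp add: \<phi>_def fun_eq_iff)

text \<open>On codes this is associativity. An unrealized component stays unrealized by
  \<open>valid_idt\<close>, and \<open>idt_mul\<close> makes the composite defined on it exactly
  when the product is.\<close>

lemma phi_mul:
  assumes "t \<in> S" "r \<in> S"
  shows "\<phi> (mul t r) = pcomp (\<phi> t) (\<phi> r)"
proof
  fix xs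
  consider "t = e" | "r = e" | "t \<noteq> e" "r \<noteq> e" by blast
  then show "\<phi> (mul t r) xs = pcomp (\<phi> t) (\<phi> r) xs"
  proof cases
    case 1
    have "xs \<notin> wspace X \<delta> \<Longrightarrow> \<phi> r xs = None" using phi_wspace by (cases "\<phi> r xs") auto
    then show ?thesis using 1 assms by (simp add: pcomp_def phi_one e_mul wid_def)
  next
    case 2
    then show ?thesis using assms phi_range[of t xs]
      by (cases "\<phi> t xs") (auto simp: pcomp_def phi_one mul_e wid_def)
  next
    case 3
    \<comment> \<open>By \<open>mul_eq_e\<close> the product is again nontrivial, so all three maps
      follow the same clauses of the definition.\<close>
    have tr: "mul t r \<in> S" "mul t r \<noteq> e" using mul_in[OF assms] mul_eq_e[OF assms] 3(1) by blast+
    show ?thesis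
    proof (cases "xs \<in> wspace X \<delta> \<and> (\<exists>s\<in>S. tl xs = codes code (length (tl xs)) s)")
      case False
      have "\<phi> u xs = None" if "u \<noteq> e" for u
      proof (cases "xs \<in> wspace X \<delta>")
        case True
        then obtain x ctx where xs: "xs = x # ctx" by (cases xs) (auto simp: wspace_def)
        then have "\<not> (\<exists>s\<in>S. ctx = codes code (length ctx) s)" using False True by simp
        then show ?thesis using phi_no_code[OF that] xs by simp
      qed (use that in \<open>simp add: \<phi>_def\<close>)
      then have "\<phi> t xs = None" "\<phi> (mul t r) xs = None" using 3(1) tr(2) by blast+
      then show ?thesis by (simp add: pcomp_def)
    next
      case True
      then obtain x ctx where xs: "xs = x # ctx" by (cases xs) (auto simp: wspace_def)
      let ?i = "length ctx"
      have x: "x \<in> X (Suc ?i)" "enat (Suc ?i) \<le> \<delta>" using True xs by (simp_all add: wspace_Cons)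
      obtain s where s: "s \<in> S" "ctx = codes code ?i s" using True xs by auto
      show ?thesis
      proof (cases "x \<in> valid ?i s")
        case True
        then obtain s' where s': "s' \<in> S" "xs = codes code (Suc ?i) s'"
          using s xs by (auto simp: valid_def)
        note p = phi_codes[where i = "Suc ?i", OF _ _ _ x(2)]
        show ?thesis
          using p[OF s'(1) assms(1)] p[OF mul_in[OF s'(1) assms(1)] assms(2)] p[OF s'(1) tr(1)]
            assoc[OF s'(1) assms] s'(2)
          by (simp add: pcomp_def del: codes.simps)
      next
        case inv: False
        have st: "mul s t \<in> S" using mul_in s assms by blast
        have "\<phi> r (x # codes code ?i (mul s t))
          = (if idt ?i (mul s t) r then Some (x # codes code ?i (mul (mul s t) r)) else None)"
          if "idt ?i s t"
          using phi_invalid[OF st assms(2) 3(2) x] valid_idt[OF s(1) assms(1) 3(1) that] inv by simp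
        then show ?thesis
          using phi_invalid[OF s(1) assms(1) 3(1) x inv] phi_invalid[OF s(1) tr x inv]
            idt_mul[OF s(1) assms 3] assoc[OF s(1) assms] xs s(2)
          by (auto simp: pcomp_def)
      qed
    qed
  qed
qed

text \<open>Evaluate at codes of e: \<open>\<phi> s\<close> sends them to the codes of s.\<close>

lemma phi_inj:
  assumes "\<And>s s'. s \<in> S \<Longrightarrow> s' \<in> S \<Longrightarrow> s \<noteq> s'
    \<Longrightarrow> \<exists>i. 1 \<le> i \<and> enat i \<le> \<delta> \<and> codes code i s \<noteq> codes code i s'"
  shows "inj_on \<phi> S"
  by (rule inj_onI, rule ccontr) (metis assms e_in e_mul option.inject phi_codes)

lemma localmap_no_code:
  assumes "t \<noteq> e" "\<not> (\<exists>s\<in>S. ctx = codes code (length ctx) s)"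
  shows "localmap (\<phi> t) ctx = (\<lambda>_. None)"
  using phi_no_code[OF assms] by (simp add: localmap_def)

lemma localmap_valid:
  assumes "s \<in> S" "t \<in> S" "enat (Suc i) \<le> \<delta>"
  shows "localmap (\<phi> t) (codes code i s) (code (Suc i) s) = Some (code (Suc i) (mul s t))"
  using phi_codes[OF assms(1,2), of "Suc i"] assms(3) by (simp add: localmap_def)

lemma localmap_invalid:
  assumes "s \<in> S" "t \<in> S" "t \<noteq> e" "x \<in> X (Suc i)" "enat (Suc i) \<le> \<delta>" "x \<notin> valid i s"
  shows "localmap (\<phi> t) (codes code i s) x = (if idt i s t then Some x else None)"
  using phi_invalid[OF assms] by (simp add: localmap_def)

lemma localmap_Some_iff:
  assumes "localmap (\<phi> t) ctx x = Some y" "t \<in> S" "length ctx = i"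
  shows "x \<in> X (Suc i)" "y \<in> X (Suc i)" "enat (Suc i) \<le> \<delta>"
proof -
  obtain ys where ys: "\<phi> t (x # ctx) = Some ys" "y = hd ys"
    using assms(1) by (auto simp: localmap_def)
  then have "x # ctx \<in> wspace X \<delta>" "ys \<in> wspace X \<delta>" "length ys = Suc i"
    using phi_wspace phi_range[OF ys(1) assms(2)] assms(3) by auto
  then show "x \<in> X (Suc i)" "y \<in> X (Suc i)" "enat (Suc i) \<le> \<delta>"
    using ys assms(3) by (cases ys; simp add: wspace_Cons)+
qed

lemma localmap_pmaps:
  assumes "t \<in> S" "length ctx = i"
  shows "localmap (\<phi> t) ctx \<in> pmaps (X (Suc i))"
  unfolding pmaps_def using localmap_Some_iff(1,2)[OF _ assms] by blast

lemma localmap_valid':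
  assumes "s \<in> S" "t \<in> S" "localmap (\<phi> t) (codes code i s) x = Some y" "x \<in> valid i s"
  obtains s' where "s' \<in> S" "codes code i s' = codes code i s" "x = code (Suc i) s'" and
    "y = code (Suc i) (mul s' t)"
proof -
  from assms(4) obtain s' where s': "s' \<in> S" "codes code i s' = codes code i s" "x = code (Suc i) s'"
    by (auto simp: valid_def)
  moreover have "y = code (Suc i) (mul s' t)"
    using localmap_valid[OF s'(1) assms(2), of i] s' assms(3) localmap_Some_iff(3)[OF assms(3,2)]
    by simp
  ultimately show ?thesis by (rule that)
qed

text \<open>Unrealized components have no image in this case, and by \<open>not_idt\<close> all
  realized ones have the same image.\<close>

lemma localmap_not_idt:
  assumes "s \<in> S" "t \<in> S" "t \<noteq> e" "\<not> idt i s t"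
  shows "localmap (\<phi> t) (codes code i s) \<in> constmaps (X (Suc i))"
proof -
  have "y = code (Suc i) (mul s t)" if h: "localmap (\<phi> t) (codes code i s) x = Some y" for x y
  proof -
    note d = localmap_Some_iff[OF h assms(2) length_codes]
    have v: "x \<in> valid i s"
      using localmap_invalid[OF assms(1-3) d(1,3)] h assms(4) by (cases "x \<in> valid i s") auto
    obtain s' where s': "s' \<in> S" "codes code i s' = codes code i s" "y = code (Suc i) (mul s' t)"
      using localmap_valid'[OF assms(1,2) h v] by blast
    then show ?thesis using not_idt[OF assms(1) s'(1) assms(2-4) s'(2)[symmetric]] by simp
  qed
  then have "\<exists>c. \<forall>x y. localmap (\<phi> t) (codes code i s) x = Some y \<longrightarrow> y = c" by metis
  then show ?thesis
    using localmap_pmaps[OF assms(2) length_codes] by (simp add: constmaps_def)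
qed

text \<open>Unrealized components are fixed by construction, so only realized ones need checking.
  Serves both the identity maps of condition (i) and the Zeiger property.\<close>

lemma localmap_idt_fixed:
  assumes "s \<in> S" "t \<in> S" "t \<noteq> e" "enat (Suc i) \<le> \<delta>" "idt i s t"
    and "\<And>s'. s' \<in> S \<Longrightarrow> codes code i s' = codes code i s \<Longrightarrow> code (Suc i) (mul s' t) = code (Suc i) s'"
  shows "localmap (\<phi> t) (codes code i s) = idX (X (Suc i))"
proof
  fix x
  show "localmap (\<phi> t) (codes code i s) x = idX (X (Suc i)) x"
  proof (cases "x \<in> X (Suc i)")
    case False
    then show ?thesis
      using localmap_Some_iff(1)[OF _ assms(2) length_codes, of code i s x]
      by (cases "localmap (\<phi> t) (codes code i s) x") (auto simp: idX_def)
  next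
    case x: True
    show ?thesis
    proof (cases "x \<in> valid i s")
      case True
      then obtain s' where s': "s' \<in> S" "codes code i s' = codes code i s" "x = code (Suc i) s'"
        by (auto simp: valid_def)
      then show ?thesis
        using localmap_valid[OF s'(1) assms(2,4)] assms(6)[OF s'(1,2)] x by (simp add: idX_def)
    next
      case False
      then show ?thesis using localmap_invalid[OF assms(1-3) x assms(4)] assms(5) x by (simp add: idX_def)
    qed
  qed
qed

end

section \<open>Coordinates of chains\<close>

definition rep :: "'m::semigroup_mult option set \<Rightarrow> 'm option" where
  "rep R = (SOME m. m \<in> R)"

lemma rep_R_eq: "R_eq (rep (Rcls m)) m"
proof -
  have "\<exists>x. x \<in> Rcls m" using R_eq_refl Rcls_iff by blast
  then have "rep (Rcls m) \<in> Rcls m" unfolding rep_def by (rule someI_ex)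
  then show ?thesis by simp
qed

definition beta :: "'m::semigroup_mult option \<Rightarrow> 'm option" where
  "beta m = (SOME b. m \<bullet> b = rep (Rcls m))"

lemma om_beta: "m \<bullet> beta m = rep (Rcls m)"
proof -
  have "\<exists>b. m \<bullet> b = rep (Rcls m)" using rep_R_eq[of m] unfolding R_eq_def R_le_def by metis
  then show ?thesis unfolding beta_def by (rule someI_ex)
qed

text \<open>Chosen once for a whole H-class, so that the last factor of \<open>coord\<close> is the
  same translation for all its elements.\<close>

definition gam :: "'m::semigroup_mult option set \<Rightarrow> 'm option" where
  "gam H = (SOME g. \<forall>p\<in>H. p \<bullet> g \<in> Hcls (rep (Rcls p)))"

lemma om_gam: "p \<bullet> gam (Hcls p) \<in> Hcls (rep (Rcls p))"
proof -
  obtain g where g: "rep (Rcls p) = p \<bullet> g"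
    using rep_R_eq[of p] unfolding R_eq_def R_le_def by metis
  have "q \<bullet> g \<in> Hcls (rep (Rcls q))" if "q \<in> Hcls p" for q
  proof -
    have q: "L_eq q p" "R_eq q p" using that by auto
    then have "Rcls q = Rcls p" by (simp add: Rcls_eq_iff)
    moreover have "R_eq (q \<bullet> g) q" using R_eq_om_cong[OF q(1)] g rep_R_eq by metis
    moreover have "L_eq (q \<bullet> g) (p \<bullet> g)" by (rule L_eq_cong[OF q(1)])
    ultimately show ?thesis using g rep_R_eq R_eq_trans R_eq_sym by (metis Hcls_iff)
  qed
  then have "\<exists>g. \<forall>q\<in>Hcls p. q \<bullet> g \<in> Hcls (rep (Rcls q))" by blast
  then have "\<forall>q\<in>Hcls p. q \<bullet> gam (Hcls p) \<in> Hcls (rep (Rcls q))"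
    unfolding gam_def by (rule someI_ex)
  then show ?thesis by simp
qed

text \<open>The factor \<open>beta m\<close> makes the coordinate of \<open>x\<close> relative to its predecessor \<open>m\<close> in the chain;
  this is what makes it invariant under right translations that do not drop \<open>m\<close>.\<close>

definition coord :: "'m::semigroup_mult option \<Rightarrow> 'm option \<Rightarrow> 'm option" where
  "coord m x = (x \<bullet> beta m) \<bullet> gam (Hcls (x \<bullet> beta m))"

text \<open>On one H-class both factors of \<open>coord m\<close> are constant, so it is a right
  translation onto the H-class of the representative; Green's lemma supplies its inverse w.\<close>

lemma coord_translation:
  assumes "L_le x m"
  shows "\<exists>s w.
    (\<forall>x'\<in>Hcls x. coord m x' = x' \<bullet> s \<and> (x' \<bullet> s) \<bullet> w = x' \<and> x' \<bullet> s \<in> Hcls (rep (Rcls x))) \<and>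
    (\<forall>h\<in>Hcls (rep (Rcls x)). h \<bullet> w \<in> Hcls x \<and> (h \<bullet> w) \<bullet> s = h)"
proof -
  let ?p = "x \<bullet> beta m"
  let ?s = "beta m \<bullet> gam (Hcls ?p)"
  have m: "R_eq (m \<bullet> beta m) m" by (simp add: om_beta rep_R_eq)
  have p: "R_eq ?p x" using R_eq_below[OF m assms] .
  then have rp: "rep (Rcls ?p) = rep (Rcls x)" by (metis Rcls_eq_iff)
  have s: "x \<bullet> ?s \<in> Hcls (rep (Rcls x))" using om_gam[of ?p] unfolding rp by (simp add: om_assoc)
  then have Rs: "R_eq (x \<bullet> ?s) x" using rep_R_eq R_eq_trans by (metis Hcls_iff)
  obtain w where w: "\<And>a. L_le a x \<Longrightarrow> (a \<bullet> ?s) \<bullet> w = a" using right_inverse[OF Rs] by blast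
  show ?thesis
  proof (rule exI[of _ ?s], rule exI[of _ w], intro conjI[OF ballI ballI])
    fix x' assume "x' \<in> Hcls x"
    then have x': "L_eq x' x" "R_eq x' x" by auto
    then have "L_le x' m" using assms unfolding L_eq_def by (blast intro: L_le_trans)
    then have "R_eq (x' \<bullet> beta m) x'" using R_eq_below[OF m] by blast
    then have "Hcls (x' \<bullet> beta m) = Hcls ?p"
      using x' p by (intro Hcls_eq L_eq_cong) (metis R_eq_sym R_eq_trans)+
    then have "coord m x' = x' \<bullet> ?s" by (simp add: coord_def om_assoc)
    moreover have "(x' \<bullet> ?s) \<bullet> w = x'" using w x'(1) unfolding L_eq_def by blast
    moreover have "R_eq (x' \<bullet> ?s) x'" using R_eq_om_cong[OF x'(1)] Rs by blast
    moreover have "L_eq (x' \<bullet> ?s) (x \<bullet> ?s)" by (rule L_eq_cong[OF x'(1)])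
    ultimately show "coord m x' = x' \<bullet> ?s \<and> (x' \<bullet> ?s) \<bullet> w = x' \<and> x' \<bullet> ?s \<in> Hcls (rep (Rcls x))"
      using s x'(2) L_eq_trans R_eq_trans R_eq_sym rep_R_eq by (metis Hcls_iff)
  next
    fix h assume h: "h \<in> Hcls (rep (Rcls x))"
    then have hL: "L_eq h (x \<bullet> ?s)" using s L_eq_trans L_eq_sym by (metis Hcls_iff)
    then obtain u where u: "h = u \<bullet> (x \<bullet> ?s)" unfolding L_eq_def L_le_def by blast
    have hw: "h \<bullet> w = u \<bullet> x" using u w[OF L_le_refl] by (simp add: om_assoc)
    then have 1: "(h \<bullet> w) \<bullet> ?s = h" using u by (simp add: om_assoc)
    have "L_eq (h \<bullet> w) x" using L_eq_cong[OF hL, of w] w[OF L_le_refl] by simp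
    moreover have "R_eq (h \<bullet> w) h" using 1 unfolding R_eq_def by (metis R_le_om)
    then have "R_eq (h \<bullet> w) x" using h rep_R_eq R_eq_trans by (metis Hcls_iff)
    ultimately show "h \<bullet> w \<in> Hcls x \<and> (h \<bullet> w) \<bullet> ?s = h" using 1 by simp
  qed
qed

text \<open>With x = u m, the element \<open>x \<bullet> beta m\<close> is u times the
  representative of the R-class of m, which does not change while m moves inside that class.\<close>

lemma coord_fixed:
  assumes "L_le x m" "R_eq (m \<bullet> n) m"
  shows "coord (m \<bullet> n) (x \<bullet> n) = coord m x"
proof -
  obtain u where u: "x = u \<bullet> m" using assms(1) by (auto simp: L_le_def)
  have "(x \<bullet> n) \<bullet> beta (m \<bullet> n) = u \<bullet> ((m \<bullet> n) \<bullet> beta (m \<bullet> n))" by (simp add: u om_assoc)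
  also have "\<dots> = u \<bullet> (m \<bullet> beta m)" using assms(2) by (metis om_beta Rcls_eq_iff)
  finally have "(x \<bullet> n) \<bullet> beta (m \<bullet> n) = x \<bullet> beta m" by (simp add: u om_assoc)
  then show ?thesis by (simp add: coord_def)
qed

definition encR :: "'m option set \<Rightarrow> ('m, 'y) xelem" where
  "encR R = (\<lambda>x. (Inl x, 0)) ` R"

text \<open>The tags keep the single element h and the set A apart inside one set. The result is
  never empty, which leaves \<open>{}\<close> free for skipped levels.\<close>

definition enc :: "'m option \<Rightarrow> 'y set \<Rightarrow> ('m, 'y) xelem" where
  "enc h A = insert (Inl h, 0) ((\<lambda>y. (Inr y, 0)) ` A)"

lemma enc_inject [simp]: "enc h A = enc h' A' \<longleftrightarrow> h = h' \<and> A = A'"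
proof
  assume eq: "enc h A = enc h' A'"
  have "Inl h = a \<longleftrightarrow> (a, 0) \<in> enc h A \<and> isl a" "y \<in> A \<longleftrightarrow> (Inr y, 0) \<in> enc h A"
    for h :: "'m option" and A :: "'y set" and a y
    by (auto simp: enc_def)
  then show "h = h' \<and> A = A'" unfolding set_eq_iff[of A] by (metis eq sum.inject(1))
qed simp

lemma enc_not_empty [simp]: "enc h A \<noteq> {}" "{} \<noteq> enc h A"
  by (auto simp: enc_def)

lemma encR_inject [simp]: "encR R = encR R' \<longleftrightarrow> R = R'"
  unfolding encR_def by (rule inj_image_eq_iff) (auto simp: inj_def)

context finite_above
begin

definition Ys :: "'m option \<Rightarrow> 'm option set \<Rightarrow> 'y set" where
  "Ys z N = {y. Some (gen y) \<bullet> z \<in> N}"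

text \<open>The next L-class is recorded by the set of generators leading into it, which, unlike the
  L-class itself, does not change when \<open>z\<close> is translated within its R-class. The empty set
  serves as the coordinate at heights that the chain skips.\<close>

definition code :: "nat \<Rightarrow> 'm option list \<Rightarrow> ('m, 'y) xelem" where
  "code i s = (let k = (i - 1) div 2 in
     if ht (elt k s) \<noteq> k then {}
     else if odd i then encR (Rcls (elt k s))
     else enc (coord (par k s) (elt k s)) (Ys (elt k s) (nx (Suc k) s)))"

lemma code_odd: "code (Suc (2 * k)) s = (if ht (elt k s) = k then encR (Rcls (elt k s)) else {})"
  by (simp add: code_def)

lemma code_even:
  "code (Suc (Suc (2 * k))) s = (if ht (elt k s) = k
     then enc (coord (par k s) (elt k s)) (Ys (elt k s) (nx (Suc k) s)) else {})"
  by (simp add: code_def)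

lemma elt_le_par:
  assumes "s \<in> chains" "ht (elt k s) = k"
  shows "L_le (elt k s) (par k s)"
  using up_Suc(1)[OF assms] up_sorted(1)[OF assms(1), of "Suc k"]
  by (cases "up k s") (auto simp: par_def)

lemma nx_step:
  assumes "s \<in> chains" "nx (Suc k) s \<noteq> {}"
  obtains y where "nx (Suc k) s = Lcls (Some (gen y) \<bullet> elt k s)" "\<not> L_eq (Some (gen y) \<bullet> elt k s) (elt k s)"
proof -
  let ?A = "takeWhile (\<lambda>x. Suc k \<le> ht x) s"
  have A: "?A \<noteq> []" "nx (Suc k) s = Lcls (last ?A)" using assms(2) by (auto simp: nx_def split: if_splits)
  have "successively gstep (?A @ up (Suc k) s)"
    using assms(1) by (simp add: chains_def up_def)
  then have "gstep (last ?A) (elt k s)"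
    using A(1) up_Suc_not_Nil[OF assms(1), of k] by (auto simp: successively_append_iff elt_def)
  then obtain y where y: "\<not> L_eq (last ?A) (elt k s)" "L_eq (last ?A) (Some (gen y) \<bullet> elt k s)"
    by (auto simp: gstep_def)
  show ?thesis
    by (rule that[of y]) (use A(2) y Lcls_eq_iff L_eq_trans in metis)+
qed

lemma nx_le:
  assumes "s \<in> chains" "z \<in> nx (Suc k) s"
  shows "L_le z (elt k s)"
proof -
  have "nx (Suc k) s \<noteq> {}" using assms(2) by blast
  then obtain y where "nx (Suc k) s = Lcls (Some (gen y) \<bullet> elt k s)" using nx_step[OF assms(1)] by blast
  then have "L_le z (Some (gen y) \<bullet> elt k s)" using assms(2) by (simp add: L_eq_def)
  then show ?thesis by (rule L_le_trans) simp
qed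

lemma nx_L_closed: "z \<in> nx k s \<Longrightarrow> L_eq z' z \<Longrightarrow> z' \<in> nx k s"
  by (auto simp: nx_def split: if_splits intro: L_eq_trans)

text \<open>The next L-class consists of the elements L-equivalent to a recorded generator times
  \<open>elt k s\<close>. An empty record can only mean that the chain stops, since it continues by
  generator steps.\<close>

lemma nx_Ys_cong:
  assumes "s \<in> chains" "s' \<in> chains" "elt k s = elt k s'"
    and eq: "Ys (elt k s) (nx (Suc k) s) = Ys (elt k s) (nx (Suc k) s')"
  shows "nx (Suc k) s = nx (Suc k) s'"
proof -
  have rec: "nx (Suc k) s = {z. \<exists>y \<in> Ys (elt k s) (nx (Suc k) s). L_eq z (Some (gen y) \<bullet> elt k s)}"
    if s: "s \<in> chains" for s
  proof (cases "nx (Suc k) s = {}")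
    case False
    then obtain y where y: "nx (Suc k) s = Lcls (Some (gen y) \<bullet> elt k s)" using nx_step[OF s] by blast
    show ?thesis unfolding y by (auto simp: Ys_def intro: L_eq_trans exI[of _ y])
  qed (simp add: Ys_def)
  show ?thesis using rec[OF assms(1)] rec[OF assms(2)] assms(3) eq by simp
qed

text \<open>For the harder direction, \<open>nx k\<close> gives the L-class of the element of height
  k, the odd coordinate its R-class, injectivity of \<open>coord\<close> on the H-class the element
  itself, and the generator set the next L-class.\<close>

lemma codes_even_iff:
  assumes "s \<in> chains" "s' \<in> chains"
  shows "codes code (2 * k) s = codes code (2 * k) s' \<longleftrightarrow> up k s = up k s' \<and> nx k s = nx k s'"
proof (induction k)
  case 0
  then show ?case using assms by simp
next
  case (Suc k)
  have cs: "codes code (2 * Suc k) s = codes code (2 * Suc k) s' \<longleftrightarrow>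
    code (Suc (Suc (2 * k))) s = code (Suc (Suc (2 * k))) s' \<and> code (Suc (2 * k)) s = code (Suc (2 * k)) s'
      \<and> up k s = up k s' \<and> nx k s = nx k s'"
    using Suc by simp
  show ?case
  proof
    assume eq: "up (Suc k) s = up (Suc k) s' \<and> nx (Suc k) s = nx (Suc k) s'"
    then have e: "elt k s = elt k s'" by (simp add: elt_def)
    have st: "up k s = up k s' \<and> nx k s = nx k s'"
      using up_Suc[OF assms(1), of k] up_Suc[OF assms(2), of k] eq e
      by (cases "ht (elt k s) = k") simp_all
    then have "par k s = par k s'" by (simp add: par_def)
    then show "codes code (2 * Suc k) s = codes code (2 * Suc k) s'"
      unfolding cs code_even code_odd using st e eq by simp
  next
    assume "codes code (2 * Suc k) s = codes code (2 * Suc k) s'"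
    then have c: "code (Suc (Suc (2 * k))) s = code (Suc (Suc (2 * k))) s'"
      "code (Suc (2 * k)) s = code (Suc (2 * k)) s'" and st: "up k s = up k s'" "nx k s = nx k s'"
      unfolding cs by auto
    note ec = elt_cong[OF assms st]
    show "up (Suc k) s = up (Suc k) s' \<and> nx (Suc k) s = nx (Suc k) s'"
    proof (cases "ht (elt k s) = k")
      case False
      then show ?thesis using up_Suc(2)[OF assms(1)] up_Suc(2)[OF assms(2)] ec(2) st by metis
    next
      case True
      note T = True True[unfolded ec(2)]
      let ?m = "par k s"
      have m: "par k s' = ?m" by (simp add: par_def st)
      have "R_eq (elt k s) (elt k s')" using c(2) T by (simp add: code_odd Rcls_eq_iff)
      then have H: "elt k s' \<in> Hcls (elt k s)" using ec(1) L_eq_sym R_eq_sym by auto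
      have cc: "coord ?m (elt k s) = coord ?m (elt k s')"
        and ys: "Ys (elt k s) (nx (Suc k) s) = Ys (elt k s') (nx (Suc k) s')"
        using c(1) T by (auto simp: code_even m)
      have "elt k s = elt k s'"
        using coord_translation[OF elt_le_par[OF assms(1) T(1)]] H cc
        by (metis Hcls_iff L_eq_refl R_eq_refl)
      then show ?thesis
        using nx_Ys_cong[OF assms] ys up_Suc(1)[OF assms(1) T(1)] up_Suc(1)[OF assms(2) T(2)] st by simp
    qed
  qed
qed

lemma codes_odd_iff:
  assumes "s \<in> chains" "s' \<in> chains"
  shows "codes code (Suc (2 * k)) s = codes code (Suc (2 * k)) s' \<longleftrightarrow>
    up k s = up k s' \<and> nx k s = nx k s' \<and> (ht (elt k s) = k \<longrightarrow> R_eq (elt k s) (elt k s'))"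
  using codes_even_iff[OF assms, of k] elt_cong(2)[OF assms, of k]
  by (auto simp: code_odd Rcls_eq_iff)

lemma codes_inj:
  assumes "s \<in> chains" "s' \<in> chains" "ht (hd s) \<le> k" "ht (hd s') \<le> k"
    "codes code (2 * Suc k) s = codes code (2 * Suc k) s'"
  shows "s = s'"
proof -
  have "up (Suc k) s = s" if "s \<in> chains" "ht (hd s) \<le> k" for s
    using that chain_not_Nil[of s] by (cases s) (auto simp: up_def)
  then show ?thesis using codes_even_iff[OF assms(1,2), of "Suc k"] assms by simp
qed

lemma idt_level:
  assumes "s \<in> chains" "s' \<in> chains" "codes code i s = codes code i s'"
  shows "up (i div 2) s = up (i div 2) s' \<and> nx (i div 2) s = nx (i div 2) s'"
proof -
  have "codes code (2 * (i div 2)) s = codes code (2 * (i div 2)) s'"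
    by (rule codes_eq_mono[OF assms(3)]) simp
  then show ?thesis using codes_even_iff[OF assms(1,2)] by simp
qed

lemma idt_code_odd:
  assumes "s \<in> chains" "t \<in> chains" "t \<noteq> [None]" "idt k s t"
  shows "code (Suc (2 * k)) (rh_mult s t) = code (Suc (2 * k)) s"
  using idt_rh_mult(3)[OF assms] by (simp add: code_odd ht_R_eq Rcls_eq_iff)

lemma not_idt_codes:
  assumes "s \<in> chains" "s' \<in> chains" "t \<in> chains" "t \<noteq> [None]"
    "codes code (2 * k) s = codes code (2 * k) s'" "\<not> idt k s t"
  shows "codes code (2 * Suc k) (rh_mult s t) = codes code (2 * Suc k) (rh_mult s' t)"
proof -
  have st: "up k s = up k s'" "nx k s = nx k s'" using codes_even_iff[OF assms(1,2)] assms(5) by auto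
  show ?thesis
    unfolding codes_even_iff[OF rh_mult_chains[OF assms(1,3)] rh_mult_chains[OF assms(2,3)]]
    using not_idt_cong[OF assms(1-4) st assms(6)] by blast
qed

lemma code_congr:
  assumes "s \<in> chains" "s' \<in> chains" "t \<in> chains" "codes code i s = codes code i s'"
  shows "codes code i (rh_mult s t) = codes code i (rh_mult s' t)"
proof (cases "t = [None]")
  case True
  then show ?thesis using assms by (simp add: rh_mult_one_right)
next
  case t: False
  let ?k = "i div 2"
  have st: "up ?k s = up ?k s'" "nx ?k s = nx ?k s'" using idt_level[OF assms(1,2,4)] by auto
  note ch = rh_mult_chains[OF assms(1,3)] rh_mult_chains[OF assms(2,3)]
  have ev: "codes code (2 * ?k) (rh_mult s t) = codes code (2 * ?k) (rh_mult s' t)"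
    unfolding codes_even_iff[OF ch] using st_cong[OF assms(1-3) st] .
  show ?thesis
  proof (cases "even i")
    case True
    then show ?thesis using ev by simp
  next
    case False
    then have i: "i = Suc (2 * ?k)" by simp
    have c: "code (Suc (2 * ?k)) s = code (Suc (2 * ?k)) s'"
      using assms(4) by (subst (asm) (1 2) i) simp
    \<comment> \<open>The odd coordinate is copied if the element stays in its R-class, and forced
      by the earlier coordinates if it drops.\<close>
    have "code (Suc (2 * ?k)) (rh_mult s t) = code (Suc (2 * ?k)) (rh_mult s' t)"
    proof (cases "idt ?k s t")
      case True
      moreover have "idt ?k s' t" using True idt_cong[OF assms(1,2) st] by simp
      ultimately show ?thesis using idt_code_odd assms(1-3) t c by metis
    next
      case False
      have "codes code (2 * ?k) s = codes code (2 * ?k) s'" using codes_even_iff[OF assms(1,2)] st by simp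
      from not_idt_codes[OF assms(1-3) t this False] show ?thesis by simp
    qed
    then have "codes code (Suc (2 * ?k)) (rh_mult s t) = codes code (Suc (2 * ?k)) (rh_mult s' t)"
      using ev by simp
    then show ?thesis by (subst (1 2) i)
  qed
qed

lemma not_idt_code:
  assumes "s \<in> chains" "s' \<in> chains" "t \<in> chains" "t \<noteq> [None]"
    "\<not> idt (i div 2) s t" "codes code i s = codes code i s'"
  shows "code (Suc i) (rh_mult s t) = code (Suc i) (rh_mult s' t)"
proof -
  let ?k = "i div 2"
  have "codes code (2 * ?k) s = codes code (2 * ?k) s'"
    by (rule codes_eq_mono[OF assms(6)]) simp
  from not_idt_codes[OF assms(1-4) this assms(5)]
  have "codes code (Suc i) (rh_mult s t) = codes code (Suc i) (rh_mult s' t)"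
    by (rule codes_eq_mono) simp
  then show ?thesis by simp
qed

text \<open>If x t r is R-equivalent to x, then x t is squeezed between them in the R-order; the
  converse is transitivity.\<close>

lemma idt_mult:
  assumes "s \<in> chains" "t \<in> chains" "r \<in> chains" "t \<noteq> [None]" "r \<noteq> [None]"
  shows "idt k s (rh_mult t r) \<longleftrightarrow> idt k s t \<and> idt k (rh_mult s t) r"
proof
  assume "idt k s (rh_mult t r)"
  then have R: "R_eq ((elt k s \<bullet> hd t) \<bullet> hd r) (elt k s)"
    by (simp add: idt_def hd_rh_mult[OF assms(2,3)] om_assoc)
  then have "R_le (elt k s) (elt k s \<bullet> hd t)"
    unfolding R_eq_def by (blast intro: R_le_trans R_le_om)
  then have t: "idt k s t" by (simp add: idt_def R_eq_def)
  moreover have "idt k (rh_mult s t) r"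
    using R t R_eq_trans R_eq_sym idt_rh_mult(1)[OF assms(1,2,4) t] unfolding idt_def by metis
  ultimately show "idt k s t \<and> idt k (rh_mult s t) r" by blast
next
  assume h: "idt k s t \<and> idt k (rh_mult s t) r"
  then show "idt k s (rh_mult t r)"
    using idt_rh_mult(1)[OF assms(1,2,4)] R_eq_trans
    unfolding idt_def hd_rh_mult[OF assms(2,3)] om_assoc[symmetric] by metis
qed

text \<open>A translation that keeps \<open>elt k s\<close> in its R-class reflects L-equivalence
  below it, so the same generators lead into the translated next class.\<close>

lemma Ys_idt:
  assumes "s \<in> chains" "t \<in> chains" "t \<noteq> [None]" "idt k s t"
  shows "Ys (elt k (rh_mult s t)) (nx (Suc k) (rh_mult s t)) = Ys (elt k s) (nx (Suc k) s)"
proof -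
  have R: "R_eq (elt k s \<bullet> hd t) (elt k s)" using assms(4) by (simp add: idt_def)
  have "Some (gen y) \<bullet> (elt k s \<bullet> hd t) \<in> mulc (nx (Suc k) s) (hd t)
      \<longleftrightarrow> Some (gen y) \<bullet> elt k s \<in> nx (Suc k) s" (is "?a \<in> _ \<longleftrightarrow> ?b \<in> _") for y
  proof -
    have "?a \<in> mulc (nx (Suc k) s) (hd t) \<longleftrightarrow> (\<exists>z\<in>nx (Suc k) s. L_eq (?b \<bullet> hd t) (z \<bullet> hd t))"
      by (simp add: mulc_def om_assoc)
    also have "\<dots> \<longleftrightarrow> (\<exists>z\<in>nx (Suc k) s. L_eq ?b z)"
      using L_eq_cancel_below[OF R L_le_om nx_le[OF assms(1)]] by blast
    also have "\<dots> \<longleftrightarrow> ?b \<in> nx (Suc k) s"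
      using nx_L_closed L_eq_refl by blast
    finally show ?thesis .
  qed
  then show ?thesis by (simp add: Ys_def idt_rh_mult(1,2)[OF assms])
qed

section \<open>Level sets and realized coordinates\<close>

text \<open>The possible values of \<open>Ys h (nx (Suc k) s)\<close>.\<close>

definition Ach :: "'m option \<Rightarrow> 'y set set" where
  "Ach h = insert {} {{y. L_eq (Some (gen y) \<bullet> h) (Some (gen y0) \<bullet> h)} | y0. \<not> L_eq (Some (gen y0) \<bullet> h) h}"

text \<open>The component h is confined to the H-class of the representative of its R-class, the
  target of \<open>coord\<close>. Adding \<open>{}\<close> at every level also makes all level sets
  nonempty.\<close>

definition X :: "nat \<Rightarrow> ('m, 'y) xelem set" where
  "X i = (let k = (i - 1) div 2 in insert {}
     (if odd i then {encR (Rcls x) | x. ht x = k}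
      else {enc h A | h A. ht h = k \<and> h \<in> Hcls (rep (Rcls h)) \<and> A \<in> Ach h}))"

lemma X_odd: "X (Suc (2 * k)) = insert {} {encR (Rcls x) | x. ht x = k}"
  and X_even: "X (Suc (Suc (2 * k))) =
    insert {} {enc h A | h A. ht h = k \<and> h \<in> Hcls (rep (Rcls h)) \<and> A \<in> Ach h}"
  by (simp_all add: X_def)

text \<open>The same cancellation as in \<open>Ys_idt\<close>; it is needed because the stored h is
  only R-equivalent to the element whose continuations are recorded.\<close>

lemma Ach_R_eq:
  assumes "R_eq h h'"
  shows "Ach h = Ach h'"
proof -
  obtain n where n: "h' = h \<bullet> n" using assms by (auto simp: R_eq_def R_le_def)
  have R: "R_eq (h \<bullet> n) h" using assms n R_eq_sym by blast
  have "L_eq (Some (gen y) \<bullet> h') (Some (gen y0) \<bullet> h') \<longleftrightarrow> L_eq (Some (gen y) \<bullet> h) (Some (gen y0) \<bullet> h)"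
    "L_eq (Some (gen y) \<bullet> h') h' \<longleftrightarrow> L_eq (Some (gen y) \<bullet> h) h" for y y0
    unfolding n om_assoc[symmetric] by (rule L_eq_cancel_below[OF R]; simp)+
  then show ?thesis by (simp add: Ach_def)
qed

lemma coord_in:
  assumes "s \<in> chains" "ht (elt k s) = k"
  shows "coord (par k s) (elt k s) \<in> Hcls (rep (Rcls (elt k s)))"
  using coord_translation[OF elt_le_par[OF assms]] by (metis Hcls_iff L_eq_refl R_eq_refl)

lemma Hcls_rep_Rcls: "h \<in> Hcls (rep (Rcls x)) \<Longrightarrow> Rcls h = Rcls x"
  using R_eq_trans[OF _ rep_R_eq] by (auto simp: Rcls_eq_iff)

lemma Ys_Ach:
  assumes "s \<in> chains"
  shows "Ys (elt k s) (nx (Suc k) s) \<in> Ach (elt k s)"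
proof (cases "nx (Suc k) s = {}")
  case False
  then obtain y0 where "nx (Suc k) s = Lcls (Some (gen y0) \<bullet> elt k s)"
    "\<not> L_eq (Some (gen y0) \<bullet> elt k s) (elt k s)" using nx_step[OF assms] by blast
  then show ?thesis by (auto simp: Ys_def Ach_def)
qed (simp add: Ys_def Ach_def)

lemma code_in_X:
  assumes "s \<in> chains"
  shows "code (Suc i) s \<in> X (Suc i)"
proof (cases "even i")
  case True
  then obtain k where "i = 2 * k" by blast
  then show ?thesis by (auto simp: code_odd X_odd)
next
  case False
  then obtain k where i: "i = Suc (2 * k)" by (metis oddE Suc_eq_plus1)
  show ?thesis
  proof (cases "ht (elt k s) = k")
    case True
    let ?h = "coord (par k s) (elt k s)"
    have h: "?h \<in> Hcls (rep (Rcls (elt k s)))" using coord_in[OF assms True] .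
    note R = Hcls_rep_Rcls[OF h]
    have "ht ?h = k" "Ach ?h = Ach (elt k s)"
      using R True by (simp_all add: Rcls_eq_iff ht_R_eq Ach_R_eq)
    then show ?thesis unfolding i X_even code_even using True h R Ys_Ach[OF assms] by auto
  qed (simp add: i X_even code_even)
qed

text \<open>A step depends on its lower term only through the L-class. So the chain can be cut off
  at height k and its new bottom term exchanged, which realizes prescribed coordinates.\<close>

lemma elt_Cons_chain:
  assumes "s \<in> chains" "ht (elt k s) = k" "L_eq x (elt k s)"
  shows "x # up k s \<in> chains" "up k (x # up k s) = up k s" "elt k (x # up k s) = x"
    "nx k (x # up k s) = nx k s" "nx (Suc k) (x # up k s) = {}"
    "codes code (2 * k) (x # up k s) = codes code (2 * k) s"
proof -
  note u = up_Suc(1)[OF assms(1,2)]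
  have hx: "ht x = k" using assms(2,3) ht_L_eq by metis
  have s: "s = takeWhile (\<lambda>x. Suc k \<le> ht x) s @ elt k s # up k s"
    using u unfolding up_def by (metis takeWhile_dropWhile_id)
  have "successively gstep (elt k s # up k s)"
    using assms(1) unfolding chains_def by (subst (asm) s) (simp add: successively_append_iff)
  then have g: "successively gstep (x # up k s)"
    using assms(3) unfolding successively_Cons gstep_def
    by (metis L_eq_sym L_eq_trans)
  have l: "last (elt k s # up k s) = None" using last_chain[OF assms(1)] by (subst (asm) s) simp
  then have l': "last (x # up k s) = None" using assms(3) by (cases "up k s") auto
  show c: "x # up k s \<in> chains" using g l' by (simp add: chains_def)
  have lt: "\<forall>y\<in>set (up k s). ht y < k"
    using up_sorted(2)[OF assms(1), of "Suc k"] u assms(2) by simp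
  then have e: "dropWhile (\<lambda>x. k \<le> ht x) (up k s) = up k s" "takeWhile (\<lambda>x. k \<le> ht x) (up k s) = []"
    by (cases "up k s"; simp)+
  then show "up k (x # up k s) = up k s" using hx by (simp add: up_def[of k "x # _"])
  show "elt k (x # up k s) = x" using hx by (simp add: elt_def up_def)
  show "nx k (x # up k s) = nx k s"
    using hx e u assms(3) by (simp add: nx_def[of k "x # _"] Lcls_eq_iff)
  show "nx (Suc k) (x # up k s) = {}" using hx by (simp add: nx_def)
  show "codes code (2 * k) (x # up k s) = codes code (2 * k) s"
    unfolding codes_even_iff[OF c assms(1)]
    using \<open>up k (x # up k s) = up k s\<close> \<open>nx k (x # up k s) = nx k s\<close> by blast
qed

definition valid :: "nat \<Rightarrow> 'm option list \<Rightarrow> ('m, 'y) xelem set" where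
  "valid i s = {code (Suc i) s' | s'. s' \<in> chains \<and> codes code i s' = codes code i s}"

lemma valid_dummy:
  assumes "s \<in> chains" "ht (elt (i div 2) s) \<noteq> i div 2"
  shows "valid i s = {{}}"
proof -
  let ?k = "i div 2"
  have "code (Suc i) s' = {}" if "s' \<in> chains" "codes code i s' = codes code i s" for s'
  proof -
    have "ht (elt ?k s') \<noteq> ?k"
      using elt_cong(2)[of s' s ?k] idt_level[OF that(1) assms(1) that(2)] that(1) assms by simp
    then show ?thesis by (simp add: code_def)
  qed
  then show ?thesis using assms(1) unfolding valid_def by blast
qed

lemma valid_even:
  assumes "s \<in> chains" "ht (elt k s) = k"
  shows "valid (2 * k) s = {encR (Rcls x) | x. L_eq x (elt k s)}"
proof (intro equalityI subsetI)
  fix z assume "z \<in> valid (2 * k) s"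
  then obtain s' where s': "s' \<in> chains" "z = code (Suc (2 * k)) s'" "codes code (2 * k) s' = codes code (2 * k) s"
    by (auto simp: valid_def)
  then have "up k s' = up k s" "nx k s' = nx k s" using codes_even_iff[OF s'(1) assms(1)] by auto
  note elt_cong[OF s'(1) assms(1) this]
  then show "z \<in> {encR (Rcls x) | x. L_eq x (elt k s)}" using assms(2) s'(2) by (auto simp: code_odd)
next
  fix z :: "('m, 'y) xelem" assume "z \<in> {encR (Rcls x) | x. L_eq x (elt k s)}"
  then obtain x where x: "z = encR (Rcls x)" "L_eq x (elt k s)" by blast
  note c = elt_Cons_chain[OF assms x(2)]
  have "z = code (Suc (2 * k)) (x # up k s)" 
    using x assms(2) c(3) ht_L_eq[OF x(2)] by (simp add: code_odd)
  then show "z \<in> valid (2 * k) s" using c(1,6) unfolding valid_def by blast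
qed

text \<open>Only the R-class of \<open>elt k s\<close> enters the right side, which yields the
  invariance in \<open>valid_idt\<close>. All pairs are realized: w inverts \<open>coord\<close>,
  and a generator prolongs the chain into the class recorded by A.\<close>

lemma valid_odd:
  assumes "s \<in> chains" "ht (elt k s) = k"
  shows "valid (Suc (2 * k)) s
    = {enc h A | h A. R_eq h (elt k s) \<and> h \<in> Hcls (rep (Rcls h)) \<and> A \<in> Ach h}" (is "_ = ?V")
proof (intro equalityI subsetI)
  fix z assume "z \<in> valid (Suc (2 * k)) s"
  then obtain s' where s': "s' \<in> chains" "z = code (Suc (Suc (2 * k))) s'"
    "codes code (Suc (2 * k)) s' = codes code (Suc (2 * k)) s" by (auto simp: valid_def)
  then have st: "up k s' = up k s" "nx k s' = nx k s" "ht (elt k s') = k \<longrightarrow> R_eq (elt k s') (elt k s)"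
    using codes_odd_iff[OF s'(1) assms(1)] by auto
  have h': "ht (elt k s') = k" using elt_cong(2)[OF s'(1) assms(1) st(1,2)] assms(2) by simp
  let ?h = "coord (par k s') (elt k s')"
  have h: "?h \<in> Hcls (rep (Rcls (elt k s')))" using coord_in[OF s'(1) h'] .
  note R = Hcls_rep_Rcls[OF h]
  then have "R_eq ?h (elt k s')" by (simp add: Rcls_eq_iff)
  moreover from this have "R_eq ?h (elt k s)" using st(3) h' R_eq_trans by blast
  ultimately show "z \<in> ?V"
    using s'(2) h' h R Ys_Ach[OF s'(1), of k] by (auto simp: code_even Ach_R_eq)
next
  fix z assume "z \<in> ?V"
  then obtain h A where z: "z = enc h A" "R_eq h (elt k s)" "h \<in> Hcls (rep (Rcls h))" "A \<in> Ach h" by blast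
  have Rh: "Rcls h = Rcls (elt k s)" using z(2) by (simp add: Rcls_eq_iff)
  obtain f w where fw:
    "\<forall>x'\<in>Hcls (elt k s). coord (par k s) x' = x' \<bullet> f \<and> (x' \<bullet> f) \<bullet> w = x' \<and> x' \<bullet> f \<in> Hcls (rep (Rcls (elt k s)))"
    "\<forall>h\<in>Hcls (rep (Rcls (elt k s))). h \<bullet> w \<in> Hcls (elt k s) \<and> (h \<bullet> w) \<bullet> f = h"
    using coord_translation[OF elt_le_par[OF assms]] by (elim exE conjE) (rule that)
  let ?x = "h \<bullet> w"
  have x: "?x \<in> Hcls (elt k s)" "coord (par k s) ?x = h" using fw z(3) Rh by metis+
  then have xL: "L_eq ?x (elt k s)" and xR: "R_eq ?x (elt k s)" by auto
  note c = elt_Cons_chain[OF assms xL]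
  let ?s = "?x # up k s"
  have hx: "ht ?x = k" using ht_L_eq[OF xL] assms(2) by simp
  have par: "par k s' = par k s" if "up k s' = up k s" for s' using that by (simp add: par_def)
  have codes: "codes code (Suc (2 * k)) s' = codes code (Suc (2 * k)) s"
    if "s' \<in> chains" "up k s' = up k s" "nx k s' = nx k s" "elt k s' = ?x" for s'
    unfolding codes_odd_iff[OF that(1) assms(1)] using that(2-4) xR by simp
  have A: "A \<in> Ach ?x" using z(4) Ach_R_eq[of h ?x] z(2) xR R_eq_trans R_eq_sym by metis
  show "z \<in> valid (Suc (2 * k)) s"
  proof (cases "A = {}")
    case True
    have "z = code (Suc (Suc (2 * k))) ?s"
      using c(3,5) hx x(2) True z(1) par[OF c(2)] by (simp add: code_even Ys_def)
    then show ?thesis using c codes unfolding valid_def by blast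
  next
    case False
    then obtain y0 where y0: "A = {y. L_eq (Some (gen y) \<bullet> ?x) (Some (gen y0) \<bullet> ?x)}"
      "\<not> L_eq (Some (gen y0) \<bullet> ?x) ?x" using A by (auto simp: Ach_def)
    let ?z = "Some (gen y0) \<bullet> ?x" and ?s' = "(Some (gen y0) \<bullet> ?x) # ?x # up k s"
    have "gstep ?z ?x" unfolding gstep_def using y0(2) by (blast intro: L_eq_refl)
    then have ch: "?s' \<in> chains" using c(1) by (simp add: chains_def)
    have hz: "k < ht ?z" using gstep_ht[OF \<open>gstep ?z ?x\<close>] hx by simp
    have e: "up k ?s' = up k s" "elt k ?s' = ?x"
      using c(2,3) hz by (simp_all add: up_def elt_def)
    have n: "nx (Suc k) ?s' = Lcls ?z" using hz hx by (simp add: nx_def)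
    have "nx k ?s' = nx k ?s"
      using hz hx by (simp add: nx_def)
    then have n': "nx k ?s' = nx k s" using c(4) by simp
    have "z = code (Suc (Suc (2 * k))) ?s'"
      unfolding code_even e(2) n par[OF e(1)] using hx x(2) z(1) y0(1) by (simp add: Ys_def)
    then show ?thesis using ch codes[OF ch e(1) n' e(2)] unfolding valid_def by blast
  qed
qed

lemma valid_idt:
  assumes "s \<in> chains" "t \<in> chains" "t \<noteq> [None]" "idt (i div 2) s t"
  shows "valid i (rh_mult s t) = valid i s"
proof -
  let ?k = "i div 2"
  have st: "rh_mult s t \<in> chains" using rh_mult_chains assms by blast
  note e = idt_rh_mult[OF assms]
  have h: "ht (elt ?k (rh_mult s t)) = ht (elt ?k s)" using ht_R_eq[OF e(3)] .
  show ?thesis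
  proof (cases "ht (elt ?k s) = ?k")
    case False
    then show ?thesis using valid_dummy[OF assms(1)] valid_dummy[OF st] h by simp
  next
    case True
    then have True': "ht (elt ?k (rh_mult s t)) = ?k" using h by simp
    show ?thesis
    proof (cases "even i")
      case ev: True
      let ?q = "elt ?k s" and ?n = "hd t"
      have R: "R_eq (?q \<bullet> ?n) ?q" using assms(4) by (simp add: idt_def)
      obtain v where v: "\<And>a. L_le a ?q \<Longrightarrow> (a \<bullet> ?n) \<bullet> v = a" using right_inverse[OF R] by blast
      have R': "R_eq ((?q \<bullet> ?n) \<bullet> v) (?q \<bullet> ?n)" using v[of ?q] R R_eq_sym by simp
      \<comment> \<open>Green's lemma: translation by \<open>?n\<close>, with inverse v, matches the
        two L-classes and preserves R-classes, so both meet the same R-classes.\<close>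
      have "{encR (Rcls x) | x. L_eq x (?q \<bullet> ?n)} = {encR (Rcls x) | x. L_eq x ?q}" (is "?A = ?B")
      proof
        show "?A \<subseteq> ?B"
        proof clarify
          fix x assume x: "L_eq x (?q \<bullet> ?n)"
          then have "L_eq (x \<bullet> v) ?q" using L_eq_cong[OF x, of v] v[of ?q] by simp
          moreover have "R_eq (x \<bullet> v) x" using R_eq_below[OF R'] x by (simp add: L_eq_def)
          ultimately show "\<exists>x'. encR (Rcls x) = encR (Rcls x') \<and> L_eq x' ?q"
            using Rcls_eq_iff by metis
        qed
        show "?B \<subseteq> ?A"
        proof clarify
          fix x assume x: "L_eq x ?q"
          then have "R_eq (x \<bullet> ?n) x" using R_eq_below[OF R] by (simp add: L_eq_def)
          then show "\<exists>x'. encR (Rcls x) = encR (Rcls x') \<and> L_eq x' (?q \<bullet> ?n)"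
            using Rcls_eq_iff L_eq_cong[OF x] by metis
        qed
      qed
      then show ?thesis using valid_even[OF assms(1) True] valid_even[OF st True'] e(1) ev by simp
    next
      case False
      then have i: "i = Suc (2 * ?k)" by simp
      have "R_eq h (elt ?k (rh_mult s t)) \<longleftrightarrow> R_eq h (elt ?k s)" for h
        using e(3) R_eq_trans R_eq_sym by blast
      then show ?thesis using valid_odd[OF assms(1) True] valid_odd[OF st True'] i by simp
    qed
  qed
qed

text \<open>Prefixes of length 2k and 2k + 1 lead to the two coordinates of level k, hence the index
  \<open>i div 2\<close>.\<close>

sublocale wreath_coding chains rh_mult "[None]" code X \<delta> "\<lambda>i. idt (i div 2)" valid for \<delta>
proof unfold_locales
  show "valid \<equiv> \<lambda>i s. {code (Suc i) s' |s'. s' \<in> chains \<and> codes code i s' = codes code i s}"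
    by (simp add: valid_def fun_eq_iff atomize_eq)
  show "idt (i div 2) s t = idt (i div 2) s' t"
    if "s \<in> chains" "s' \<in> chains" "codes code i s = codes code i s'" for s s' i t
    using idt_cong[OF that(1,2)] idt_level[OF that] by blast
qed (fact one_chain rh_mult_chains rh_mult_assoc rh_mult_one_left rh_mult_one_right rh_mult_eq_one(1)
    code_in_X code_congr idt_mult valid_idt[unfolded valid_def] not_idt_code)+

lemma idt_below:
  assumes "s \<in> chains" "t \<in> chains" "t \<noteq> [None]" "idt k s t" "k \<le> k'"
  shows "idt k' s t"
  using R_eq_below[OF _ elt_antimono[OF assms(1,5)]] assms(4) by (simp add: idt_def)

text \<open>The core of the Zeiger property: \<open>elt k s\<close> is the predecessor relative to
  which the coordinate of height \<open>Suc k\<close> is measured, so \<open>coord_fixed\<close>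
  applies. At height k itself the predecessor may drop although the element does not.\<close>

lemma code_even_below:
  assumes "s \<in> chains" "t \<in> chains" "t \<noteq> [None]" "idt k s t"
  shows "code (Suc (Suc (2 * Suc k))) (rh_mult s t) = code (Suc (Suc (2 * Suc k))) s"
proof -
  have st: "rh_mult s t \<in> chains" using rh_mult_chains assms by blast
  have i: "idt (Suc k) s t" using idt_below[OF assms] by simp
  note e = idt_rh_mult[OF assms(1-3) i]
  have p: "par (Suc k) s = elt k s" if "s \<in> chains" for s
    using up_Suc_not_Nil[OF that] by (simp add: par_def elt_def)
  have "coord (elt k s \<bullet> hd t) (elt (Suc k) s \<bullet> hd t) = coord (elt k s) (elt (Suc k) s)"
    using coord_fixed elt_antimono[OF assms(1), of k "Suc k"] assms(4) by (simp add: idt_def)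
  then show ?thesis
    unfolding code_even p[OF assms(1)] p[OF st] Ys_idt[OF assms(1-3) i]
    using ht_R_eq[OF e(3)] by (simp add: e(1) idt_rh_mult(1)[OF assms])
qed

lemma code_even_translation:
  assumes "s \<in> chains" "t \<in> chains" "t \<noteq> [None]" "idt k s t" "ht (elt k s) = k"
  obtains g where "\<And>h. h \<in> Hcls (rep (Rcls (elt k s))) \<Longrightarrow> h \<bullet> g \<in> Hcls (rep (Rcls (elt k s)))"
    and "\<And>s'. \<lbrakk>s' \<in> chains; codes code (Suc (2 * k)) s' = codes code (Suc (2 * k)) s\<rbrakk> \<Longrightarrow>
      \<exists>h A. code (Suc (Suc (2 * k))) s' = enc h A \<and> code (Suc (Suc (2 * k))) (rh_mult s' t) = enc (h \<bullet> g) A"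
proof -
  let ?q = "elt k s" and ?n = "hd t"
  have st: "rh_mult s t \<in> chains" using rh_mult_chains assms by blast
  note e = idt_rh_mult[OF assms(1-4)]
  have h': "ht (elt k (rh_mult s t)) = k" using ht_R_eq[OF e(3)] assms(5) by simp
  have Req: "R_eq (?q \<bullet> ?n) ?q" using assms(4) by (simp add: idt_def)
  then have R: "Rcls (?q \<bullet> ?n) = Rcls ?q" by (simp add: Rcls_eq_iff)
  obtain f1 w1 where 1:
    "\<forall>x'\<in>Hcls ?q. coord (par k s) x' = x' \<bullet> f1 \<and> (x' \<bullet> f1) \<bullet> w1 = x' \<and> x' \<bullet> f1 \<in> Hcls (rep (Rcls ?q))"
    "\<forall>h\<in>Hcls (rep (Rcls ?q)). h \<bullet> w1 \<in> Hcls ?q \<and> (h \<bullet> w1) \<bullet> f1 = h"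
    using coord_translation[OF elt_le_par[OF assms(1,5)]] by (elim exE conjE) (rule that)
  obtain f2 w2 where 2: "\<forall>x'\<in>Hcls (?q \<bullet> ?n).
      coord (par k (rh_mult s t)) x' = x' \<bullet> f2 \<and> (x' \<bullet> f2) \<bullet> w2 = x' \<and> x' \<bullet> f2 \<in> Hcls (rep (Rcls ?q))"
    using coord_translation[OF elt_le_par[OF st h']] unfolding e(1) R
    by (elim exE conjE) (rule that)
  have H: "x' \<bullet> ?n \<in> Hcls (?q \<bullet> ?n)" if "x' \<in> Hcls ?q" for x'
  proof -
    have x: "L_eq x' ?q" "R_eq x' ?q" using that by auto
    then have "R_eq (x' \<bullet> ?n) x'" using R_eq_below[OF Req] by (simp add: L_eq_def)
    then have "R_eq (x' \<bullet> ?n) (?q \<bullet> ?n)" using x(2) Req R_eq_trans R_eq_sym by metis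
    then show ?thesis using L_eq_cong[OF x(1)] by simp
  qed
  show ?thesis
  \<comment> \<open>w1 turns a coordinate back into the element, \<open>?n\<close> multiplies it,
    and f2 takes the coordinate of the result.\<close>
  proof (rule that[of "(w1 \<bullet> ?n) \<bullet> f2"])
    fix h assume "h \<in> Hcls (rep (Rcls ?q))"
    then show "h \<bullet> ((w1 \<bullet> ?n) \<bullet> f2) \<in> Hcls (rep (Rcls ?q))"
      using 1(2) 2 H unfolding om_assoc[symmetric] by blast
  next
    fix s' assume s': "s' \<in> chains" "codes code (Suc (2 * k)) s' = codes code (Suc (2 * k)) s"
    then have u: "up k s' = up k s" "nx k s' = nx k s" "ht (elt k s') = k \<longrightarrow> R_eq (elt k s') ?q"
      using codes_odd_iff[OF s'(1) assms(1)] by auto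
    note c = elt_cong[OF s'(1) assms(1) u(1,2)]
    have hk: "ht (elt k s') = k" using c(2) assms(5) by simp
    then have x: "elt k s' \<in> Hcls ?q" using u(3) c(1) by simp
    have id': "idt k s' t" using idt_cong[OF s'(1) assms(1) u(1,2)] assms(4) by simp
    note e' = idt_rh_mult[OF s'(1) assms(2,3) id']
    have p: "par k s' = par k s" "par k (rh_mult s' t) = par k (rh_mult s t)"
      using st_cong[OF s'(1) assms(1,2) u(1,2)] u(1) by (simp_all add: par_def)
    let ?h = "coord (par k s') (elt k s')"
    have "coord (par k (rh_mult s' t)) (elt k s' \<bullet> ?n) = ?h \<bullet> ((w1 \<bullet> ?n) \<bullet> f2)"
      using bspec[OF 1(1) x] bspec[OF 2 H[OF x]] unfolding p by (simp add: om_assoc[symmetric])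
    then show "\<exists>h A. code (Suc (Suc (2 * k))) s' = enc h A
        \<and> code (Suc (Suc (2 * k))) (rh_mult s' t) = enc (h \<bullet> ((w1 \<bullet> ?n) \<bullet> f2)) A"
      unfolding code_even Ys_idt[OF s'(1) assms(2,3) id'] using hk ht_R_eq[OF e'(3)] e'(1) by simp
  qed
qed

end

section \<open>Schuetzenberger groups and local maps\<close>

lemma schutz_carrier: "f \<in> carrier (schutz m) \<longleftrightarrow>
    (\<exists>s. f = restrict (\<lambda>h. h \<bullet> s) (Hcls m) \<and> (\<forall>h\<in>Hcls m. h \<bullet> s \<in> Hcls m))"
  unfolding schutz_def by auto

lemma schutz_carrierE:
  assumes "f \<in> carrier (schutz m)"
  obtains s where "f = restrict (\<lambda>h. h \<bullet> s) (Hcls m)" "\<forall>h\<in>Hcls m. h \<bullet> s \<in> Hcls m"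
  using assms by (auto simp only: schutz_carrier)

lemma schutz_apply: "f \<in> carrier (schutz m) \<Longrightarrow> h \<in> Hcls m \<Longrightarrow> f h \<in> Hcls m"
  by (elim schutz_carrierE) simp

lemma schutz_ext: "f \<in> carrier (schutz m) \<Longrightarrow> f \<in> extensional (Hcls m)"
  by (elim schutz_carrierE) simp

lemma schutz_mult: "x \<otimes>\<^bsub>schutz m\<^esub> y = restrict (y \<circ> x) (Hcls m)"
  and schutz_one: "\<one>\<^bsub>schutz m\<^esub> = restrict id (Hcls m)"
  by (simp_all add: schutz_def)

lemma Hcls_self: "m \<in> Hcls m"
  by simp

lemma group_schutz: "group (schutz m)"
proof (rule groupI)
  fix x y assume "x \<in> carrier (schutz m)" "y \<in> carrier (schutz m)"
  then obtain s t where s: "x = restrict (\<lambda>h. h \<bullet> s) (Hcls m)" "\<forall>h\<in>Hcls m. h \<bullet> s \<in> Hcls m"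
    and t: "y = restrict (\<lambda>h. h \<bullet> t) (Hcls m)" "\<forall>h\<in>Hcls m. h \<bullet> t \<in> Hcls m"
    by (elim schutz_carrierE)
  have "restrict (y \<circ> x) (Hcls m) = restrict (\<lambda>h. h \<bullet> (s \<bullet> t)) (Hcls m)"
    using s t by (auto simp: restrict_def om_assoc simp del: Hcls_iff)
  moreover have "\<forall>h\<in>Hcls m. h \<bullet> (s \<bullet> t) \<in> Hcls m"
    using s(2) t(2) by (simp add: om_assoc[symmetric] del: Hcls_iff)
  ultimately show "x \<otimes>\<^bsub>schutz m\<^esub> y \<in> carrier (schutz m)"
    unfolding schutz_mult schutz_carrier by blast
next
  have "restrict id (Hcls m) = restrict (\<lambda>h. h \<bullet> None) (Hcls m)" by (auto simp: restrict_def)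
  then show "\<one>\<^bsub>schutz m\<^esub> \<in> carrier (schutz m)"
    unfolding schutz_one schutz_carrier by (intro exI[of _ None]) simp
next
  fix x y z assume "x \<in> carrier (schutz m)"
  then show "x \<otimes>\<^bsub>schutz m\<^esub> y \<otimes>\<^bsub>schutz m\<^esub> z = x \<otimes>\<^bsub>schutz m\<^esub> (y \<otimes>\<^bsub>schutz m\<^esub> z)"
    using schutz_apply unfolding schutz_mult by (fastforce simp: restrict_def simp del: Hcls_iff)
next
  fix x assume x: "x \<in> carrier (schutz m)"
  show "\<one>\<^bsub>schutz m\<^esub> \<otimes>\<^bsub>schutz m\<^esub> x = x"
    unfolding schutz_mult schutz_one
    using schutz_ext[OF x] by (auto simp: restrict_def extensional_def simp del: Hcls_iff)
  obtain s where s: "x = restrict (\<lambda>h. h \<bullet> s) (Hcls m)" "\<forall>h\<in>Hcls m. h \<bullet> s \<in> Hcls m"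
    using schutz_carrierE[OF x] .
  have ms: "L_eq (m \<bullet> s) m" "R_eq (m \<bullet> s) m" using bspec[OF s(2) Hcls_self] by simp_all
  obtain v where v: "\<And>a. L_le a m \<Longrightarrow> (a \<bullet> s) \<bullet> v = a" using right_inverse[OF ms(2)] by blast
  \<comment> \<open>Each h is a left multiple of \<open>m \<bullet> s\<close>, so the inverse found
    at m works on the whole H-class.\<close>
  have hv: "h \<bullet> v \<in> Hcls m \<and> (h \<bullet> v) \<bullet> s = h" if "h \<in> Hcls m" for h
  proof -
    have h: "L_eq h m" "R_eq h m" using that by auto
    then have hms: "L_eq h (m \<bullet> s)" using ms(1) L_eq_trans L_eq_sym by blast
    then obtain u where u: "h = u \<bullet> (m \<bullet> s)" unfolding L_eq_def L_le_def by blast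
    have "h \<bullet> v = u \<bullet> m" using u v[OF L_le_refl] by (simp add: om_assoc)
    then have 1: "(h \<bullet> v) \<bullet> s = h" using u by (simp add: om_assoc)
    have "L_eq (h \<bullet> v) m" using L_eq_cong[OF hms, of v] v[OF L_le_refl] by simp
    moreover have "R_eq (h \<bullet> v) h" using 1 unfolding R_eq_def by (metis R_le_om)
    ultimately show ?thesis using 1 h(2) R_eq_trans by simp blast
  qed
  let ?y = "restrict (\<lambda>h. h \<bullet> v) (Hcls m)"
  have "?y \<in> carrier (schutz m)" unfolding schutz_carrier using hv by blast
  moreover have "?y \<otimes>\<^bsub>schutz m\<^esub> x = \<one>\<^bsub>schutz m\<^esub>"
    unfolding schutz_mult schutz_one s(1) using hv by (auto simp: restrict_def simp del: Hcls_iff)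
  ultimately show "\<exists>y\<in>carrier (schutz m). y \<otimes>\<^bsub>schutz m\<^esub> x = \<one>\<^bsub>schutz m\<^esub>" by blast
qed

lemma schutzR_rep: "schutzR R = schutz (rep R)"
  by (simp add: schutzR_def rep_def)

text \<open>Translations a and b carry the H-classes of r and m to each other, so s is conjugate to
  \<open>(b \<bullet> s) \<bullet> a\<close>, which acts trivially on the H-class of m.\<close>

lemma schutz_trivial_R_eq:
  assumes "R_eq m r" and triv: "carrier (schutz m) = {\<one>\<^bsub>schutz m\<^esub>}"
    and s: "\<forall>h\<in>Hcls r. h \<bullet> s \<in> Hcls r" and h: "h \<in> Hcls r"
  shows "h \<bullet> s = h"
proof -
  obtain a where a: "m = r \<bullet> a" using assms(1) by (auto simp: R_eq_def R_le_def)
  have ra: "R_eq (r \<bullet> a) r" using assms(1) a by simp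
  obtain b where b: "\<And>x. L_le x r \<Longrightarrow> (x \<bullet> a) \<bullet> b = x" using right_inverse[OF ra] by blast
  have mb: "R_eq (m \<bullet> b) m" "m \<bullet> b = r" using b[of r] a assms(1) R_eq_sym by auto
  have to_m: "x \<bullet> a \<in> Hcls m" if "x \<in> Hcls r" for x
  proof -
    have x: "L_eq x r" "R_eq x r" using that by auto
    have "R_eq (x \<bullet> a) x" using R_eq_below[OF ra] x(1) by (simp add: L_eq_def)
    then show ?thesis using L_eq_cong[OF x(1), of a] x(2) assms(1) a R_eq_trans R_eq_sym by (metis Hcls_iff)
  qed
  have to_r: "x \<bullet> b \<in> Hcls r" if "x \<in> Hcls m" for x
  proof -
    have x: "L_eq x m" "R_eq x m" using that by auto
    have "R_eq (x \<bullet> b) x" using R_eq_below[OF mb(1)] x(1) by (simp add: L_eq_def)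
    then show ?thesis using L_eq_cong[OF x(1), of b] x(2) assms(1) mb(2) R_eq_trans by (metis Hcls_iff)
  qed
  let ?s = "(b \<bullet> s) \<bullet> a"
  have "\<forall>x\<in>Hcls m. x \<bullet> ?s \<in> Hcls m"
    using to_m to_r s unfolding om_assoc[symmetric] by blast
  then have "restrict (\<lambda>h. h \<bullet> ?s) (Hcls m) \<in> carrier (schutz m)" unfolding schutz_carrier by blast
  then have eq: "restrict (\<lambda>h. h \<bullet> ?s) (Hcls m) = restrict id (Hcls m)" by (simp add: triv schutz_one)
  have ha: "h \<bullet> a \<in> Hcls m" using to_m h .
  have hb: "(h \<bullet> a) \<bullet> b = h" "((h \<bullet> s) \<bullet> a) \<bullet> b = h \<bullet> s" using b h bspec[OF s h] by (simp_all add: L_eq_def)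
  have "(h \<bullet> a) \<bullet> ?s = h \<bullet> a" using fun_cong[OF eq, of "h \<bullet> a"] ha by (simp del: Hcls_iff)
  then have "(h \<bullet> s) \<bullet> a = h \<bullet> a" using hb(1) by (simp add: om_assoc[symmetric])
  then show ?thesis using hb by metis
qed

section \<open>Constant maps and permutations\<close>

lemma constmaps_absorb:
  assumes "f \<in> pmaps Z" "g \<in> pmaps Z" "f \<in> constmaps Z \<or> g \<in> constmaps Z"
  shows "pcomp f g \<in> constmaps Z"
proof -
  have "pcomp f g \<in> pmaps Z"
    using assms(1,2) by (auto simp: pmaps_def pcomp_def bind_eq_Some_conv)
  moreover have "\<exists>c. \<forall>x y. pcomp f g x = Some y \<longrightarrow> y = c"
    using assms(3)
  proof
    assume "f \<in> constmaps Z"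
    then obtain c where "\<forall>x y. f x = Some y \<longrightarrow> y = c" by (auto simp: constmaps_def)
    then show ?thesis by (intro exI[of _ "the (g c)"]) (auto simp: pcomp_def bind_eq_Some_conv)
  next
    assume "g \<in> constmaps Z"
    then obtain c where "\<forall>x y. g x = Some y \<longrightarrow> y = c" by (auto simp: constmaps_def)
    then show ?thesis by (intro exI[of _ c]) (auto simp: pcomp_def bind_eq_Some_conv)
  qed
  ultimately show ?thesis by (simp add: constmaps_def)
qed

lemma idX_pmaps: "idX Z \<in> pmaps Z"
  by (auto simp: idX_def pmaps_def)

lemma pcomp_idX: "f \<in> pmaps Z \<Longrightarrow> pcomp (idX Z) f = f" "f \<in> pmaps Z \<Longrightarrow> pcomp f (idX Z) = f"
proof -
  assume f: "f \<in> pmaps Z"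
  show "pcomp (idX Z) f = f"
  proof
    fix x show "pcomp (idX Z) f x = f x"
      using f by (cases "f x") (auto simp: pcomp_def idX_def pmaps_def)
  qed
  show "pcomp f (idX Z) = f"
  proof
    fix x show "pcomp f (idX Z) x = f x"
      using f by (cases "f x") (auto simp: pcomp_def idX_def pmaps_def)
  qed
qed

text \<open>Such a map forces Z to have at most one element. Hence constant maps contribute nothing
  but the identity to the groups of the wreath product.\<close>

lemma perm_constmap:
  assumes "f \<in> perms Z" "f \<in> constmaps Z"
  shows "f = idX Z"
proof -
  obtain c where c: "\<forall>x y. f x = Some y \<longrightarrow> y = c" using assms(2) by (auto simp: constmaps_def)
  have f: "f \<in> pmaps Z" "\<forall>x\<in>Z. f x \<noteq> None" "inj_on (\<lambda>x. the (f x)) Z"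
    using assms(1) unfolding perms_def bij_betw_def by blast+
  have fx: "f x = Some c \<and> c \<in> Z" if "x \<in> Z" for x
  proof -
    have "f x \<noteq> None" using f(2) that by blast
    then obtain y where y: "f x = Some y" by (cases "f x") simp_all
    moreover have "y = c" using c y by blast
    moreover have "y \<in> Z" using f(1) y unfolding pmaps_def by blast
    ultimately show ?thesis by simp
  qed
  have "x = c" if "x \<in> Z" for x
  proof -
    have "f x = Some c" "c \<in> Z" using fx[OF that] by blast+
    moreover from this have "f c = Some c" using fx by blast
    ultimately show ?thesis using inj_onD[OF f(3), of x c] that by simp
  qed
  then have "f x = idX Z x" for x
  proof (cases "x \<in> Z")
    case True
    then have "f x = Some c" "x = c" using fx \<open>\<And>x. x \<in> Z \<Longrightarrow> x = c\<close> by blast+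
    then show ?thesis using True by (simp add: idX_def)
  next
    case False
    have "f x = None"
    proof (rule ccontr)
      assume "f x \<noteq> None"
      then obtain y where "f x = Some y" by (cases "f x") simp_all
      then show False using f(1) False unfolding pmaps_def by blast
    qed
    then show ?thesis using False by (simp add: idX_def)
  qed
  then show ?thesis by (rule ext)
qed

lemma perms_of_inverse:
  assumes "f \<in> pmaps Z" "g \<in> pmaps Z" "pcomp f g = idX Z" "pcomp g f = idX Z"
  shows "f \<in> perms Z"
proof -
  have one: "\<exists>y\<in>Z. f x = Some y \<and> g y = Some x"
    if "x \<in> Z" "pcomp f g = idX Z" "f \<in> pmaps Z" for x f g
  proof -
    have "pcomp f g x = Some x" using that by (simp add: idX_def)
    then show ?thesis using that(3) by (auto simp: pcomp_def bind_eq_Some_conv pmaps_def)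
  qed
  have 1: "\<exists>y\<in>Z. f x = Some y \<and> g y = Some x" if "x \<in> Z" for x
    using one that assms by blast
  have 2: "\<exists>y\<in>Z. g x = Some y \<and> f y = Some x" if "x \<in> Z" for x
    using one that assms by blast
  have "bij_betw (\<lambda>x. the (f x)) Z Z"
    by (rule bij_betw_byWitness[where f' = "\<lambda>x. the (g x)"]) (use 1 2 in force)+
  moreover have "\<forall>x\<in>Z. f x \<noteq> None" using 1 by force
  ultimately show ?thesis using assms(1) by (simp add: perms_def)
qed

definition hpart :: "('m, 'y) xelem \<Rightarrow> 'm option" where
  "hpart x = (THE h. (Inl h, 0) \<in> x)"

definition Apart :: "('m, 'y) xelem \<Rightarrow> 'y set" where
  "Apart x = {y. (Inr y, 0) \<in> x}"

lemma hpart_enc [simp]: "hpart (enc h A) = h" and Apart_enc [simp]: "Apart (enc h A) = A"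
  by (auto simp: hpart_def Apart_def enc_def)

section \<open>The component monoids\<close>

context finite_above
begin

lemma finite_Rcls: "finite (Rcls (m :: 'm option))"
  by (rule finite_subset[OF _ finite_above[of m]]) (auto simp: R_eq_def R_le_imp_J_le)

lemma finite_schutz: "finite (carrier (schutz (m :: 'm option)))"
proof -
  have "Hcls m \<subseteq> Rcls m" by auto
  then have fin: "finite (Hcls m)" using finite_Rcls finite_subset by blast
  have "carrier (schutz m) \<subseteq> Hcls m \<rightarrow>\<^sub>E Hcls m"
    using schutz_apply schutz_ext by (auto simp: PiE_def simp del: Hcls_iff)
  then show ?thesis using finite_PiE[of "Hcls m" "\<lambda>_. Hcls m"] fin finite_subset by blast
qed

lemma Lambda_height:
  assumes "R \<in> Lambda gen k"
  shows "\<exists>m. R = Rcls m \<and> ht m = k"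
proof -
  obtain m where m: "R = Rcls m" "R \<subseteq> U2 gen k \<union> U3 gen k \<union> U4 gen k"
    using assms unfolding Lambda_def by blast
  have "m \<in> R" using m(1) by simp
  then have "m \<in> U2 gen k \<union> U3 gen k \<union> U4 gen k" using m(2) by blast
  then have "hJ m = enat k" unfolding U2_def U3_def U4_def by blast
  then show ?thesis using m(1) by (auto simp: hJ_ht)
qed

text \<open>Some m' of the R-class avoids all three sets. By \<open>U2\<close> if m' lies in W, and
  by \<open>U3\<close> otherwise, its group is trivial; this passes to the representative.\<close>

lemma schutz_not_Lambda:
  assumes "ht m = k" "Rcls m \<notin> Lambda gen k"
    and s: "\<forall>h\<in>Hcls (rep (Rcls m)). h \<bullet> s \<in> Hcls (rep (Rcls m))" and h: "h \<in> Hcls (rep (Rcls m))"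
  shows "h \<bullet> s = h"
proof -
  obtain m' where m': "m' \<in> Rcls m" "m' \<notin> U2 gen k \<union> U3 gen k \<union> U4 gen k"
  proof -
    have "\<not> Rcls m \<subseteq> U2 gen k \<union> U3 gen k \<union> U4 gen k"
      using assms(2) unfolding Lambda_def by blast
    then show ?thesis using that by blast
  qed
  have "ht m' = k" using m'(1) ht_R_eq assms(1) by simp
  then have hJ: "hJ m' = enat k" by (simp add: hJ_ht)
  let ?c = "ecard (carrier (schutz m'))"
  have mono: "?c \<le> ?c * (1 + qm gen m')" by (metis le_iff_add mult.right_neutral distrib_left)
  have "?c \<le> 1"
  proof (rule ccontr)
    assume "\<not> ?c \<le> 1"
    then have "1 < ?c" "1 < ?c * (1 + qm gen m')" using mono by (auto elim: less_le_trans)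
    then show False using m'(2) hJ unfolding U2_def U3_def by (cases "inW m'") auto
  qed
  then have "card (carrier (schutz m')) \<le> 1"
    using finite_schutz by (simp add: ecard_def one_enat_def)
  then have "carrier (schutz m') = {\<one>\<^bsub>schutz m'\<^esub>}"
    using monoid.one_closed[OF group.is_monoid[OF group_schutz]] finite_schutz
    by (metis card_le_Suc0_iff_eq One_nat_def is_singletonI' is_singleton_def singletonD empty_iff)
  moreover have "R_eq m' (rep (Rcls m))" using m'(1) rep_R_eq R_eq_trans R_eq_sym by (metis Rcls_iff)
  ultimately show ?thesis using schutz_trivial_R_eq s h by blast
qed

abbreviation SG :: "nat \<Rightarrow> ('m option set \<Rightarrow> 'm option \<Rightarrow> 'm option) monoid" where
  "SG k \<equiv> sum_group (Lambda gen k) schutzR"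

text \<open>A coordinate is moved by the component of its own R-class, and only in its part h.
  Recorded generators and R-classes outside \<open>Lambda\<close> stay fixed, as the local maps
  require.\<close>

definition act :: "nat \<Rightarrow> ('m option set \<Rightarrow> 'm option \<Rightarrow> 'm option)
    \<Rightarrow> ('m, 'y) xelem \<Rightarrow> ('m, 'y) xelem option" where
  "act k g x = (if x \<notin> X (Suc (Suc (2 * k))) then None
     else if x = {} \<or> Rcls (hpart x) \<notin> Lambda gen k then Some x
     else Some (enc (g (Rcls (hpart x)) (hpart x)) (Apart x)))"

lemma group_schutzR: "group (schutzR R)"
  by (simp add: schutzR_rep group_schutz)

lemma group_SG: "group (SG k)"
  by (simp add: group_schutzR)

lemma SG_carrier: "g \<in> carrier (SG k) \<longleftrightarrow>
    g \<in> (\<Pi>\<^sub>E R\<in>Lambda gen k. carrier (schutz (rep R))) \<and> finite {R \<in> Lambda gen k. g R \<noteq> \<one>\<^bsub>schutz (rep R)\<^esub>}"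
  by (simp add: carrier_sum_group group_schutzR group_schutz schutzR_rep)

lemma enc_X_even: "enc h A \<in> X (Suc (Suc (2 * k)))
    \<longleftrightarrow> ht h = k \<and> h \<in> Hcls (rep (Rcls h)) \<and> A \<in> Ach h"
  by (auto simp: X_even simp del: Hcls_iff)

lemma X_even_cases:
  assumes "x \<in> X (Suc (Suc (2 * k)))"
  obtains "x = {}" | h A where "x = enc h A" "ht h = k" "h \<in> Hcls (rep (Rcls h))" "A \<in> Ach h"
  using assms by (auto simp: X_even simp del: Hcls_iff)

lemma act_enc:
  assumes "g \<in> carrier (SG k)" "enc h A \<in> X (Suc (Suc (2 * k)))" "Rcls h \<in> Lambda gen k"
  shows "act k g (enc h A) = Some (enc (g (Rcls h) h) A)" "Rcls (g (Rcls h) h) = Rcls h"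
    "g (Rcls h) h \<in> Hcls (rep (Rcls h))" "enc (g (Rcls h) h) A \<in> X (Suc (Suc (2 * k)))"
proof -
  show "act k g (enc h A) = Some (enc (g (Rcls h) h) A)" using assms by (simp add: act_def)
  have h: "ht h = k" "h \<in> Hcls (rep (Rcls h))" "A \<in> Ach h" using assms(2) enc_X_even by auto
  have "g (Rcls h) \<in> carrier (schutz (rep (Rcls h)))" using assms(1,3) by (auto simp: SG_carrier)
  then show 1: "g (Rcls h) h \<in> Hcls (rep (Rcls h))" using schutz_apply h(2) by blast
  then show 2: "Rcls (g (Rcls h) h) = Rcls h" by (rule Hcls_rep_Rcls)
  then have "R_eq (g (Rcls h) h) h" by (simp add: Rcls_eq_iff)
  then show "enc (g (Rcls h) h) A \<in> X (Suc (Suc (2 * k)))"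
    unfolding enc_X_even using 1 2 h ht_R_eq Ach_R_eq by metis
qed

lemma act_other: "x \<in> X (Suc (Suc (2 * k))) \<Longrightarrow> x = {} \<or> Rcls (hpart x) \<notin> Lambda gen k \<Longrightarrow> act k g x = Some x"
  by (simp add: act_def)

lemma act_X: 
  assumes "g \<in> carrier (SG k)" "act k g x = Some y"
  shows "x \<in> X (Suc (Suc (2 * k))) \<and> y \<in> X (Suc (Suc (2 * k)))"
proof -
  have x: "x \<in> X (Suc (Suc (2 * k)))" using assms(2) by (auto simp: act_def split: if_splits)
  then show ?thesis
  proof (cases rule: X_even_cases)
    case (2 h A)
    then show ?thesis using x assms act_enc[OF assms(1), of h A] act_other[OF x, of g]
      by (cases "Rcls h \<in> Lambda gen k") auto
  qed (use assms act_other[OF x, of g] x in auto)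
qed

lemma act_mult:
  assumes "g \<in> carrier (SG k)" "g' \<in> carrier (SG k)"
  shows "act k (g \<otimes>\<^bsub>SG k\<^esub> g') = pcomp (act k g) (act k g')"
proof
  fix x
  show "act k (g \<otimes>\<^bsub>SG k\<^esub> g') x = pcomp (act k g) (act k g') x"
  proof (cases "x \<in> X (Suc (Suc (2 * k)))")
    case True
    note x = True
    show ?thesis
    proof (cases "x = {} \<or> Rcls (hpart x) \<notin> Lambda gen k")
      case True
      then show ?thesis using act_other[OF x True] by (simp add: pcomp_def)
    next
      case False
      with x obtain h A where h: "x = enc h A" "h \<in> Hcls (rep (Rcls h))" by (auto elim: X_even_cases)
      have L: "Rcls h \<in> Lambda gen k" using False h by simp
      have gg: "g \<otimes>\<^bsub>SG k\<^esub> g' \<in> carrier (SG k)"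
        using assms group_SG by (intro monoid.m_closed group.is_monoid)
      have X: "enc h A \<in> X (Suc (Suc (2 * k)))" using x h by simp
      note a = act_enc[OF assms(1) X L]
      have "act k g' (enc (g (Rcls h) h) A) = Some (enc (g' (Rcls h) (g (Rcls h) h)) A)"
        using act_enc(1)[OF assms(2) a(4)] a(2) L by simp
      moreover have "(g \<otimes>\<^bsub>SG k\<^esub> g') (Rcls h) h = g' (Rcls h) (g (Rcls h) h)"
        using L h(2) by (simp add: schutzR_rep schutz_mult del: Hcls_iff)
      ultimately show ?thesis
        unfolding h(1) act_enc(1)[OF gg X L] by (simp add: pcomp_def a(1))
    qed
  qed (simp add: act_def pcomp_def)
qed

lemma act_one: "act k \<one>\<^bsub>SG k\<^esub> = idX (X (Suc (Suc (2 * k))))"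
proof
  fix x
  show "act k \<one>\<^bsub>SG k\<^esub> x = idX (X (Suc (Suc (2 * k)))) x"
  proof (cases "x \<in> X (Suc (Suc (2 * k)))")
    case True
    then show ?thesis
    proof (cases rule: X_even_cases)
      case (2 h A)
      then show ?thesis using True
        by (cases "Rcls h \<in> Lambda gen k")
          (simp_all add: act_def idX_def schutzR_rep schutz_one del: Hcls_iff)
    qed (use True in \<open>simp add: act_def idX_def\<close>)
  qed (simp add: act_def idX_def)
qed

lemma act_pmaps: "g \<in> carrier (SG k) \<Longrightarrow> act k g \<in> pmaps (X (Suc (Suc (2 * k))))"
  using act_X by (auto simp: pmaps_def)

lemma act_perms:
  assumes "g \<in> carrier (SG k)"
  shows "act k g \<in> perms (X (Suc (Suc (2 * k))))"
proof -
  let ?i = "inv\<^bsub>SG k\<^esub> g"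
  have i: "?i \<in> carrier (SG k)" "g \<otimes>\<^bsub>SG k\<^esub> ?i = \<one>\<^bsub>SG k\<^esub>" "?i \<otimes>\<^bsub>SG k\<^esub> g = \<one>\<^bsub>SG k\<^esub>"
    using group.inv_closed[OF group_SG assms] group.r_inv[OF group_SG assms] group.l_inv[OF group_SG assms]
    by blast+
  show ?thesis
    by (rule perms_of_inverse[OF act_pmaps[OF assms] act_pmaps[OF i(1)]])
      (metis act_mult assms i act_one)+
qed

lemma act_inj: "inj_on (act k) (carrier (SG k))"
proof (rule inj_onI)
  fix g g' assume g: "g \<in> carrier (SG k)" "g' \<in> carrier (SG k)" "act k g = act k g'"
  show "g = g'"
  proof (rule PiE_ext)
    show "g \<in> (\<Pi>\<^sub>E R\<in>Lambda gen k. carrier (schutz (rep R)))"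
      "g' \<in> (\<Pi>\<^sub>E R\<in>Lambda gen k. carrier (schutz (rep R)))" using g SG_carrier by auto
    then have gR: "g R \<in> carrier (schutz (rep R))" "g' R \<in> carrier (schutz (rep R))"
      if "R \<in> Lambda gen k" for R using that by auto
    fix R assume R: "R \<in> Lambda gen k"
    show "g R = g' R"
    proof (rule extensionalityI[OF schutz_ext[OF gR(1)[OF R]] schutz_ext[OF gR(2)[OF R]]])
      fix h assume h: "h \<in> Hcls (rep R)"
      obtain m where m: "R = Rcls m" "ht m = k" using Lambda_height[OF R] by blast
      have hR: "Rcls h = R" using Hcls_rep_Rcls h m by metis
      have "ht h = k" using hR m ht_R_eq Rcls_eq_iff by metis
      then have X: "enc h {} \<in> X (Suc (Suc (2 * k)))"
        unfolding enc_X_even using h hR by (simp add: Ach_def)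
      show "g R h = g' R h"
        using act_enc(1)[OF g(1) X] act_enc(1)[OF g(2) X] g(3) R hR by simp
    qed
  qed
qed

text \<open>Taking all constant maps makes closure immediate from \<open>constmaps_absorb\<close>.
  For i = 2k + 2 the index \<open>i div 2 - 1\<close> is k.\<close>

definition Mo :: "nat \<Rightarrow> (('m, 'y) xelem \<Rightarrow> ('m, 'y) xelem option) set" where
  "Mo i = constmaps (X i) \<union> (if odd i then {idX (X i)} else act (i div 2 - 1) ` carrier (SG (i div 2 - 1)))"

lemma Mo_odd: "Mo (Suc (2 * k)) = insert (idX (X (Suc (2 * k)))) (constmaps (X (Suc (2 * k))))"
  and Mo_even: "Mo (Suc (Suc (2 * k))) = constmaps (X (Suc (Suc (2 * k)))) \<union> act k ` carrier (SG k)"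
  by (simp_all add: Mo_def)

lemma idX_Mo: "idX (X (Suc i)) \<in> Mo (Suc i)"
proof (cases "even i")
  case False
  then obtain k where "i = Suc (2 * k)" by (metis oddE Suc_eq_plus1)
  moreover have "\<one>\<^bsub>SG k\<^esub> \<in> carrier (SG k)"
    using group_SG by (intro monoid.one_closed group.is_monoid)
  ultimately show ?thesis unfolding Mo_even by (metis (no_types) UnI2 act_one image_eqI Mo_even)
qed (simp add: Mo_def)

lemma Mo_pmaps: "Mo (Suc i) \<subseteq> pmaps (X (Suc i))"
proof (cases "even i")
  case True
  then show ?thesis using idX_pmaps by (auto simp: Mo_def constmaps_def)
next
  case False
  then obtain k where i: "i = Suc (2 * k)" by (metis oddE Suc_eq_plus1)
  show ?thesis unfolding i Mo_even using act_pmaps by (auto simp: constmaps_def)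
qed

lemma pmonoid_Mo: "pmonoid (X (Suc i)) (Mo (Suc i))"
  unfolding pmonoid_def
proof (intro conjI ballI)
  fix f g assume fg: "f \<in> Mo (Suc i)" "g \<in> Mo (Suc i)"
  then have p: "f \<in> pmaps (X (Suc i))" "g \<in> pmaps (X (Suc i))" using Mo_pmaps by blast+
  show "pcomp f g \<in> Mo (Suc i)"
  proof (cases "f \<in> constmaps (X (Suc i)) \<or> g \<in> constmaps (X (Suc i))")
    case True
    then show ?thesis using constmaps_absorb[OF p] by (simp add: Mo_def)
  next
    case nc: False
    show ?thesis
    proof (cases "even i")
      case True
      then have "f = idX (X (Suc i))" using fg nc by (simp add: Mo_def)
      then show ?thesis using fg pcomp_idX(1)[OF p(2)] by simp
    next
      case False
      then obtain k where i: "i = Suc (2 * k)" by (metis oddE Suc_eq_plus1)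
      obtain a b where ab: "a \<in> carrier (SG k)" "b \<in> carrier (SG k)" "f = act k a" "g = act k b"
        using fg nc unfolding i Mo_even by blast
      then have "pcomp f g = act k (a \<otimes>\<^bsub>SG k\<^esub> b)" by (simp only: act_mult)
      moreover have "a \<otimes>\<^bsub>SG k\<^esub> b \<in> carrier (SG k)"
        using ab group_SG by (intro monoid.m_closed group.is_monoid)
      ultimately show ?thesis unfolding i Mo_even by blast
    qed
  qed
qed (use Mo_pmaps idX_Mo in auto)

lemma pgroup_Mo: "pgroup (X (Suc (Suc (2 * k)))) (Mo (Suc (Suc (2 * k)))) \<cong> SG k"
proof -
  let ?X = "X (Suc (Suc (2 * k)))" and ?M = "Mo (Suc (Suc (2 * k)))"
  have car: "?M \<inter> perms ?X = act k ` carrier (SG k)"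
  proof
    show "?M \<inter> perms ?X \<subseteq> act k ` carrier (SG k)"
    proof
      fix f assume f: "f \<in> ?M \<inter> perms ?X"
      show "f \<in> act k ` carrier (SG k)"
      proof (cases "f \<in> constmaps ?X")
        case True
        then have "f = act k \<one>\<^bsub>SG k\<^esub>" using f perm_constmap unfolding act_one by blast
        moreover have "\<one>\<^bsub>SG k\<^esub> \<in> carrier (SG k)"
          using group_SG by (intro monoid.one_closed group.is_monoid)
        ultimately show ?thesis by blast
      qed (use f Mo_even in blast)
    qed
    show "act k ` carrier (SG k) \<subseteq> ?M \<inter> perms ?X" unfolding Mo_even using act_perms by blast
  qed
  have "act k \<in> iso (SG k) (pgroup ?X ?M)"
  proof (rule isoI)
    show "act k \<in> hom (SG k) (pgroup ?X ?M)"
      by (rule homI) (simp_all only: pgroup_def car partial_object.simps monoid.simps imageI act_mult)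
    show "bij_betw (act k) (carrier (SG k)) (carrier (pgroup ?X ?M))"
      using act_inj by (simp add: bij_betw_def pgroup_def car)
  qed
  then have "SG k \<cong> pgroup ?X ?M" by (rule is_isoI)
  then show ?thesis by (rule group.iso_sym[OF group_SG])
qed

end

section \<open>Finiteness for finitely many generators\<close>

lemma finite_pmaps:
  assumes "finite Z"
  shows "finite (pmaps Z)"
proof -
  have "pmaps Z \<subseteq> (\<lambda>g x. if x \<in> Z then g x else None) ` (Z \<rightarrow>\<^sub>E insert None (Some ` Z))"
  proof
    fix f assume f: "f \<in> pmaps Z"
    have r: "restrict f Z \<in> Z \<rightarrow>\<^sub>E insert None (Some ` Z)"
    proof (rule restrict_PiE_iff[THEN iffD2], rule ballI)
      fix x assume "x \<in> Z"
      show "f x \<in> insert None (Some ` Z)"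
        using f unfolding pmaps_def by (cases "f x") auto
    qed
    have "f x = None" if "x \<notin> Z" for x
      using f that unfolding pmaps_def by (cases "f x") auto
    then have "f = (\<lambda>x. if x \<in> Z then restrict f Z x else None)" by (intro ext) simp
    then show "f \<in> (\<lambda>g x. if x \<in> Z then g x else None) ` (Z \<rightarrow>\<^sub>E insert None (Some ` Z))"
      using r by (rule image_eqI)
  qed
  moreover have "finite (Z \<rightarrow>\<^sub>E insert None (Some ` Z))" using assms by (intro finite_PiE) auto
  ultimately show ?thesis by (meson finite_imageI finite_subset)
qed

context finite_above
begin

text \<open>Read a word for m from the left and take the last letter y that raises the height, with
  a the prefix before it; from then on the prefixes stay R-equivalent.\<close>

lemma factor_lower:
  assumes "\<exists>ys. ys \<noteq> [] \<and> m = fold (\<lambda>y acc. acc * gen y) (tl ys) (gen (hd ys))"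
  shows "\<exists>y a. ht a < ht (Some m) \<and> J_le (a \<bullet> Some (gen y)) (Some m)"
proof -
  have "\<exists>y a. ht a < ht (Some (fold (\<lambda>y acc. acc * gen y) zs (gen y0)))
      \<and> J_le (a \<bullet> Some (gen y)) (Some (fold (\<lambda>y acc. acc * gen y) zs (gen y0)))" for zs y0
  proof (induction zs rule: rev_induct)
    case Nil
    have "0 < ht (Some (gen y0))" by (metis gr0I ht_eq_0 option.distinct(1))
    then show ?case by (intro exI[of _ y0] exI[of _ None]) simp
  next
    case (snoc y zs)
    let ?m = "fold (\<lambda>y acc. acc * gen y) zs (gen y0)"
    have f: "Some (fold (\<lambda>y acc. acc * gen y) (zs @ [y]) (gen y0)) = Some ?m \<bullet> Some (gen y)" by simp
    show ?case
    proof (cases "ht (Some ?m) < ht (Some ?m \<bullet> Some (gen y))")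
      case True
      then show ?thesis unfolding f by (intro exI[of _ y] exI[of _ "Some ?m"]) simp
    next
      case False
      then have e: "ht (Some ?m \<bullet> Some (gen y)) = ht (Some ?m)" using ht_om[of "Some ?m" "Some (gen y)"] by linarith
      then have "J_le (Some ?m) (Some ?m \<bullet> Some (gen y))"
        using R_eq_iff_ht unfolding R_eq_def by (blast intro: R_le_imp_J_le)
      then show ?thesis using snoc J_le_trans unfolding f e by blast
    qed
  qed
  then show ?thesis using assms by metis
qed

text \<open>By \<open>factor_lower\<close>, an element of height \<open>Suc k\<close> is J-above one
  of the finitely many products a y with a of height at most k, and each of these has a finite set
  above it.\<close>

lemma finite_ht:
  assumes Ygen: "\<forall>m::'m. \<exists>ys. ys \<noteq> [] \<and> m = fold (\<lambda>y acc. acc * gen y) (tl ys) (gen (hd ys))"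
    and fin: "finite (UNIV :: 'y set)"
  shows "finite {x :: 'm option. ht x \<le> k}"
proof (induction k)
  case (Suc k)
  have "{x. ht x \<le> Suc k} \<subseteq> {x. ht x \<le> k} \<union>
      (\<Union>a\<in>{x. ht x \<le> k}. \<Union>y. {x. J_le (a \<bullet> Some (gen y)) x})"
  proof clarify
    fix x assume x: "ht x \<le> Suc k" "x \<notin> (\<Union>a\<in>{x. ht x \<le> k}. \<Union>y. {x. J_le (a \<bullet> Some (gen y)) x})"
    show "ht x \<le> k"
    proof (cases x)
      case (Some m)
      obtain y a where ya: "ht a < ht x" "J_le (a \<bullet> Some (gen y)) x"
        using factor_lower[OF spec[OF Ygen, of m]] Some by blast
      have "\<not> ht a \<le> k" using x(2) ya(2) by blast
      then show ?thesis using ya(1) x(1) by linarith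
    qed simp
  qed
  moreover have "finite \<dots>" using Suc fin finite_above by (intro finite_UnI finite_UN_I)
  ultimately show ?case by (rule finite_subset)
qed simp

lemma finite_X:
  assumes fin: "finite (UNIV :: 'y set)" "\<And>k. finite {x :: 'm option. ht x \<le> k}"
  shows "finite (X i)"
proof -
  let ?k = "(i - 1) div 2"
  have k: "finite {x :: 'm option. ht x = ?k}" by (rule finite_subset[OF _ fin(2)[of ?k]]) auto
  have A: "finite (UNIV :: 'y set set)" using fin(1) by (metis Pow_UNIV finite_Pow_iff)
  have "X i \<subseteq> insert {} ((\<lambda>x. encR (Rcls x)) ` {x. ht x = ?k} \<union> (\<lambda>(h, A). enc h A) ` ({x. ht x = ?k} \<times> UNIV))"
    by (auto simp: X_def Let_def)
  moreover have "finite \<dots>" using k A by simp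
  ultimately show ?thesis by (rule finite_subset)
qed

text \<open>The group element is supported on the R-class of \<open>elt k s\<close>: there it is the
  translation from \<open>code_even_translation\<close>, while coordinates of other R-classes are
  unrealized and hence fixed.\<close>

lemma localmap_even:
  assumes s: "s \<in> chains" and t: "t \<in> chains" "t \<noteq> [None]" and d: "enat (Suc (Suc (2 * k))) \<le> \<delta>"
    and i: "idt k s t"
  shows "\<exists>g\<in>carrier (SG k). localmap (\<phi> \<delta> t) (codes code (Suc (2 * k)) s) = act k g"
proof (cases "ht (elt k s) = k")
  case False
  have dummy: "code (Suc (Suc (2 * k))) r = {}" if "ht (elt k r) \<noteq> k" for r
    using that by (simp add: code_even)
  have "localmap (\<phi> \<delta> t) (codes code (Suc (2 * k)) s) = idX (X (Suc (Suc (2 * k))))"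
  proof (rule localmap_idt_fixed[OF s t d])
    fix s' assume s': "s' \<in> chains" "codes code (Suc (2 * k)) s' = codes code (Suc (2 * k)) s"
    then have u: "up k s' = up k s" "nx k s' = nx k s" using codes_odd_iff[OF s'(1) s] by auto
    have "ht (elt k s') \<noteq> k" using elt_cong(2)[OF s'(1) s u] False by simp
    moreover have "idt k s' t" using idt_cong[OF s'(1) s u] i by simp
    ultimately show "code (Suc (Suc (2 * k))) (rh_mult s' t) = code (Suc (Suc (2 * k))) s'"
      using ht_R_eq[OF idt_rh_mult(3)[OF s'(1) t]] by (simp add: dummy)
  qed (use i in simp)
  then show ?thesis
    using act_one[of k] monoid.one_closed[OF group.is_monoid[OF group_SG]] by metis
next
  case True
  let ?R = "Rcls (elt k s)" and ?X = "X (Suc (Suc (2 * k)))"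
  obtain n where n: "\<And>h. h \<in> Hcls (rep ?R) \<Longrightarrow> h \<bullet> n \<in> Hcls (rep ?R)"
    and tr: "\<And>s'. \<lbrakk>s' \<in> chains; codes code (Suc (2 * k)) s' = codes code (Suc (2 * k)) s\<rbrakk> \<Longrightarrow>
      \<exists>h A. code (Suc (Suc (2 * k))) s' = enc h A \<and> code (Suc (Suc (2 * k))) (rh_mult s' t) = enc (h \<bullet> n) A"
    using code_even_translation[OF s t i True] by blast
  define g where "g = (\<lambda>R\<in>Lambda gen k. if R = ?R then restrict (\<lambda>h. h \<bullet> n) (Hcls (rep R))
    else \<one>\<^bsub>schutz (rep R)\<^esub>)"
  have "restrict (\<lambda>h. h \<bullet> n) (Hcls (rep ?R)) \<in> carrier (schutz (rep ?R))"
    unfolding schutz_carrier using n by blast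
  then have g: "g \<in> carrier (SG k)"
    unfolding SG_carrier g_def
    by (auto simp: monoid.one_closed[OF group.is_monoid[OF group_schutz]] split: if_splits
        intro!: finite_subset[of _ "{?R}"])
  \<comment> \<open>If the R-class is not in \<open>Lambda\<close>, g has no component for it, so
    the translation has to be trivial.\<close>
  have triv: "h \<bullet> n = h" if "?R \<notin> Lambda gen k" "h \<in> Hcls (rep ?R)" for h
    using schutz_not_Lambda[OF True that(1) _ that(2)] n by blast
  have "localmap (\<phi> \<delta> t) (codes code (Suc (2 * k)) s) x = act k g x" for x
  proof (cases "x \<in> ?X")
    case False
    then have "localmap (\<phi> \<delta> t) (codes code (Suc (2 * k)) s) x = None"
      using localmap_Some_iff(1)[OF _ t(1) length_codes[of code "Suc (2 * k)" s]]
      by (cases "localmap (\<phi> \<delta> t) (codes code (Suc (2 * k)) s) x") blast+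
    then show ?thesis using False by (simp add: act_def)
  next
    case x: True
    note inv = localmap_invalid[OF s t x d]
    have i': "idt (Suc (2 * k) div 2) s t" using i by simp
    note vo = valid_odd[OF s True]
    show ?thesis using x
    proof (cases rule: X_even_cases)
      case 1
      then have "x \<notin> valid (Suc (2 * k)) s" unfolding vo by auto
      then show ?thesis using inv i' act_other[OF x, of g] 1 by simp
    next
      case (2 h A)
      show ?thesis
      proof (cases "Rcls h = ?R")
        case True
        then have hR: "R_eq h (elt k s)" by (simp add: Rcls_eq_iff)
        then have "x \<in> valid (Suc (2 * k)) s" unfolding vo using 2 by blast
        then obtain s' where s': "s' \<in> chains" "codes code (Suc (2 * k)) s' = codes code (Suc (2 * k)) s"
          "x = code (Suc (Suc (2 * k))) s'" by (auto simp: valid_def)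
        have "localmap (\<phi> \<delta> t) (codes code (Suc (2 * k)) s) x = Some (code (Suc (Suc (2 * k))) (rh_mult s' t))"
          using localmap_valid[OF s'(1) t(1) d] unfolding s'(2) s'(3) .
        also have "\<dots> = Some (enc (h \<bullet> n) A)" using tr[OF s'(1,2)] 2(1) s'(3) by auto
        also have "\<dots> = act k g x"
        proof (cases "?R \<in> Lambda gen k")
          case L: True
          have "g ?R h = h \<bullet> n" using L 2(3) True unfolding g_def by (simp del: Hcls_iff)
          then show ?thesis using act_enc(1)[OF g, of h A] x 2(1) L True by simp
        next
          case L: False
          then have "act k g x = Some x" using act_other[OF x] 2(1) True by simp
          then show ?thesis using triv[OF L] 2(1,3) True by simp
        qed
        finally show ?thesis .
      next
        case False
        then have "\<not> R_eq h (elt k s)" by (simp add: Rcls_eq_iff)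
        then have "x \<notin> valid (Suc (2 * k)) s" unfolding vo using 2(1) by auto
        then have "localmap (\<phi> \<delta> t) (codes code (Suc (2 * k)) s) x = Some x" using inv i' by simp
        also have "\<dots> = act k g x"
        proof (cases "Rcls h \<in> Lambda gen k")
          case L: True
          have "g (Rcls h) h = h" using L 2(3) False unfolding g_def by (simp add: schutz_one del: Hcls_iff)
          then show ?thesis using act_enc(1)[OF g, of h A] x 2(1) L by simp
        next
          case L: False
          then show ?thesis using act_other[OF x, of g] 2(1) by simp
        qed
        finally show ?thesis .
      qed
    qed
  qed
  then show ?thesis using g by (intro bexI[of _ g] ext)
qed

lemma phi_wreath:
  assumes t: "t \<in> chains"
  shows "\<phi> \<delta> t \<in> wreath X Mo \<delta>"
proof -
  have "localmap (\<phi> \<delta> t) ctx \<in> Mo (Suc j)" if ctx: "enat (Suc j) \<le> \<delta>" "tuples X j ctx" for j ctx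
  proof (cases "t = [None]")
    case True
    then show ?thesis using localmap_wid[OF ctx(2,1)] idX_Mo phi_one by simp
  next
    case t': False
    have len: "length ctx = j" using ctx(2) by (rule tuples_length)
    show ?thesis
    proof (cases "\<exists>s\<in>chains. ctx = codes code (length ctx) s")
      case False
      \<comment> \<open>The empty map counts as a constant map.\<close>
      have "(\<lambda>_. None) \<in> constmaps (X (Suc j))" by (simp add: constmaps_def pmaps_def)
      then show ?thesis using localmap_no_code[OF t' False] by (simp add: Mo_def)
    next
      case True
      then obtain s where s: "s \<in> chains" "ctx = codes code j s" using len by auto
      show ?thesis
      proof (cases "idt (j div 2) s t")
        case False
        then show ?thesis using localmap_not_idt[OF s(1) t t' False] s(2) by (simp add: Mo_def)
      next
        case i: True
        show ?thesis
        proof (cases "even j")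
          case True
          then obtain k where j: "j = 2 * k" by blast
          have "localmap (\<phi> \<delta> t) ctx = idX (X (Suc j))"
            unfolding s(2)
          proof (rule localmap_idt_fixed[OF s(1) t t' ctx(1) i])
            fix s' assume s': "s' \<in> chains" "codes code j s' = codes code j s"
            have "idt k s' t"
              using idt_cong[OF s'(1) s(1)] idt_level[OF s'(1) s(1) s'(2)] i by (simp add: j)
            then show "code (Suc j) (rh_mult s' t) = code (Suc j) s'"
              using idt_code_odd[OF s'(1) t t'] by (simp add: j)
          qed
          then show ?thesis using idX_Mo by simp
        next
          case False
          then obtain k where j: "j = Suc (2 * k)" by (metis oddE Suc_eq_plus1)
          have "idt k s t" using i j by simp
          from localmap_even[OF s(1) t t' _ this] ctx(1)
          show ?thesis unfolding s(2) j Mo_even by blast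
        qed
      qed
    qed
  qed
  then have "\<forall>i ctx. 1 \<le> i \<and> enat i \<le> \<delta> \<and> tuples X (i - 1) ctx \<longrightarrow> localmap (\<phi> \<delta> t) ctx \<in> Mo i"
    by (metis Suc_diff_1 less_eq_Suc_le One_nat_def)
  then show ?thesis unfolding wreath_def using phi_sequential[OF t] by blast
qed

lemma phi_zeiger:
  assumes S: "S \<subseteq> chains"
  shows "zeiger X \<delta> S (\<phi> \<delta>)"
  unfolding zeiger_def
proof (intro ballI allI impI, elim conjE)
  fix t k ctx q ext x y
  assume t0: "t \<in> S" and ctx: "tuples X (2 * k + 1) ctx"
    and f: "localmap (\<phi> \<delta> t) ctx \<in> perms (X (2 * k + 2)) - constmaps (X (2 * k + 2))"
    and q: "2 * k + 2 \<le> q - 1" "enat (q - 1) < \<delta>" and ext: "tuples X (q - 1) ext"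
    and dr: "drop (q - 1 - (2 * k + 1)) ext = ctx"
    and xy: "localmap (\<phi> \<delta> t) ext x = Some y"
  have t: "t \<in> chains" using S t0 by blast
  define j where "j = q - 1"
  have qj: "q = Suc j" using q(1) by (simp add: j_def)
  have len: "length ext = j" using ext by (simp add: tuples_length j_def)
  have d: "enat (Suc j) \<le> \<delta>" using localmap_Some_iff(3)[OF xy t len] .
  have "localmap (\<phi> \<delta> t) ext = idX (X (Suc j))"
  proof (cases "t = [None]")
    case True
    then show ?thesis using localmap_wid[of X j ext] ext d phi_one j_def by simp
  next
    case t': False
    have "\<exists>s\<in>chains. ext = codes code (length ext) s"
      using localmap_no_code[OF t', of ext] xy by fastforce
    then obtain s where s: "s \<in> chains" "ext = codes code j s" using len by auto
    have j: "Suc (Suc (2 * k)) \<le> j" using q(1) by (simp add: j_def)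
    have c: "ctx = codes code (Suc (2 * k)) s"
      using dr drop_codes[of "Suc (2 * k)" j code s] s(2) j by (simp add: j_def)
    \<comment> \<open>A drop at level k would make the local map constant.\<close>
    have "idt (Suc (2 * k) div 2) s t"
    proof (rule ccontr)
      assume "\<not> idt (Suc (2 * k) div 2) s t"
      from localmap_not_idt[OF s(1) t t' this] c f show False by simp
    qed
    then have i: "idt k s t" by simp
    show ?thesis
      unfolding s(2)
    proof (rule localmap_idt_fixed[OF s(1) t t' d])
      show "idt (j div 2) s t" using idt_below[OF s(1) t t' i] j by simp
    next
      fix s' assume s': "s' \<in> chains" "codes code j s' = codes code j s"
      have "codes code (2 * k) s' = codes code (2 * k) s"
        by (rule codes_eq_mono[OF s'(2)]) (use j in simp)
      then have i': "idt k s' t" using idt_cong[OF s'(1) s(1)] codes_even_iff[OF s'(1) s(1)] i by simp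
      show "code (Suc j) (rh_mult s' t) = code (Suc j) s'"
      proof (cases "even j")
        case True
        then obtain k' where k': "j = 2 * k'" by blast
        then have "idt k' s' t" using idt_below[OF s'(1) t t' i'] j by simp
        then show ?thesis using idt_code_odd[OF s'(1) t t'] k' by simp
      next
        case False
        \<comment> \<open>The level l of this even coordinate exceeds k, so the level just above it
          in the chain is still at least k, as \<open>code_even_below\<close> demands.\<close>
        then obtain l where l: "j = Suc (2 * l)" by (metis oddE Suc_eq_plus1)
        then have "k < l" using j by simp
        then obtain k' where k': "l = Suc k'" "k \<le> k'" by (cases l) auto
        have "idt k' s' t" using idt_below[OF s'(1) t t' i' k'(2)] .
        then show ?thesis using code_even_below[OF s'(1) t t'] l k'(1) by simp
      qed
    qed
  qed
  then show "x \<in> X q \<and> y = x" using xy qj by (auto simp: idX_def split: if_splits)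
qed

text \<open>Two chains whose heads have height at most k are separated by 2k + 2 coordinates, which
  is where the value of \<delta> comes from.\<close>

lemma phi_inj_on:
  assumes "\<And>m :: 'm. enat (ht (Some m)) \<le> h" "\<delta> = 2 + 2 * h"
  shows "inj_on (\<phi> \<delta>) chains"
proof (rule phi_inj)
  fix s s' assume s: "s \<in> chains" "s' \<in> chains" "s \<noteq> s'"
  define k where "k = max (ht (hd s)) (ht (hd s'))"
  have "enat (ht (x :: 'm option)) \<le> h" for x
    using assms(1) by (cases x) (simp_all flip: zero_enat_def)
  then have "enat k \<le> h" by (simp add: k_def max_def)
  then have "2 + 2 * enat k \<le> \<delta>" unfolding assms(2) by (intro add_left_mono mult_left_mono) auto
  moreover have "2 + 2 * enat k = enat (2 * Suc k)" by (simp add: numeral_eq_enat)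
  ultimately have "enat (2 * Suc k) \<le> \<delta>" by simp
  moreover have "codes code (2 * Suc k) s \<noteq> codes code (2 * Suc k) s'"
    using codes_inj[OF s(1,2), of k] s(3) by (auto simp: k_def simp del: codes.simps)
  ultimately show "\<exists>i. 1 \<le> i \<and> enat i \<le> \<delta> \<and> codes code i s \<noteq> codes code i s'"
    by (intro exI[of _ "2 * Suc k"]) simp
qed

end

theorem theorem8p21:
  fixes gen :: "'y \<Rightarrow> 'm::semigroup_mult" and \<delta> :: enat
  assumes Ygen: "\<forall>m::'m. \<exists>ys. ys \<noteq> [] \<and> m = fold (\<lambda>y acc. acc * gen y) (tl ys) (gen (hd ys))"
    and fJa: "finite_J_above TYPE('m)"
    and delta: "\<delta> = 2 + 2 * (SUP m \<in> range (Some :: 'm \<Rightarrow> 'm option). hJ m)"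
  shows "\<exists>(X :: nat \<Rightarrow> ('m, 'y) xelem set) Mi \<phi>.
     (\<forall>i. 1 \<le> i \<and> enat i \<le> \<delta> \<longrightarrow> X i \<noteq> {}) \<and>
     (\<forall>\<sigma>\<in>RhY gen. \<phi> \<sigma> \<in> wreath X Mi \<delta>) \<and>
     inj_on \<phi> (RhY gen) \<and>
     \<phi> [None] = wid X \<delta> \<and>
     (\<forall>\<sigma>\<in>RhY gen. \<forall>\<tau>\<in>RhY gen. \<phi> (rh_mult \<sigma> \<tau>) = pcomp (\<phi> \<sigma>) (\<phi> \<tau>)) \<and>
     (\<forall>k. enat (2*k+1) \<le> \<delta> \<longrightarrow>
        pmonoid (X (2*k+1)) (Mi (2*k+1)) \<and>
        Mi (2*k+1) \<subseteq> insert (idX (X (2*k+1))) (constmaps (X (2*k+1)))) \<and>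
     (\<forall>k. enat (2*k+2) \<le> \<delta> \<longrightarrow>
        pmonoid (X (2*k+2)) (Mi (2*k+2)) \<and>
        Mi (2*k+2) \<subseteq> perms (X (2*k+2)) \<union> constmaps (X (2*k+2)) \<and>
        (\<exists>H. (\<forall>R\<in>Lambda gen k. subgroup (H R) (schutzR R)) \<and>
             pgroup (X (2*k+2)) (Mi (2*k+2)) \<cong>
               sum_group (Lambda gen k) (\<lambda>R. (schutzR R)\<lparr>carrier := H R\<rparr>))) \<and>
     zeiger X \<delta> (RhY gen) \<phi> \<and>
     (finite (UNIV :: 'y set) \<longrightarrow>
        (\<forall>i. 1 \<le> i \<and> enat i \<le> \<delta> \<longrightarrow> finite (X i) \<and> finite (Mi i)))"
proof -
  interpret finite_above gen by unfold_locales (fact fJa)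
  have sub: "RhY gen \<subseteq> chains" using RhY_subset_chains by blast
  have n1: "2 * k + 1 = Suc (2 * k)" and n2: "2 * k + 2 = Suc (Suc (2 * k))" for k by simp_all
  have "X i \<noteq> {}" for i by (simp add: X_def Let_def)
  moreover have "\<forall>\<sigma>\<in>RhY gen. \<phi> \<delta> \<sigma> \<in> wreath X Mo \<delta>" using phi_wreath sub by blast
  moreover have "inj_on (\<phi> \<delta>) (RhY gen)"
  proof (rule inj_on_subset[OF phi_inj_on[OF _ delta] sub])
    show "enat (ht (Some m)) \<le> (SUP m \<in> range (Some :: 'm \<Rightarrow> 'm option). hJ m)" for m :: 'm
      by (metis SUP_upper hJ_ht rangeI)
  qed
  moreover have "\<phi> \<delta> [None] = wid X \<delta>" by (rule phi_one)
  moreover have "\<forall>\<sigma>\<in>RhY gen. \<forall>\<tau>\<in>RhY gen. \<phi> \<delta> (rh_mult \<sigma> \<tau>) = pcomp (\<phi> \<delta> \<sigma>) (\<phi> \<delta> \<tau>)"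
    using phi_mul sub by blast
  moreover have "pmonoid (X (2*k+1)) (Mo (2*k+1)) \<and>
      Mo (2*k+1) \<subseteq> insert (idX (X (2*k+1))) (constmaps (X (2*k+1)))" for k
    unfolding n1 using pmonoid_Mo[of "2 * k"] Mo_odd[of k] by blast
  moreover have "pmonoid (X (2*k+2)) (Mo (2*k+2)) \<and>
      Mo (2*k+2) \<subseteq> perms (X (2*k+2)) \<union> constmaps (X (2*k+2)) \<and>
      (\<exists>H. (\<forall>R\<in>Lambda gen k. subgroup (H R) (schutzR R)) \<and>
           pgroup (X (2*k+2)) (Mo (2*k+2)) \<cong>
             sum_group (Lambda gen k) (\<lambda>R. (schutzR R)\<lparr>carrier := H R\<rparr>))" for k
  \<comment> \<open>Every G'_\<lambda> is taken to be the full Schuetzenberger group.\<close>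
  proof (intro conjI exI[of _ "\<lambda>R. carrier (schutzR R)"] ballI)
    show "pmonoid (X (2*k+2)) (Mo (2*k+2))" unfolding n2 by (rule pmonoid_Mo)
    show "Mo (2*k+2) \<subseteq> perms (X (2*k+2)) \<union> constmaps (X (2*k+2))"
      unfolding n2 Mo_even using act_perms by blast
    show "subgroup (carrier (schutzR R)) (schutzR R)" for R
      by (rule group.subgroup_self[OF group_schutzR])
    show "pgroup (X (2*k+2)) (Mo (2*k+2)) \<cong>
        sum_group (Lambda gen k) (\<lambda>R. (schutzR R)\<lparr>carrier := carrier (schutzR R)\<rparr>)"
      unfolding n2 using pgroup_Mo by simp
  qed
  moreover have "zeiger X \<delta> (RhY gen) (\<phi> \<delta>)" by (rule phi_zeiger[OF sub])
  moreover have "finite (X i) \<and> finite (Mo i)" if fin: "finite (UNIV :: 'y set)" and i: "1 \<le> i" for i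
  proof -
    have X: "finite (X i)" using finite_X[OF fin finite_ht[OF Ygen fin]] .
    have "Mo i \<subseteq> pmaps (X i)" using Mo_pmaps[of "i - 1"] i by simp
    then show ?thesis using X finite_pmaps finite_subset by blast
  qed
  ultimately show ?thesis by (intro exI[of _ X] exI[of _ Mo] exI[of _ "\<phi> \<delta>"]) blast
qed

end
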